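(* Let $(H,\langle\cdot,\cdot\rangle,\|\cdot\|)$ be a real Hilbert space and $A$ a strictly positive selfadjoint operator on $H$ with domain $\mathcal D(A)\subset H$ (the embedding not necessarily compact). Let $\alpha,\beta,\gamma,\kappa>0$ and $\eta\in\mathbb R$ with $\mu:=\gamma-\alpha\beta\ge 0$. Consider the problem $$\begin{cases} u_{ttt}+\alpha u_{tt}+\beta A u_t+\gamma A u=\eta A\theta,\\ \theta_t+\kappa A\theta=-\eta A u_{tt}-\alpha\eta A u_t,\end{cases}\qquad u(0)=u_0,\ u_t(0)=v_0,\ u_{tt}(0)=w_0,\ \theta(0)=\theta_0.$$ Then for every $\boldsymbol u_0=(u_0,v_0,w_0,\theta_0)\in\mathcal H$ the problem admits a unique weak solution $$t\mapsto \boldsymbol u(t)=(u(t),u_t(t),u_{tt}(t),\theta(t))\in\mathcal C([0,\infty),\mathcal H),$$ and for every fixed $t\ge0$ the map $\boldsymbol u_0\mapsto\boldsymbol u(t)$ belongs to $\mathcal C(\mathcal H,\mathcal H)$. Consequently the system generates a strongly continuous semigroup $S(t)$ on $\mathcal H$, $S(t)\boldsymbol u_0=\boldsymbol u(t)$.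
   Context: For $\sigma\in\mathbb R$, $H^\sigma=\mathcal D(A^{\sigma/2})$ with inner product $\langle u,v\rangle_\sigma=\langle A^{\sigma/2}u,A^{\sigma/2}v\rangle$ and norm $\|u\|_\sigma=\|A^{\sigma/2}u\|$ (for $\sigma>0$, $H^{-\sigma}$ is the completion, the dual of $H^\sigma$). The phase space is $\mathcal H=H^1\times H^1\times H\times H$ with norm $\|(u,v,w,\theta)\|_{\mathcal H}^2=\|v+\alpha u\|_1^2+\|w+\alpha v\|^2+\|v\|_1^2+\|\theta\|^2$, equivalent to the product norm. A concrete instance is $A=-\Delta$ with Dirichlet boundary conditions on $H=L^2(\Omega)$, $H^1=H^1_0(\Omega)$. *)

theory Defs
  imports "HOL-Analysis.Analysis"
begin

definition strictly_pos_selfadjoint :: "'a::{real_inner,complete_space} set \<Rightarrow> ('a \<Rightarrow> 'a) \<Rightarrow> bool" where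
  "strictly_pos_selfadjoint D A \<longleftrightarrow>
     subspace D \<and> closure D = UNIV \<and>
     (\<forall>x\<in>D. \<forall>y\<in>D. A (x + y) = A x + A y) \<and>
     (\<forall>c. \<forall>x\<in>D. A (c *\<^sub>R x) = c *\<^sub>R A x) \<and>
     (\<forall>x\<in>D. \<forall>y\<in>D. inner (A x) y = inner x (A y)) \<and>
     (\<forall>v w. (\<forall>u\<in>D. inner (A u) v = inner u w) \<longrightarrow> v \<in> D \<and> A v = w) \<and>
     (\<exists>c>0. \<forall>x\<in>D. inner (A x) x \<ge> c * (norm x)\<^sup>2)"

text \<open>The set whose supremum is the norm of A^(1/2) u (D(A) is a core for A^(1/2)).\<close>
definition half_set :: "'a::real_inner set \<Rightarrow> ('a \<Rightarrow> 'a) \<Rightarrow> 'a \<Rightarrow> real set" where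
  "half_set D A u = insert 0 {inner u (A \<phi>) / sqrt (inner (A \<phi>) \<phi>) | \<phi>. \<phi> \<in> D \<and> \<phi> \<noteq> 0}"

text \<open>H^1 = D(A^(1/2)) and its norm.\<close>
definition H1 :: "'a::real_inner set \<Rightarrow> ('a \<Rightarrow> 'a) \<Rightarrow> 'a set" where
  "H1 D A = {u. bdd_above (half_set D A u)}"

definition norm1 :: "'a::real_inner set \<Rightarrow> ('a \<Rightarrow> 'a) \<Rightarrow> 'a \<Rightarrow> real" where
  "norm1 D A u = Sup (half_set D A u)"

definition phase :: "'a::real_inner set \<Rightarrow> ('a \<Rightarrow> 'a) \<Rightarrow> ('a \<times> 'a \<times> 'a \<times> 'a) set" where
  "phase D A = {(u, v, w, \<theta>). u \<in> H1 D A \<and> v \<in> H1 D A}"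

definition phase_norm :: "'a::real_inner set \<Rightarrow> ('a \<Rightarrow> 'a) \<Rightarrow> real \<Rightarrow> 'a \<times> 'a \<times> 'a \<times> 'a \<Rightarrow> real" where
  "phase_norm D A \<alpha> U = (case U of (u, v, w, \<theta>) \<Rightarrow>
     sqrt ((norm1 D A (v + \<alpha> *\<^sub>R u))\<^sup>2 + (norm (w + \<alpha> *\<^sub>R v))\<^sup>2 + (norm1 D A v)\<^sup>2 + (norm \<theta>)\<^sup>2))"

definition cont_phase :: "'a::real_inner set \<Rightarrow> ('a \<Rightarrow> 'a) \<Rightarrow> real \<Rightarrow> (real \<Rightarrow> 'a \<times> 'a \<times> 'a \<times> 'a) \<Rightarrow> bool" where
  "cont_phase D A \<alpha> U \<longleftrightarrow> (\<forall>t\<ge>0. U t \<in> phase D A) \<and>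
     (\<forall>t\<ge>0. \<forall>e>0. \<exists>d>0. \<forall>s\<ge>0. \<bar>s - t\<bar> < d \<longrightarrow> phase_norm D A \<alpha> (U s - U t) < e)"

text \<open>Weak solution of the problem with data U0 (equations tested against \<psi> \<in> D(A)),
  in the class C([0,\<infinity>), phase space). Components of U t are (u, u_t, u_tt, \<theta>).\<close>
definition weak_solution ::
  "'a::{real_inner,complete_space} set \<Rightarrow> ('a \<Rightarrow> 'a) \<Rightarrow> real \<Rightarrow> real \<Rightarrow> real \<Rightarrow> real \<Rightarrow> real \<Rightarrow>
   'a \<times> 'a \<times> 'a \<times> 'a \<Rightarrow> (real \<Rightarrow> 'a \<times> 'a \<times> 'a \<times> 'a) \<Rightarrow> bool" where
  "weak_solution D A \<alpha> \<beta> \<gamma> \<kappa> \<eta> U0 U \<longleftrightarrow>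
     cont_phase D A \<alpha> U \<and>
     (\<forall>t\<ge>0. \<forall>\<psi>\<in>D.
        inner (fst (U t)) \<psi> = inner (fst U0) \<psi> + integral {0..t} (\<lambda>s. inner (fst (snd (U s))) \<psi>) \<and>
        inner (fst (snd (U t))) \<psi> = inner (fst (snd U0)) \<psi>
            + integral {0..t} (\<lambda>s. inner (fst (snd (snd (U s)))) \<psi>) \<and>
        inner (fst (snd (snd (U t)))) \<psi> = inner (fst (snd (snd U0))) \<psi>
            - integral {0..t} (\<lambda>s. \<alpha> * inner (fst (snd (snd (U s)))) \<psi>
                 + \<beta> * inner (fst (snd (U s))) (A \<psi>) + \<gamma> * inner (fst (U s)) (A \<psi>)
                 - \<eta> * inner (snd (snd (snd (U s)))) (A \<psi>)) \<and>
        inner (snd (snd (snd (U t)))) \<psi> = inner (snd (snd (snd U0))) \<psi>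
            - integral {0..t} (\<lambda>s. \<kappa> * inner (snd (snd (snd (U s)))) (A \<psi>)
                 + \<eta> * inner (fst (snd (snd (U s)))) (A \<psi>)
                 + \<alpha> * \<eta> * inner (fst (snd (U s))) (A \<psi>)))"

definition sol_op ::
  "'a::{real_inner,complete_space} set \<Rightarrow> ('a \<Rightarrow> 'a) \<Rightarrow> real \<Rightarrow> real \<Rightarrow> real \<Rightarrow> real \<Rightarrow> real \<Rightarrow>
   real \<Rightarrow> 'a \<times> 'a \<times> 'a \<times> 'a \<Rightarrow> 'a \<times> 'a \<times> 'a \<times> 'a" where
  "sol_op D A \<alpha> \<beta> \<gamma> \<kappa> \<eta> t U0 = (THE x. \<exists>U. weak_solution D A \<alpha> \<beta> \<gamma> \<kappa> \<eta> U0 U \<and> x = U t)"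

end

theory Submission
  imports Defs
begin

text \<open>
  With \<open>\<rho> = \<gamma> / \<beta>\<close>, \<open>r = v + \<rho> u\<close> and \<open>q = w + \<alpha> v\<close> the system becomes \<open>q' = - \<beta> A r + \<eta> A \<theta>\<close>,
  \<open>\<theta>' = - \<kappa> A \<theta> - \<eta> A q\<close>, with \<open>r' - q\<close> and \<open>u'\<close> bounded expressions in \<open>r\<close> and \<open>u\<close>. In the
  derivative of \<open>\<beta> |r|\<^sub>1\<^sup>2 + |q|\<^sup>2 + |\<theta>|\<^sup>2 + |u|\<^sub>1\<^sup>2\<close> the unbounded coupling terms cancel, so this energy
  grows at most exponentially; the same holds for the energy one level lower, where \<open>H\<^sup>1\<close> and \<open>H\<close>
  become \<open>H\<close> and \<open>H\<^sup>-\<^sup>1\<close>. The lower energy only involves \<open>R = A\<^sup>-\<^sup>1\<close>, which is bounded, and gives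
  uniqueness of weak solutions. For existence, \<open>R\<close> is replaced by the boundedly invertible \<open>R + \<epsilon>\<close>;
  the resulting linear equations with bounded operators commute with \<open>R\<close>, and for data in the range
  of a power of \<open>R\<close> their solutions converge. Such data are dense in the phase space, and the
  energy estimate extends existence to all data.
\<close>

section \<open>Inverses of strictly positive selfadjoint operators\<close>

text \<open>The weight \<rho> merges \<open>\<beta> A v + \<gamma> A u\<close> into
  \<open>\<beta> A r\<close>, and \<open>q\<close> absorbs the damping \<open>\<alpha> w\<close>;
  what is left over is \<open>r' = q + \<delta> v\<close> with
  \<open>\<delta> = (\<gamma> - \<alpha> * \<beta>) / \<beta>\<close>. The obstacle is that
  \<open>w\<close> and \<theta> of a weak solution only lie in the base space: \<open>A\<close>
  cannot be applied to them, and only \<open>R w\<close> and \<open>R \<theta>\<close> are known to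
  be differentiable. Therefore everything is expressed through \<open>R\<close>. The
  \<open>H^1\<close> norm is treated as the norm dual to
  \<open>sqrt (inner (R \<psi>) \<psi>)\<close>, and the phase-space energy is evaluated on
  \<open>R W\<close>, where it becomes a form with bounded operators. The inverse of
  \<open>R + \<epsilon>\<close> is the Yosida approximation \<open>A (1 + \<epsilon> A)^-1\<close>.
  Two approximations differ by a forcing that contains this operator, whose norm may grow like
  \<open>1 / \<epsilon>\<close>; a factor \<open>R\<close> compensates, because
  \<open>R (R + \<epsilon>)^-1\<close> is a contraction. This is why the data must lie in the range
  of a power of \<open>R\<close>.\<close>

lemma orthogonal_to_proper_closed_subspace:
  fixes M :: "'a::{real_inner,complete_space} set"
  assumes "subspace M" "closed M" "y \<notin> M"
  shows "\<exists>z. z \<noteq> 0 \<and> (\<forall>m\<in>M. inner z m = 0)"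
proof -
  define d where "d = infdist y M"
  have ne: "M \<noteq> {}" using assms(1) subspace_0 by blast
  have d_le: "d \<le> norm (y - m)" if "m \<in> M" for m
    using infdist_le[OF that, of y] by (simp add: d_def dist_norm)
  have d0: "d \<ge> 0" by (simp add: d_def infdist_nonneg)
  \<comment> \<open>The minimising sequence is measured in the squared distance, so that the
    parallelogram identity turns the error \<open>1 / real (Suc n)\<close> directly into a Cauchy
    bound.\<close>
  have "\<exists>m\<in>M. (norm (y - m))\<^sup>2 < d\<^sup>2 + 1 / real (Suc n)" for n
  proof -
    have "d < sqrt (d\<^sup>2 + 1 / real (Suc n))"
      using d0 by (intro real_less_rsqrt) auto
    then obtain m where "m \<in> M" "dist y m < sqrt (d\<^sup>2 + 1 / real (Suc n))"
      using ne unfolding d_def infdist_def by (auto simp: cINF_less_iff)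
    then have "(norm (y - m))\<^sup>2 < (sqrt (d\<^sup>2 + 1 / real (Suc n)))\<^sup>2"
      by (intro power_strict_mono) (auto simp: dist_norm)
    moreover have "(sqrt (d\<^sup>2 + 1 / real (Suc n)))\<^sup>2 = d\<^sup>2 + 1 / real (Suc n)"
      by (intro real_sqrt_pow2) auto
    ultimately show ?thesis using \<open>m \<in> M\<close> by auto
  qed
  then obtain m where mM: "\<And>n. m n \<in> M" and m: "\<And>n. (norm (y - m n))\<^sup>2 < d\<^sup>2 + 1 / real (Suc n)"
    by metis
  have par: "(norm (m i - m j))\<^sup>2 \<le> 2 / real (Suc i) + 2 / real (Suc j)" for i j
  proof -
    have "(1/2) *\<^sub>R (m i + m j) \<in> M"
      using assms(1) mM by (simp add: subspace_add subspace_scale)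
    then have "d\<^sup>2 \<le> (norm (y - (1/2) *\<^sub>R (m i + m j)))\<^sup>2"
      using d_le d0 by (intro power_mono) auto
    moreover have "(norm (m i - m j))\<^sup>2 + 4 * (norm (y - (1/2) *\<^sub>R (m i + m j)))\<^sup>2
        = 2 * (norm (y - m i))\<^sup>2 + 2 * (norm (y - m j))\<^sup>2"
      by (simp add: power2_norm_eq_inner algebra_simps inner_commute)
    ultimately show ?thesis using m[of i] m[of j] by simp
  qed
  have "Cauchy m"
  proof (rule metric_CauchyI)
    fix e :: real assume "e > 0"
    then obtain N where N: "1 / real (Suc N) < e\<^sup>2 / 4"
      using nat_approx_posE[of "e\<^sup>2/4"] by (auto simp: divide_simps)
    show "\<exists>N. \<forall>i\<ge>N. \<forall>j\<ge>N. dist (m i) (m j) < e"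
    proof (intro exI allI impI)
      fix i j assume "i \<ge> N" "j \<ge> N"
      then have "1 / real (Suc i) \<le> 1 / real (Suc N)" "1 / real (Suc j) \<le> 1 / real (Suc N)"
        by (auto intro!: divide_left_mono)
      then have "(norm (m i - m j))\<^sup>2 < e\<^sup>2" using par[of i j] N by simp
      then show "dist (m i) (m j) < e"
        using \<open>e > 0\<close> by (simp add: dist_norm power_less_imp_less_base)
    qed
  qed
  then obtain l where l: "m \<longlonglongrightarrow> l" using Cauchy_convergent convergent_def by blast
  have lM: "l \<in> M" using assms(2) l mM closed_sequentially by blast
  have "(\<lambda>n. (norm (y - m n))\<^sup>2) \<longlonglongrightarrow> (norm (y - l))\<^sup>2"
    by (intro tendsto_intros l)
  moreover have "(\<lambda>n. d\<^sup>2 + 1 / real (Suc n)) \<longlonglongrightarrow> d\<^sup>2 + 0"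
    by (intro tendsto_add tendsto_const LIMSEQ_Suc[OF lim_1_over_n])
  ultimately have le: "(norm (y - l))\<^sup>2 \<le> d\<^sup>2 + 0"
    using m by (intro LIMSEQ_le) (auto intro: less_imp_le)
  show ?thesis
  proof (intro exI conjI ballI)
    show "y - l \<noteq> 0" using lM assms(3) by auto
    fix x assume x: "x \<in> M"
    show "inner (y - l) x = 0"
    proof (cases "x = 0")
      case False
      \<comment> \<open>This \<open>s\<close> minimises the distance from \<open>y - l\<close> to
        the line spanned by \<open>x\<close>; minimality of \<open>l\<close> forces the gain
        \<open>(inner (y - l) x)\<^sup>2 / inner x x\<close> to vanish.\<close>
      define s where "s = inner (y - l) x / inner x x"
      have "l + s *\<^sub>R x \<in> M" using x lM assms(1) by (simp add: subspace_add subspace_scale)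
      then have "d\<^sup>2 \<le> (norm (y - (l + s *\<^sub>R x)))\<^sup>2"
        using d_le d0 by (intro power_mono) auto
      also have "y - (l + s *\<^sub>R x) = (y - l) - s *\<^sub>R x" by simp
      also have "(norm ((y - l) - s *\<^sub>R x))\<^sup>2 = (norm (y - l))\<^sup>2 - 2 * s * inner (y - l) x + s\<^sup>2 * inner x x"
        using dot_norm_neg[of "y - l" "s *\<^sub>R x"]
        by (simp add: power_mult_distrib dot_square_norm)
      also have "\<dots> = (norm (y - l))\<^sup>2 - (inner (y - l) x)\<^sup>2 / inner x x"
        using False by (simp add: s_def power2_eq_square)
      finally have "(inner (y - l) x)\<^sup>2 / inner x x \<le> 0" using le by linarith
      moreover have "inner x x > 0" using False by simp
      ultimately have "(inner (y - l) x)\<^sup>2 \<le> 0" by (simp add: divide_le_0_iff)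
      then show ?thesis by simp
    qed auto
  qed
qed

text \<open>The lower bound makes preimages of convergent sequences Cauchy, and the maximality
  clause of selfadjointness then closes the range. A vector orthogonal to the range satisfies
  \<open>A z = 0\<close> by that same clause, hence is zero.\<close>

lemma strictly_pos_selfadjoint_surj:
  assumes "strictly_pos_selfadjoint D A"
  shows "A ` D = UNIV"
proof (rule ccontr)
  assume neq: "A ` D \<noteq> UNIV"
  from assms have D: "subspace D"
    and add: "\<And>x y. x \<in> D \<Longrightarrow> y \<in> D \<Longrightarrow> A (x + y) = A x + A y"
    and scale: "\<And>c x. x \<in> D \<Longrightarrow> A (c *\<^sub>R x) = c *\<^sub>R A x"
    and sym: "\<And>x y. x \<in> D \<Longrightarrow> y \<in> D \<Longrightarrow> inner (A x) y = inner x (A y)"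
    and adj: "\<And>v w. (\<And>u. u \<in> D \<Longrightarrow> inner (A u) v = inner u w) \<Longrightarrow> v \<in> D \<and> A v = w"
    and "\<exists>c>0. \<forall>x\<in>D. inner (A x) x \<ge> c * (norm x)\<^sup>2"
    unfolding strictly_pos_selfadjoint_def by blast+
  then obtain c where c: "c > 0" "\<And>x. x \<in> D \<Longrightarrow> inner (A x) x \<ge> c * (norm x)\<^sup>2" by blast
  have A0: "A 0 = 0" using scale[of 0 0] subspace_0[OF D] by simp
  have diff: "A (x - y) = A x - A y" if "x \<in> D" "y \<in> D" for x y
    using add[of x "(-1) *\<^sub>R y"] scale[of y "-1"] that D subspace_neg[OF D] by simp
  have low: "c * norm x \<le> norm (A x)" if "x \<in> D" for x
  proof (cases "x = 0")
    case False
    have "c * norm x * norm x \<le> norm (A x) * norm x"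
      using c(2)[OF that] norm_cauchy_schwarz[of "A x" x] by (simp add: power2_eq_square mult.assoc)
    then show ?thesis using False by simp
  qed (simp add: A0)
  have sub: "subspace (A ` D)"
    unfolding subspace_def
  proof (intro conjI ballI allI)
    show "0 \<in> A ` D" using A0 subspace_0[OF D] by (metis imageI)
  next
    fix x y assume "x \<in> A ` D" "y \<in> A ` D"
    then obtain a b where "a \<in> D" "b \<in> D" "x = A a" "y = A b" by blast
    then show "x + y \<in> A ` D" using add[of a b] subspace_add[OF D, of a b] by (metis imageI)
  next
    fix s x assume "x \<in> A ` D"
    then obtain a where "a \<in> D" "x = A a" by blast
    then show "s *\<^sub>R x \<in> A ` D" using scale[of a s] subspace_scale[OF D, of a s] by (metis imageI)
  qed
  have cl: "closed (A ` D)"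
    unfolding closed_sequential_limits
  proof (intro allI impI, elim conjE)
    fix y l assume yD: "\<forall>n. y n \<in> A ` D" and yl: "y \<longlonglongrightarrow> l"
    then have "\<forall>n. \<exists>a. a \<in> D \<and> y n = A a" by blast
    then obtain x where x: "\<And>n. x n \<in> D" "\<And>n. y n = A (x n)" by metis
    have "Cauchy x"
    proof (rule metric_CauchyI)
      fix e :: real assume "e > 0"
      then obtain N where N: "\<forall>i\<ge>N. \<forall>j\<ge>N. dist (y i) (y j) < c * e"
        using metric_CauchyD[OF LIMSEQ_imp_Cauchy[OF yl], of "c * e"] c(1) by auto
      show "\<exists>N. \<forall>i\<ge>N. \<forall>j\<ge>N. dist (x i) (x j) < e"
      proof (intro exI allI impI)
        fix i j assume "i \<ge> N" "j \<ge> N"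
        then have "norm (A (x i - x j)) < c * e"
          using N x by (simp add: dist_norm diff)
        then have "c * norm (x i - x j) < c * e"
          using low[OF subspace_diff[OF D x(1) x(1)], of i j] by linarith
        then show "dist (x i) (x j) < e" using c(1) by (simp add: dist_norm)
      qed
    qed
    then obtain z where z: "x \<longlonglongrightarrow> z" using Cauchy_convergent convergent_def by blast
    \<comment> \<open>The graph of \<open>A\<close> is closed: symmetry holds along the sequence and
      passes to the limit, so the adjoint clause gives \<open>z \<in> D\<close> and
      \<open>A z = l\<close>.\<close>
    have "inner (A u) z = inner u l" if u: "u \<in> D" for u
    proof (rule LIMSEQ_unique)
      show "(\<lambda>n. inner (A u) (x n)) \<longlonglongrightarrow> inner (A u) z" by (intro tendsto_intros z)
      have "(\<lambda>n. inner u (y n)) \<longlonglongrightarrow> inner u l" by (intro tendsto_intros yl)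
      then show "(\<lambda>n. inner (A u) (x n)) \<longlonglongrightarrow> inner u l" using sym u x by simp
    qed
    then show "l \<in> A ` D" using adj[of z l] by blast
  qed
  obtain y where "y \<notin> A ` D" using neq by blast
  from orthogonal_to_proper_closed_subspace[OF sub cl this]
  obtain z where z: "z \<noteq> 0" "\<And>m. m \<in> A ` D \<Longrightarrow> inner z m = 0" by blast
  have "inner (A u) z = inner u 0" if "u \<in> D" for u
    using z(2)[OF imageI[OF that]] by (simp add: inner_commute)
  then have "z \<in> D \<and> A z = 0" by (rule adj)
  then show False using low[of z] z(1) c(1) by (simp add: mult_le_0_iff)
qed

text \<open>Strict positivity yields injectivity and, read at \<open>R x\<close>, both quantitative
  bounds with \<open>k = 1 / c\<close>, where \<open>c\<close> is the lower bound of
  \<open>A\<close>.\<close>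

lemma strictly_pos_selfadjoint_inverse:
  assumes "strictly_pos_selfadjoint D A"
  obtains R k where "bounded_linear R" "k > 0" "\<And>x. R x \<in> D" "\<And>x. A (R x) = x"
    "\<And>x. x \<in> D \<Longrightarrow> R (A x) = x" "\<And>x y. inner (R x) y = inner x (R y)"
    "\<And>x. (norm (R x))\<^sup>2 \<le> k * inner (R x) x" "\<And>x. norm (R x) \<le> k * norm x"
proof -
  from assms have D: "subspace D"
    and add: "\<And>x y. x \<in> D \<Longrightarrow> y \<in> D \<Longrightarrow> A (x + y) = A x + A y"
    and scale: "\<And>c x. x \<in> D \<Longrightarrow> A (c *\<^sub>R x) = c *\<^sub>R A x"
    and sym: "\<And>x y. x \<in> D \<Longrightarrow> y \<in> D \<Longrightarrow> inner (A x) y = inner x (A y)"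
    and "\<exists>c>0. \<forall>x\<in>D. inner (A x) x \<ge> c * (norm x)\<^sup>2"
    unfolding strictly_pos_selfadjoint_def by blast+
  then obtain c where c: "c > 0" "\<And>x. x \<in> D \<Longrightarrow> inner (A x) x \<ge> c * (norm x)\<^sup>2" by blast
  have diff: "A (x - y) = A x - A y" if "x \<in> D" "y \<in> D" for x y
    using add[of x "(-1) *\<^sub>R y"] scale[of y "-1"] that D subspace_neg[OF D] by simp
  have inj: "x = y" if "x \<in> D" "y \<in> D" "A x = A y" for x y
    using c(2)[of "x - y"] that diff D c(1) by (auto simp: subspace_diff mult_le_0_iff)
  define R where "R = inv_into D A"
  have RD: "R x \<in> D" and AR: "A (R x) = x" for x
    using strictly_pos_selfadjoint_surj[OF assms] unfolding R_def
    by (auto intro: inv_into_into f_inv_into_f)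
  have RA: "R (A x) = x" if "x \<in> D" for x using inj RD AR that by blast
  have pos: "(norm (R x))\<^sup>2 \<le> 1 / c * inner (R x) x" for x
    using c(2)[OF RD, of x] c(1) by (simp add: AR field_simps inner_commute)
  have bnd: "norm (R x) \<le> 1 / c * norm x" for x
  proof (cases "R x = 0")
    case True then show ?thesis using c(1) by (simp add: zero_le_divide_iff)
  next
    case False
    have "1 / c * inner (R x) x \<le> 1 / c * (norm (R x) * norm x)"
      using c(1) by (intro mult_left_mono norm_cauchy_schwarz) auto
    then have "norm (R x) * norm (R x) \<le> norm (R x) * (1 / c * norm x)"
      using pos[of x] by (simp add: power2_eq_square mult_ac)
    then show ?thesis using False by (meson mult_le_cancel_left_pos zero_less_norm_iff)
  qed
  have "bounded_linear R"
  proof (rule bounded_linear_intro)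
    show "R (x + y) = R x + R y" for x y
      using RA[of "R x + R y"] add[OF RD RD] RD D by (simp add: AR subspace_add)
    show "R (s *\<^sub>R x) = s *\<^sub>R R x" for s x
      using RA[of "s *\<^sub>R R x"] scale[OF RD] RD D by (simp add: AR subspace_scale)
    show "norm (R x) \<le> norm x * (1 / c)" for x using bnd by (simp add: mult.commute)
  qed
  moreover have "inner (R x) y = inner x (R y)" for x y
    using sym[OF RD RD, of x y] by (simp add: AR)
  ultimately show ?thesis
    using that[of R "1 / c"] RD AR RA pos bnd c(1) by simp
qed

section \<open>Differential equations without Bochner integrals\<close>

text \<open>The mean value inequality for \<open>F n x - x *\<^sub>R g s\<close> on the segment
  between \<open>s\<close> and \<open>t\<close> has a bound independent of \<open>n\<close>, so it
  survives the pointwise limit.\<close>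

lemma has_vector_derivative_uniform_limit:
  fixes F :: "nat \<Rightarrow> real \<Rightarrow> 'a::real_normed_vector"
  assumes der: "\<And>n t. t \<in> {a..b} \<Longrightarrow> (F n has_vector_derivative f n t) (at t within {a..b})"
    and lim: "\<And>t. t \<in> {a..b} \<Longrightarrow> (\<lambda>n. F n t) \<longlonglongrightarrow> G t"
    and unif: "uniform_limit {a..b} f g sequentially"
    and cont: "continuous_on {a..b} g"
    and s: "s \<in> {a..b}"
  shows "(G has_vector_derivative g s) (at s within {a..b})"
  unfolding has_vector_derivative_def has_derivative_within_alt
proof (intro conjI allI impI)
  show "bounded_linear (\<lambda>x. x *\<^sub>R g s)" by (rule bounded_linear_scaleR_left)
  fix e :: real assume e: "e > 0"
  obtain d where d: "d > 0" "\<And>t. t \<in> {a..b} \<Longrightarrow> dist t s < d \<Longrightarrow> dist (g t) (g s) < e / 2"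
    using cont s e unfolding continuous_on_iff by (metis half_gt_zero)
  have ev: "\<forall>\<^sub>F n in sequentially. \<forall>t\<in>{a..b}. dist (f n t) (g t) < e / 2"
    using unif half_gt_zero[OF e] unfolding uniform_limit_iff by blast
  have "norm (G t - G s - (t - s) *\<^sub>R g s) \<le> e * norm (t - s)"
    if t: "t \<in> {a..b}" "norm (t - s) < d" for t
  proof -
    let ?S = "{min s t..max s t}"
    have sub: "?S \<subseteq> {a..b}" using s t by auto
    have "norm (F n t - F n s - (t - s) *\<^sub>R g s) \<le> e * norm (t - s)"
      if n: "\<forall>t\<in>{a..b}. dist (f n t) (g t) < e / 2" for n
    proof -
      let ?h = "\<lambda>x. F n x - x *\<^sub>R g s"
      have "norm (?h t - ?h s) \<le> e * norm (t - s)"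
      proof (rule differentiable_bound[where S = ?S and f' = "\<lambda>x h. h *\<^sub>R (f n x - g s)"])
        fix x assume x: "x \<in> ?S"
        have "(F n has_vector_derivative f n x) (at x within ?S)"
          using der[of x n] x sub has_vector_derivative_within_subset by blast
        then have "(?h has_vector_derivative f n x - g s) (at x within ?S)"
          by (auto intro!: derivative_eq_intros)
        then show "(?h has_derivative (\<lambda>h. h *\<^sub>R (f n x - g s))) (at x within ?S)"
          by (simp add: has_vector_derivative_def)
        have "dist x s < d" using x t(2) by (auto simp: dist_real_def)
        then have "dist (f n x) (g s) \<le> e"
          using n d(2)[of x] x sub dist_triangle[of "f n x" "g s" "g x"] by fastforce
        then show "onorm (\<lambda>h. h *\<^sub>R (f n x - g s)) \<le> e"
          by (intro onorm_le) (simp add: dist_norm mult.commute[of e] mult_left_mono)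
      qed auto
      then show ?thesis by (simp add: algebra_simps)
    qed
    then have "\<forall>\<^sub>F n in sequentially. norm (F n t - F n s - (t - s) *\<^sub>R g s) \<le> e * norm (t - s)"
      by (intro eventually_mono[OF ev])
    moreover have "(\<lambda>n. norm (F n t - F n s - (t - s) *\<^sub>R g s)) \<longlonglongrightarrow> norm (G t - G s - (t - s) *\<^sub>R g s)"
      by (intro tendsto_intros lim t s)
    ultimately show ?thesis by (intro tendsto_upperbound) auto
  qed
  then show "\<exists>d>0. \<forall>y\<in>{a..b}. norm (y - s) < d \<longrightarrow> norm (G y - G s - (y - s) *\<^sub>R g s) \<le> e * norm (y - s)"
    using d(1) by blast
qed

text \<open>The solution is the exponential series of \<open>t G\<close> applied to
  \<open>x0\<close>; \<open>X n\<close> are its partial sums.\<close>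

lemma bounded_linear_ode_solution:
  fixes G :: "'b::{real_normed_vector,complete_space} \<Rightarrow> 'b"
  assumes G: "bounded_linear G"
  obtains x where "x 0 = x0"
    "\<And>\<tau> t. t \<in> {0..\<tau>} \<Longrightarrow> (x has_vector_derivative G (x t)) (at t within {0..\<tau>})"
proof -
  interpret G: bounded_linear G by fact
  obtain K where K: "K \<ge> 0" "\<And>x. norm (G x) \<le> norm x * K" using G.nonneg_bounded by blast
  define X where "X n t = (\<Sum>i<n. (t ^ i / fact i) *\<^sub>R (G ^^ i) x0)" for n and t :: real
  have pw: "norm ((G ^^ i) x0) \<le> norm x0 * K ^ i" for i
  proof (induction i)
    case (Suc i)
    have "norm ((G ^^ Suc i) x0) \<le> norm ((G ^^ i) x0) * K" using K(2) by simp
    also have "\<dots> \<le> norm x0 * K ^ i * K" using Suc K(1) by (intro mult_right_mono)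
    finally show ?case by (simp add: mult_ac)
  qed simp
  have uc: "uniformly_Cauchy_on {0..\<tau>} X" for \<tau>
  proof (rule uniformly_Cauchy_onI')
    fix e :: real assume e: "e > 0"
    let ?c = "\<lambda>i. norm x0 * ((\<bar>\<tau>\<bar> * K) ^ i / fact i)"
    have "summable ?c"
      using summable_exp[of "\<bar>\<tau>\<bar> * K"] by (intro summable_mult) (simp add: field_simps)
    then obtain N where N: "\<And>m n. m \<ge> N \<Longrightarrow> norm (sum ?c {m..<n}) < e"
      using e unfolding summable_Cauchy by blast
    have "dist (X m t) (X n t) < e" if t: "t \<in> {0..\<tau>}" and "m \<ge> N" "n > m" for t m n
    proof -
      have "X n t - X m t = (\<Sum>i\<in>{m..<n}. (t ^ i / fact i) *\<^sub>R (G ^^ i) x0)"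
        unfolding X_def using \<open>n > m\<close>
        by (simp add: sum_diff_nat_ivl[of 0 m n, symmetric] lessThan_atLeast0)
      also have "norm \<dots> \<le> (\<Sum>i\<in>{m..<n}. ?c i)"
      proof (rule sum_norm_le)
        fix i
        have "norm ((t ^ i / fact i) *\<^sub>R (G ^^ i) x0) \<le> \<bar>\<tau>\<bar> ^ i / fact i * (norm x0 * K ^ i)"
          unfolding norm_scaleR using t pw[of i] K(1)
          by (intro mult_mono) (auto intro!: divide_right_mono power_mono simp: power_abs)
        then show "norm ((t ^ i / fact i) *\<^sub>R (G ^^ i) x0) \<le> ?c i"
          by (simp add: power_mult_distrib mult_ac)
      qed
      also have "\<dots> < e" using N[OF \<open>m \<ge> N\<close>, of n] by simp
      finally show ?thesis by (simp add: dist_norm norm_minus_commute)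
    qed
    then show "\<exists>M. \<forall>x\<in>{0..\<tau>}. \<forall>m\<ge>M. \<forall>n>m. dist (X m x) (X n x) < e" by blast
  qed
  define x where "x t = lim (\<lambda>n. X n t)" for t
  have unif: "uniform_limit {0..\<tau>} X x sequentially" for \<tau>
    using Cauchy_uniformly_convergent[OF uc, of \<tau>]
    unfolding uniformly_convergent_uniform_limit_iff x_def .
  have contX: "continuous_on S (X n)" for n S
    unfolding X_def by (intro continuous_intros) auto
  have contx: "continuous_on {0..\<tau>} x" for \<tau>
    by (rule uniform_limit_theorem[OF _ unif]) (simp_all add: contX)
  \<comment> \<open>Differentiation lowers the degree of a partial sum by one, hence the index shift
    between \<open>X (Suc n)\<close> and \<open>G (X n)\<close>.\<close>
  have der: "(X (Suc n) has_vector_derivative G (X n t)) (at t within S)" for n t S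
  proof -
    have "((\<lambda>t. \<Sum>i<Suc n. (t ^ i / fact i) *\<^sub>R (G ^^ i) x0) has_vector_derivative
        (\<Sum>i<Suc n. (real i * t ^ (i - 1) / fact i) *\<^sub>R (G ^^ i) x0)) (at t within S)"
      by (intro has_vector_derivative_sum)
         (auto intro!: derivative_eq_intros has_vector_derivative_scaleR simp: has_real_derivative_iff_has_vector_derivative[symmetric])
    also have "(\<Sum>i<Suc n. (real i * t ^ (i - 1) / fact i) *\<^sub>R (G ^^ i) x0)
        = (\<Sum>i<n. (real (Suc i) * t ^ i / fact (Suc i)) *\<^sub>R (G ^^ Suc i) x0)"
      by (subst sum.lessThan_Suc_shift) simp
    also have "\<dots> = (\<Sum>i<n. (t ^ i / fact i) *\<^sub>R (G ^^ Suc i) x0)"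
      by (intro sum.cong refl arg_cong2[where f = scaleR]) (simp add: field_simps del: of_nat_Suc)
    also have "\<dots> = G (X n t)"
      unfolding X_def by (simp add: G.sum G.scaleR)
    finally show ?thesis unfolding X_def .
  qed
  have "(x has_vector_derivative G (x t)) (at t within {0..\<tau>})" if "t \<in> {0..\<tau>}" for t \<tau>
  proof (rule has_vector_derivative_uniform_limit[where F = "\<lambda>n. X (Suc n)" and f = "\<lambda>n t. G (X n t)"])
    show "(\<lambda>n. X (Suc n) t) \<longlonglongrightarrow> x t" if "t \<in> {0..\<tau>}" for t
      using tendsto_uniform_limitI[OF unif that] by (rule LIMSEQ_Suc)
    show "uniform_limit {0..\<tau>} (\<lambda>n t. G (X n t)) (\<lambda>t. G (x t)) sequentially"
      by (rule bounded_linear.uniform_limit[OF G unif])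
    show "continuous_on {0..\<tau>} (\<lambda>t. G (x t))"
      by (rule G.continuous_on[OF contx])
  qed (use der that in auto)
  moreover have "x 0 = x0"
  proof -
    have "X (Suc n) 0 = x0" for n
      unfolding X_def by (subst sum.lessThan_Suc_shift) simp
    then have "(\<lambda>n. X n 0) \<longlonglongrightarrow> x0" by (subst filterlim_sequentially_Suc[symmetric]) simp
    then show ?thesis by (simp add: x_def limI)
  qed
  ultimately show ?thesis using that by blast
qed

text \<open>Symmetry turns the increment of the form into
  \<open>inner (S (x s) - S (x t)) (x s + x t)\<close>, so continuity of \<open>x\<close> is enough
  once \<open>S x\<close> is differentiable. This is the situation of \<open>w\<close> and
  \<theta>.\<close>

lemma has_vector_derivative_inner_selfadjoint:
  fixes x :: "real \<Rightarrow> 'a::real_inner"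
  assumes sym: "\<And>a b. inner (S a) b = inner a (S b)"
    and der: "((\<lambda>t. S (x t)) has_vector_derivative y) (at t within I)"
    and cont: "continuous (at t within I) x"
  shows "((\<lambda>t. inner (S (x t)) (x t)) has_real_derivative 2 * inner y (x t)) (at t within I)"
proof -
  have eq: "inner (S (x s)) (x s) - inner (S (x t)) (x t) = inner (S (x s) - S (x t)) (x s + x t)" for s
    using trans[OF sym inner_commute, of "x s" "x t"] by (simp add: inner_diff_left inner_add_right)
  have "((\<lambda>s. norm (S (x s) - S (x t) - (s - t) *\<^sub>R y) / norm (s - t)) \<longlongrightarrow> 0) (at t within I)"
    using der by (simp add: has_vector_derivative_def has_derivative_iff_norm)
  then have "((\<lambda>s. norm ((1 / (s - t)) *\<^sub>R (S (x s) - S (x t)) - y)) \<longlongrightarrow> 0) (at t within I)"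
  proof (rule Lim_transform_eventually)
    have "norm (S (x s) - S (x t) - (s - t) *\<^sub>R y) / norm (s - t)
        = norm ((1 / (s - t)) *\<^sub>R (S (x s) - S (x t)) - y)" if "s \<noteq> t" for s
    proof -
      have "(1 / (s - t)) *\<^sub>R (S (x s) - S (x t)) - y
          = (1 / (s - t)) *\<^sub>R (S (x s) - S (x t) - (s - t) *\<^sub>R y)"
        using that by (simp add: scaleR_diff_right)
      then show ?thesis by (simp add: divide_inverse mult.commute)
    qed
    then show "\<forall>\<^sub>F s in at t within I. norm (S (x s) - S (x t) - (s - t) *\<^sub>R y) / norm (s - t)
        = norm ((1 / (s - t)) *\<^sub>R (S (x s) - S (x t)) - y)"
      by (auto simp: eventually_at_filter)
  qed
  then have q: "((\<lambda>s. (1 / (s - t)) *\<^sub>R (S (x s) - S (x t))) \<longlongrightarrow> y) (at t within I)"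
    by (simp add: tendsto_norm_zero_iff LIM_zero_iff)
  have "(x \<longlongrightarrow> x t) (at t within I)" using cont by (simp add: continuous_within)
  then have "((\<lambda>s. inner ((1 / (s - t)) *\<^sub>R (S (x s) - S (x t))) (x s + x t)) \<longlongrightarrow> inner y (x t + x t)) (at t within I)"
    by (intro tendsto_intros q)
  then show ?thesis
    unfolding has_field_derivative_iff eq by (simp add: inner_add_right divide_inverse mult.commute distrib_left)
qed

text \<open>The function \<open>exp (- \<omega> * s) * E s - K * s\<close> is nonincreasing: after
  multiplication by \<open>exp (- \<omega> * s) \<le> 1\<close> the inhomogeneity is still at most
  \<open>K\<close>.\<close>

lemma gronwall_real_derivative:
  fixes E :: "real \<Rightarrow> real"
  assumes der: "\<And>t. t \<in> {0..\<tau>} \<Longrightarrow> (E has_real_derivative E' t) (at t within {0..\<tau>})"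
    and le: "\<And>t. t \<in> {0..\<tau>} \<Longrightarrow> E' t \<le> \<omega> * E t + K"
    and "\<omega> \<ge> 0" "K \<ge> 0" "t \<in> {0..\<tau>}"
  shows "E t \<le> exp (\<omega> * t) * (E 0 + K * t)"
proof -
  let ?h = "\<lambda>s. exp (- \<omega> * s) * E s - K * s"
  have "?h t \<le> ?h 0"
  proof (rule DERIV_nonpos_imp_decreasing_open[where f = ?h])
    show "0 \<le> t" using assms by simp
    have d: "(?h has_real_derivative exp (- \<omega> * s) * (E' s - \<omega> * E s) - K) (at s within {0..\<tau>})"
      if "s \<in> {0..\<tau>}" for s
      using der[OF that] by (auto intro!: derivative_eq_intros simp: algebra_simps)
    then have "continuous_on {0..\<tau>} ?h" by (intro DERIV_continuous_on)
    then show "continuous_on {0..t} ?h" using assms(5) by (rule_tac continuous_on_subset) auto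
    fix s assume s: "0 < s" "s < t"
    then have sI: "s \<in> {0..\<tau>}" and int: "s \<in> interior {0..\<tau>}" using assms(5) by auto
    have "exp (- \<omega> * s) * (E' s - \<omega> * E s) \<le> exp (- \<omega> * s) * K"
      using le[OF sI] by (intro mult_left_mono) auto
    also have "\<dots> \<le> 1 * K" using assms s by (intro mult_right_mono) auto
    finally show "\<exists>y. DERIV ?h s :> y \<and> y \<le> 0"
      using d[OF sI] at_within_interior[OF int] by (intro exI[of _ "exp (- \<omega> * s) * (E' s - \<omega> * E s) - K"]) auto
  qed
  then have "exp (\<omega> * t) * (exp (- \<omega> * t) * E t) \<le> exp (\<omega> * t) * (E 0 + K * t)"
    by (intro mult_left_mono) auto
  then show ?thesis by (simp add: mult.assoc[symmetric] exp_add[symmetric])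
qed

section \<open>The space \<open>H\<^sup>1\<close>\<close>

text \<open>Working with the bounded inverse lets every quadratic form be defined on the whole
  space; \<open>coercive\<close> is the strict positivity of \<open>A\<close> read through
  \<open>R\<close>.\<close>

locale spsa_inverse =
  fixes D :: "'a::{real_inner,complete_space} set" and A R :: "'a \<Rightarrow> 'a" and k :: real
  assumes dense: "closure D = UNIV"
    and blin: "bounded_linear R" and k_pos: "k > 0"
    and RD: "\<And>x. R x \<in> D" and AR: "\<And>x. A (R x) = x" and RA: "\<And>x. x \<in> D \<Longrightarrow> R (A x) = x"
    and sym: "\<And>x y. inner (R x) y = inner x (R y)"
    and coercive: "\<And>x. (norm (R x))\<^sup>2 \<le> k * inner (R x) x"
    and bound: "\<And>x. norm (R x) \<le> k * norm x"
begin

sublocale R: bounded_linear R by (rule blin)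

lemma R_eq_0_iff: "R x = 0 \<longleftrightarrow> x = 0"
  by (metis AR R.zero)

lemma R_nonneg: "0 \<le> inner (R x) x"
proof -
  have "0 \<le> k * inner (R x) x" using coercive[of x] by (meson order_trans zero_le_power2)
  then show ?thesis using k_pos by (simp add: zero_le_mult_iff)
qed

lemma R_pos: "x \<noteq> 0 \<Longrightarrow> 0 < inner (R x) x"
  using coercive[of x] R_nonneg[of x] R_eq_0_iff[of x] by (cases "inner (R x) x = 0") auto

lemma R_form_le: "inner (R x) x \<le> k * (norm x)\<^sup>2"
proof -
  have "inner (R x) x \<le> norm (R x) * norm x" by (rule norm_cauchy_schwarz)
  also have "\<dots> \<le> k * norm x * norm x" by (intro mult_right_mono bound) auto
  finally show ?thesis by (simp add: power2_eq_square)
qed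

lemma R_cauchy_schwarz: "inner (R x) y \<le> sqrt (inner (R x) x) * sqrt (inner (R y) y)"
proof (cases "y = 0")
  case False
  define b where "b = inner (R y) y"
  \<comment> \<open>The minimiser of the form of \<open>R\<close> along
    \<open>x - s *\<^sub>R y\<close>.\<close>
  define s where "s = inner (R x) y / b"
  have b: "b > 0" using R_pos[OF False] by (simp add: b_def)
  have xy: "inner (R y) x = inner (R x) y" using sym[of x y] by (simp add: inner_commute)
  have "0 \<le> inner (R (x - s *\<^sub>R y)) (x - s *\<^sub>R y)" by (rule R_nonneg)
  also have "\<dots> = inner (R x) x - 2 * s * inner (R x) y + s\<^sup>2 * b"
    by (simp add: R.diff R.scaleR inner_diff_left inner_diff_right xy b_def power2_eq_square algebra_simps)
  also have "\<dots> = inner (R x) x - (inner (R x) y)\<^sup>2 / b"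
    using b by (simp add: s_def power2_eq_square field_simps)
  finally have "(inner (R x) y)\<^sup>2 \<le> inner (R x) x * b" using b by (simp add: field_simps)
  then have "sqrt ((inner (R x) y)\<^sup>2) \<le> sqrt (inner (R x) x * b)" by (rule real_sqrt_le_mono)
  then show ?thesis by (simp add: real_sqrt_mult b_def)
qed simp

text \<open>After the substitution \<open>\<phi> = R \<psi>\<close> the supremum defining \<open>norm1\<close> ranges over all of the space.\<close>

lemma half_set_eq:
  "half_set D A u = insert 0 {inner u \<psi> / sqrt (inner (R \<psi>) \<psi>) | \<psi>. \<psi> \<noteq> 0}"
proof -
  have "{inner u (A \<phi>) / sqrt (inner (A \<phi>) \<phi>) | \<phi>. \<phi> \<in> D \<and> \<phi> \<noteq> 0}
      = {inner u \<psi> / sqrt (inner (R \<psi>) \<psi>) | \<psi>. \<psi> \<noteq> 0}" (is "?L = ?R")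
  proof (intro equalityI subsetI)
    fix x assume "x \<in> ?L"
    then obtain \<phi> where "x = inner u (A \<phi>) / sqrt (inner (A \<phi>) \<phi>)" "\<phi> \<in> D" "\<phi> \<noteq> 0" by blast
    moreover then have "A \<phi> \<noteq> 0" "inner (R (A \<phi>)) (A \<phi>) = inner (A \<phi>) \<phi>"
      using RA by (metis R.zero) (simp add: RA \<open>\<phi> \<in> D\<close> inner_commute)
    ultimately show "x \<in> ?R" by force
  next
    fix x assume "x \<in> ?R"
    then obtain \<psi> where "x = inner u \<psi> / sqrt (inner (R \<psi>) \<psi>)" "\<psi> \<noteq> 0" by blast
    moreover then have "R \<psi> \<noteq> 0" "R \<psi> \<in> D" "inner (A (R \<psi>)) (R \<psi>) = inner (R \<psi>) \<psi>" "A (R \<psi>) = \<psi>"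
      by (auto simp: AR RD R_eq_0_iff inner_commute)
    ultimately show "x \<in> ?L" by force
  qed
  then show ?thesis by (simp add: half_set_def)
qed

abbreviation "H \<equiv> H1 D A"
abbreviation "nrm \<equiv> norm1 D A"

text \<open>Together with \<open>inner_le_norm1\<close> this makes \<open>nrm u\<close> the least
  constant that bounds \<open>inner u \<psi>\<close> by the \<open>H^-1\<close> norm
  \<open>sqrt (inner (R \<psi>) \<psi>)\<close>. Most later facts on \<open>H^1\<close> rest on this
  duality.\<close>

lemma norm1_leI:
  assumes "0 \<le> M" "\<And>\<psi>. inner u \<psi> \<le> M * sqrt (inner (R \<psi>) \<psi>)"
  shows "u \<in> H" "nrm u \<le> M"
proof -
  have b: "x \<le> M" if "x \<in> half_set D A u" for x
    using that unfolding half_set_eq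
  proof (elim insertE CollectE exE conjE)
    fix \<psi> assume "x = inner u \<psi> / sqrt (inner (R \<psi>) \<psi>)" "\<psi> \<noteq> 0"
    then show ?thesis using assms(2)[of \<psi>] R_pos[of \<psi>] by (simp add: divide_le_eq)
  qed (use assms in simp)
  then show "u \<in> H" by (auto simp: H1_def bdd_above_def)
  show "nrm u \<le> M" unfolding norm1_def by (rule cSup_least) (auto simp: b half_set_def)
qed

lemma inner_le_norm1:
  assumes "u \<in> H"
  shows "inner u \<psi> \<le> nrm u * sqrt (inner (R \<psi>) \<psi>)"
proof (cases "\<psi> = 0")
  case False
  then have "inner u \<psi> / sqrt (inner (R \<psi>) \<psi>) \<le> nrm u"
    unfolding norm1_def using assms by (intro cSup_upper) (auto simp: half_set_eq H1_def)
  then show ?thesis using R_pos[OF False] by (simp add: divide_le_eq)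
qed simp

lemma norm1_nonneg: "u \<in> H \<Longrightarrow> 0 \<le> nrm u"
  unfolding norm1_def by (intro cSup_upper) (auto simp: half_set_def H1_def)

lemma norm1_zero: "0 \<in> H" "nrm 0 = 0"
  using norm1_leI[of 0 0] norm1_nonneg[of 0] by auto

lemma H1_add: "u \<in> H \<Longrightarrow> v \<in> H \<Longrightarrow> u + v \<in> H"
  and norm1_triangle: "u \<in> H \<Longrightarrow> v \<in> H \<Longrightarrow> nrm (u + v) \<le> nrm u + nrm v"
proof -
  assume uv: "u \<in> H" "v \<in> H"
  have "inner (u + v) \<psi> \<le> (nrm u + nrm v) * sqrt (inner (R \<psi>) \<psi>)" for \<psi>
    using inner_le_norm1[OF uv(1), of \<psi>] inner_le_norm1[OF uv(2), of \<psi>]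
    by (simp add: inner_add_left distrib_right)
  then show "u + v \<in> H" "nrm (u + v) \<le> nrm u + nrm v"
    using norm1_leI[of "nrm u + nrm v" "u + v"] norm1_nonneg uv by auto
qed

lemma H1_scale: "u \<in> H \<Longrightarrow> c *\<^sub>R u \<in> H"
  and norm1_scale_le: "u \<in> H \<Longrightarrow> nrm (c *\<^sub>R u) \<le> \<bar>c\<bar> * nrm u"
proof -
  assume u: "u \<in> H"
  have "inner (c *\<^sub>R u) \<psi> \<le> (\<bar>c\<bar> * nrm u) * sqrt (inner (R \<psi>) \<psi>)" for \<psi>
  proof -
    have "inner (c *\<^sub>R u) \<psi> = inner u (c *\<^sub>R \<psi>)" by simp
    also have "\<dots> \<le> nrm u * sqrt (inner (R (c *\<^sub>R \<psi>)) (c *\<^sub>R \<psi>))" by (rule inner_le_norm1[OF u])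
    also have "inner (R (c *\<^sub>R \<psi>)) (c *\<^sub>R \<psi>) = c\<^sup>2 * inner (R \<psi>) \<psi>"
      by (simp add: R.scaleR power2_eq_square)
    finally show ?thesis by (simp add: real_sqrt_mult mult_ac)
  qed
  then show "c *\<^sub>R u \<in> H" "nrm (c *\<^sub>R u) \<le> \<bar>c\<bar> * nrm u"
    using norm1_leI[of "\<bar>c\<bar> * nrm u" "c *\<^sub>R u"] norm1_nonneg[OF u] by auto
qed

lemma H1_diff: "u \<in> H \<Longrightarrow> v \<in> H \<Longrightarrow> u - v \<in> H"
  using H1_add[of u "(-1) *\<^sub>R v"] H1_scale[of v "-1"] by simp

lemma norm1_minus_le: "u \<in> H \<Longrightarrow> nrm (- u) \<le> nrm u"
  using norm1_scale_le[of u "-1"] by simp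

lemma norm1_minus_commute: "u \<in> H \<Longrightarrow> v \<in> H \<Longrightarrow> nrm (u - v) = nrm (v - u)"
  using norm1_minus_le[of "u - v"] norm1_minus_le[of "v - u"] by (simp add: H1_diff)

text \<open>The duality is tested with \<open>\<psi> = u\<close>, and the form of \<open>R\<close>
  is at most \<open>k * (norm u)\<^sup>2\<close>; this is the origin of
  \<open>sqrt k\<close>.\<close>

lemma norm_le_norm1:
  assumes "u \<in> H"
  shows "norm u \<le> sqrt k * nrm u"
proof (cases "u = 0")
  case False
  have "norm u * norm u = inner u u" by (simp add: dot_square_norm power2_eq_square)
  also have "\<dots> \<le> nrm u * sqrt (inner (R u) u)" by (rule inner_le_norm1[OF assms])
  also have "\<dots> \<le> nrm u * sqrt (k * (norm u)\<^sup>2)"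
    using norm1_nonneg[OF assms] R_form_le by (intro mult_left_mono real_sqrt_le_mono)
  also have "\<dots> = norm u * (sqrt k * nrm u)" by (simp add: real_sqrt_mult)
  finally show ?thesis using False by (meson mult_le_cancel_left_pos zero_less_norm_iff)
qed (use norm1_zero in simp)

text \<open>The upper bound is the Cauchy-Schwarz inequality for the form of \<open>R\<close>,
  attained at \<open>\<psi> = a\<close>. On the range of \<open>R\<close> it turns
  \<open>H^1\<close> norms into quadratic forms that can be differentiated in time.\<close>

lemma R_in_H1: "R a \<in> H"
  and norm1_R: "nrm (R a) = sqrt (inner (R a) a)"
proof -
  have 1: "R a \<in> H" "nrm (R a) \<le> sqrt (inner (R a) a)"
    using norm1_leI[of "sqrt (inner (R a) a)" "R a"] R_cauchy_schwarz R_nonneg by auto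
  then show "R a \<in> H" by blast
  have "sqrt (inner (R a) a) \<le> nrm (R a)"
  proof (cases "a = 0")
    case False
    have "sqrt (inner (R a) a) * sqrt (inner (R a) a) = inner (R a) a" using R_nonneg by simp
    also have "\<dots> \<le> nrm (R a) * sqrt (inner (R a) a)" by (rule inner_le_norm1[OF 1(1)])
    finally show ?thesis using R_pos[OF False] by (meson mult_right_le_imp_le real_sqrt_gt_zero)
  qed (use norm1_zero in simp)
  with 1 show "nrm (R a) = sqrt (inner (R a) a)" by simp
qed

lemma norm1_R_le: "nrm (R a) \<le> sqrt k * norm a"
  using real_sqrt_le_mono[OF R_form_le[of a]] by (simp add: norm1_R real_sqrt_mult)

text \<open>A supremum of continuous functionals is lower semicontinuous. This carries
  \<open>H^1\<close> bounds through limits that are known only in the base norm.\<close>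

lemma norm1_lsc:
  assumes "u \<longlonglongrightarrow> l" "0 \<le> M" "\<forall>\<^sub>F n in sequentially. u n \<in> H \<and> nrm (u n) \<le> M"
  shows "l \<in> H" "nrm l \<le> M"
proof -
  have "inner l \<psi> \<le> M * sqrt (inner (R \<psi>) \<psi>)" for \<psi>
  proof (rule tendsto_upperbound)
    show "(\<lambda>n. inner (u n) \<psi>) \<longlonglongrightarrow> inner l \<psi>" by (intro tendsto_intros assms)
    show "\<forall>\<^sub>F n in sequentially. inner (u n) \<psi> \<le> M * sqrt (inner (R \<psi>) \<psi>)"
    proof (rule eventually_mono[OF assms(3)], elim conjE)
      fix n assume "u n \<in> H" "nrm (u n) \<le> M"
      then show "inner (u n) \<psi> \<le> M * sqrt (inner (R \<psi>) \<psi>)"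
        using inner_le_norm1[of "u n" \<psi>] R_nonneg[of \<psi>]
        by (meson mult_right_mono order_trans real_sqrt_ge_zero)
    qed
  qed auto
  then show "l \<in> H" "nrm l \<le> M" using norm1_leI assms(2) by blast+
qed

text \<open>\<open>R + \<epsilon>\<close> is itself strictly positive selfadjoint with full domain,
  so the inversion result applies to it. The contraction bound, obtained by testing with
  \<open>R (T x)\<close>, does not depend on \<epsilon>.\<close>

lemma R_shift_inverse:
  assumes "\<epsilon> > 0"
  obtains T where "bounded_linear T" "\<And>x. R (T x) + \<epsilon> *\<^sub>R T x = x" "\<And>x. T (R x) = R (T x)"
    "\<And>x. norm (R (T x)) \<le> norm x"
proof -
  let ?B = "\<lambda>x. R x + \<epsilon> *\<^sub>R x"
  have coer: "\<epsilon> * (norm x)\<^sup>2 \<le> inner (?B x) x" for x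
    using R_nonneg[of x] by (simp add: inner_add_left dot_square_norm)
  have adj: "?B v = w" if "\<forall>u. inner (?B u) v = inner u w" for v w
  proof -
    have "inner u (?B v - w) = 0" for u
      using that[rule_format, of u] by (simp add: inner_add_left inner_add_right inner_diff_right sym)
    then show ?thesis using inner_eq_zero_iff[of "?B v - w"] by simp
  qed
  have "strictly_pos_selfadjoint UNIV ?B"
    unfolding strictly_pos_selfadjoint_def
  proof (intro conjI)
    show "\<forall>v w. (\<forall>u\<in>UNIV. inner (?B u) v = inner u w) \<longrightarrow> v \<in> UNIV \<and> ?B v = w"
      using adj by simp
    show "\<exists>c>0. \<forall>x\<in>UNIV. c * (norm x)\<^sup>2 \<le> inner (?B x) x" using coer assms by blast
  qed (auto simp: R.add R.scaleR scaleR_add_right inner_add_left inner_add_right sym)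
  then obtain T where T: "bounded_linear T" "\<And>x. ?B (T x) = x" "\<And>x. T (?B x) = x"
    using strictly_pos_selfadjoint_inverse[of UNIV ?B] by (metis UNIV_I)
  interpret T: bounded_linear T by fact
  have comm: "T (R x) = R (T x)" for x
  proof -
    have "T (R x) = T (R (?B (T x)))" by (simp only: T(2))
    also have "R (?B (T x)) = ?B (R (T x))" by (simp add: R.add R.scaleR)
    finally show ?thesis by (simp only: T(3))
  qed
  have "norm (R (T x)) \<le> norm x" for x
  proof (cases "R (T x) = 0")
    case False
    have "norm (R (T x)) * norm (R (T x)) = inner (R (T x)) (R (T x))"
      by (simp add: dot_square_norm power2_eq_square)
    also have "\<dots> \<le> inner (R (T x)) (?B (T x))"
      using R_nonneg[of "T x"] assms by (simp add: inner_add_right)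
    also have "\<dots> = inner (R (T x)) x" by (simp only: T(2))
    also have "\<dots> \<le> norm (R (T x)) * norm x" by (rule norm_cauchy_schwarz)
    finally show ?thesis using False by (meson mult_le_cancel_left_pos zero_less_norm_iff)
  qed simp
  then show ?thesis using that[of T] T comm by blast
qed

text \<open>Density of \<open>D\<close> is lifted through \<open>R\<close>: a point \<open>d\<close>
  of \<open>D\<close> near \<open>x\<close> equals \<open>R (A d)\<close>, and the induction
  hypothesis approximates \<open>A d\<close>.\<close>

lemma R_pow_dense: "\<epsilon> > 0 \<Longrightarrow> \<exists>z. norm (x - (R ^^ j) z) < \<epsilon>"
proof (induction j arbitrary: x \<epsilon>)
  case 0
  then show ?case by (intro exI[of _ x]) simp
next
  case (Suc j)
  have "x \<in> closure D" by (simp add: dense)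
  then obtain d where d: "d \<in> D" "dist d x < \<epsilon> / 2"
    using Suc.prems by (meson closure_approachable half_gt_zero)
  obtain z where z: "norm (A d - (R ^^ j) z) < \<epsilon> / (2 * k)"
    using Suc.IH[of "\<epsilon> / (2 * k)"] Suc.prems k_pos by auto
  have "x - (R ^^ Suc j) z = (x - d) + R (A d - (R ^^ j) z)" by (simp add: R.diff RA d)
  also have "norm \<dots> \<le> norm (x - d) + k * norm (A d - (R ^^ j) z)"
    using norm_triangle_ineq[of "x - d"] bound by (meson add_left_mono order_trans)
  also have "\<dots> < \<epsilon> / 2 + k * (\<epsilon> / (2 * k))"
    using d(2) mult_strict_left_mono[OF z k_pos] by (intro add_strict_mono) (simp_all add: dist_norm norm_minus_commute)
  also have "\<dots> = \<epsilon>" using k_pos by simp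
  finally show ?case by blast
qed

text \<open>The approximants are the resolvents \<open>R (a n) = (1 + d n A)\<^sup>-\<^sup>1 u\<close>. The sequence \<open>inner (a n) u\<close> is
  increasing and bounded, and its increments dominate the squared distances of the approximants.\<close>

lemma D_dense_in_H1:
  assumes u: "u \<in> H" and e: "\<epsilon> > 0"
  shows "\<exists>a. nrm (u - R a) < \<epsilon>"
proof -
  define d where "d n = 1 / real (Suc n)" for n
  have d: "d n > 0" for n by (simp add: d_def)
  have "\<exists>a. R a + d n *\<^sub>R a = u" for n using R_shift_inverse[OF d] by metis
  then obtain a where a: "\<And>n. R (a n) + d n *\<^sub>R a n = u" by metis
  have Ra: "R (a n) = u - d n *\<^sub>R a n" for n using a[of n] by (simp add: algebra_simps)
  define p where "p n = inner (a n) u" for n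
  have form: "inner (R (a n)) (a n) \<le> p n" for n
    unfolding p_def using d[of n] arg_cong[OF a[of n], of "inner (a n)"]
    by (simp add: inner_add_right inner_commute) (smt (verit) inner_ge_zero mult_nonneg_nonneg)
  have p_le: "p n \<le> (nrm u)\<^sup>2" for n
  proof -
    have pn: "0 \<le> p n" using form[of n] R_nonneg[of "a n"] by linarith
    \<comment> \<open>\<open>p n\<close> is bounded by \<open>nrm u\<close> times its own square
      root, which closes the estimate.\<close>
    have "p n \<le> nrm u * sqrt (inner (R (a n)) (a n))"
      using inner_le_norm1[OF u, of "a n"] by (simp add: p_def inner_commute)
    also have "\<dots> \<le> nrm u * sqrt (p n)"
      using form norm1_nonneg[OF u] by (intro mult_left_mono real_sqrt_le_mono)
    finally have le: "sqrt (p n) * sqrt (p n) \<le> nrm u * sqrt (p n)" using pn by simp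
    have "sqrt (p n) \<le> nrm u"
    proof (cases "p n = 0")
      case False
      then show ?thesis using mult_right_le_imp_le[OF le] pn by simp
    qed (use norm1_nonneg[OF u] in simp)
    then have "(sqrt (p n))\<^sup>2 \<le> (nrm u)\<^sup>2" using pn by (intro power_mono) auto
    then show ?thesis using pn by simp
  qed
  have key: "(nrm (R (a n) - R (a m)))\<^sup>2 \<le> p n - p m" if "m \<le> n" for m n
  proof -
    let ?x = "a n" and ?y = "a m"
    have dnm: "d n \<le> d m" using that by (simp add: d_def frac_le)
    have Z: "R (?x - ?y) = d m *\<^sub>R ?y - d n *\<^sub>R ?x" by (simp add: R.diff Ra)
    have "p n - p m = inner (?x - ?y) (R ?x + d n *\<^sub>R ?x)" by (simp add: p_def inner_diff_left a)
    also have "\<dots> = inner (R (?x - ?y)) ?x + d n * inner (?x - ?y) ?x"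
      by (simp add: inner_add_right sym)
    finally have p: "p n - p m = inner (R (?x - ?y)) ?x + d n * inner (?x - ?y) ?x" .
    have "(nrm (R (a n) - R (a m)))\<^sup>2 = inner (R (?x - ?y)) (?x - ?y)"
      unfolding R.diff[symmetric] norm1_R using R_nonneg by simp
    then have "p n - p m - (nrm (R (a n) - R (a m)))\<^sup>2
        = d n * inner (?x - ?y) (?x - ?y) + (d m - d n) * inner ?y ?y"
      unfolding p Z
      by (simp add: inner_diff_left inner_diff_right inner_commute[of "a m" "a n"] algebra_simps)
    also have "\<dots> \<ge> 0" using dnm d[of n] by simp
    finally show ?thesis by simp
  qed
  have "incseq p" using key by (intro monoI) (smt (verit) zero_le_power2)
  then have "convergent p"
    by (metis convergent_def incseq_convergent p_le)
  then have "Cauchy p" by (rule convergent_Cauchy)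
  then obtain N where N: "\<And>m n. m \<ge> N \<Longrightarrow> n \<ge> N \<Longrightarrow> \<bar>p m - p n\<bar> < (\<epsilon> / 2)\<^sup>2"
    using metric_CauchyD[of p "(\<epsilon> / 2)\<^sup>2"] e by (auto simp: dist_real_def)
  have close: "nrm (R (a n) - R (a N)) \<le> \<epsilon> / 2" if "n \<ge> N" for n
  proof -
    have "(nrm (R (a n) - R (a N)))\<^sup>2 \<le> (\<epsilon> / 2)\<^sup>2" using key[OF that] N[of n N] that by linarith
    then show ?thesis by (rule power2_le_imp_le) (use e in simp)
  qed
  have "(\<lambda>n. norm (d n *\<^sub>R a n)) \<longlonglongrightarrow> 0"
  proof (rule tendsto_sandwich[where f = "\<lambda>n. 0" and h = "\<lambda>n. sqrt (d n) * nrm u"])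
    have "norm (d n *\<^sub>R a n) \<le> sqrt (d n) * nrm u" for n
    proof (rule power2_le_imp_le)
      have "d n * inner (a n) (a n) \<le> p n"
        unfolding p_def using d[of n] R_nonneg[of "a n"] arg_cong[OF a[of n], of "inner (a n)"]
        by (simp add: inner_add_right inner_commute)
      then have "d n * (d n * (norm (a n))\<^sup>2) \<le> d n * (nrm u)\<^sup>2"
        using p_le[of n] d[of n] by (intro mult_left_mono) (auto simp: dot_square_norm)
      moreover have "(norm (d n *\<^sub>R a n))\<^sup>2 = d n * (d n * (norm (a n))\<^sup>2)"
        by (simp add: power_mult_distrib power2_eq_square)
      moreover have "(sqrt (d n) * nrm u)\<^sup>2 = d n * (nrm u)\<^sup>2"
        using d[of n] by (simp add: power_mult_distrib)
      ultimately show "(norm (d n *\<^sub>R a n))\<^sup>2 \<le> (sqrt (d n) * nrm u)\<^sup>2" by simp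
    qed (use norm1_nonneg[OF u] d[of n] in auto)
    then show "\<forall>\<^sub>F n in sequentially. norm (d n *\<^sub>R a n) \<le> sqrt (d n) * nrm u" by simp
    have "d \<longlonglongrightarrow> 0" unfolding d_def by (rule LIMSEQ_Suc[OF lim_1_over_n])
    then have "(\<lambda>n. sqrt (d n) * nrm u) \<longlonglongrightarrow> sqrt 0 * nrm u" by (intro tendsto_intros)
    then show "(\<lambda>n. sqrt (d n) * nrm u) \<longlonglongrightarrow> 0" by simp
  qed auto
  then have "(\<lambda>n. d n *\<^sub>R a n) \<longlonglongrightarrow> 0" by (rule tendsto_norm_zero_cancel)
  then have "(\<lambda>n. u - d n *\<^sub>R a n - R (a N)) \<longlonglongrightarrow> u - 0 - R (a N)"
    by (intro tendsto_diff tendsto_const)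
  then have lim: "(\<lambda>n. R (a n) - R (a N)) \<longlonglongrightarrow> u - R (a N)" by (simp add: Ra[symmetric])
  \<comment> \<open>The bound on \<open>R (a n) - R (a N)\<close> is uniform in \<open>n\<close>;
    lower semicontinuity along the base-norm limit transfers it to \<open>u\<close>.\<close>
  have "nrm (u - R (a N)) \<le> \<epsilon> / 2"
    using close e by (intro norm1_lsc(2)[OF lim]) (auto simp: eventually_sequentially R_in_H1 H1_diff)
  then show ?thesis using e by (intro exI[of _ "a N"]) simp
qed

text \<open>One power of \<open>R\<close> is spent on the \<open>H^1\<close> norm, since
  \<open>R\<close> is bounded from the base space into \<open>H^1\<close>; the other
  \<open>j\<close> powers are approximated in the base norm.\<close>

lemma R_pow_dense_in_H1:
  assumes u: "u \<in> H" and e: "\<epsilon> > 0"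
  shows "\<exists>z. nrm (u - (R ^^ Suc j) z) < \<epsilon>"
proof -
  obtain a where a: "nrm (u - R a) < \<epsilon> / 2" using D_dense_in_H1[OF u, of "\<epsilon> / 2"] e by auto
  obtain z where z: "norm (a - (R ^^ j) z) < \<epsilon> / (2 * sqrt k)"
    using R_pow_dense[of "\<epsilon> / (2 * sqrt k)" a j] e k_pos by auto
  have "nrm (u - (R ^^ Suc j) z) = nrm ((u - R a) + R (a - (R ^^ j) z))" by (simp add: R.diff)
  also have "\<dots> \<le> nrm (u - R a) + sqrt k * norm (a - (R ^^ j) z)"
    using norm1_triangle[OF H1_diff[OF u R_in_H1] R_in_H1] norm1_R_le
    by (meson add_left_mono order_trans)
  also have "\<dots> < \<epsilon> / 2 + sqrt k * (\<epsilon> / (2 * sqrt k))"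
    using a z k_pos by (intro add_strict_mono mult_strict_left_mono) auto
  also have "\<dots> = \<epsilon>" using k_pos by simp
  finally show ?thesis by blast
qed

end

lemma strictly_pos_selfadjoint_imp_spsa_inverse:
  assumes "strictly_pos_selfadjoint D A"
  shows "\<exists>R k. spsa_inverse D A R k"
proof (rule strictly_pos_selfadjoint_inverse[OF assms], intro exI)
  fix R k
  assume "bounded_linear R" "k > 0" "\<And>x. R x \<in> D" "\<And>x. A (R x) = x" "\<And>x. x \<in> D \<Longrightarrow> R (A x) = x"
    "\<And>x y. inner (R x) y = inner x (R y)" "\<And>x. (norm (R x))\<^sup>2 \<le> k * inner (R x) x"
    "\<And>x. norm (R x) \<le> k * norm x"
  moreover have "closure D = UNIV" using assms unfolding strictly_pos_selfadjoint_def by blast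
  ultimately show "spsa_inverse D A R k" by (intro spsa_inverse.intro)
qed

section \<open>The energy estimate\<close>

locale mgt_system = spsa_inverse D A R k
  for D :: "'a::{real_inner,complete_space} set" and A R k +
  fixes \<alpha> \<beta> \<gamma> \<kappa> \<eta> :: real
  assumes \<alpha>_pos: "\<alpha> > 0" and \<beta>_pos: "\<beta> > 0" and \<gamma>_pos: "\<gamma> > 0" and \<kappa>_pos: "\<kappa> > 0"
    and \<mu>_nonneg: "\<gamma> - \<alpha> * \<beta> \<ge> 0"
begin

definition \<rho> where "\<rho> = \<gamma> / \<beta>"
definition \<delta> where "\<delta> = \<rho> - \<alpha>"
text \<open>The sum of two growth coefficients: \<open>\<delta> * (2 + \<rho>) + 1 / \<beta>\<close>
  is that of the \<open>r\<close> term divided by its weight \<beta>, and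
  \<open>\<beta> * \<delta> * \<rho> + 1\<close> is that of the \<open>u\<close> term.\<close>

definition \<omega> where "\<omega> = \<delta> * (2 + \<rho>) + 1 / \<beta> + \<beta> * \<delta> * \<rho> + 1"

lemma \<rho>_pos: "\<rho> > 0" using \<beta>_pos \<gamma>_pos by (simp add: \<rho>_def)
lemma \<delta>_nonneg: "\<delta> \<ge> 0" using \<beta>_pos \<mu>_nonneg by (simp add: \<rho>_def \<delta>_def field_simps)
lemma \<omega>_nonneg: "\<omega> \<ge> 0" using \<rho>_pos \<delta>_nonneg \<beta>_pos by (simp add: \<omega>_def)
lemma \<beta>\<rho>: "\<beta> * \<rho> = \<gamma>" using \<beta>_pos by (simp add: \<rho>_def)

text \<open>The system reads \<open>(evol_lhs R U)' = evol_rhs R U\<close>: applying \<open>R\<close>, the inverse of \<open>A\<close>,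
  to the last two equations leaves only bounded operators.\<close>

definition evol_lhs :: "('a \<Rightarrow> 'a) \<Rightarrow> 'a \<times> 'a \<times> 'a \<times> 'a \<Rightarrow> 'a \<times> 'a \<times> 'a \<times> 'a" where
  "evol_lhs B = (\<lambda>(u, v, w, \<theta>). (u, v, B w, B \<theta>))"

definition evol_rhs :: "('a \<Rightarrow> 'a) \<Rightarrow> 'a \<times> 'a \<times> 'a \<times> 'a \<Rightarrow> 'a \<times> 'a \<times> 'a \<times> 'a" where
  "evol_rhs B = (\<lambda>(u, v, w, \<theta>). (v, w, \<eta> *\<^sub>R \<theta> - \<beta> *\<^sub>R v - \<gamma> *\<^sub>R u - \<alpha> *\<^sub>R B w,
     - (\<kappa> *\<^sub>R \<theta> + \<eta> *\<^sub>R (w + \<alpha> *\<^sub>R v))))"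

text \<open>With \<open>S\<close> the identity and \<open>Q\<close> equal to \<open>R\<close>,
  possibly shifted, this is the lower energy. With \<open>S = R\<close> and \<open>Q\<close> the
  square of \<open>R\<close> it is, by \<open>norm1_R\<close>, the phase-space energy of
  \<open>map4 R U\<close>. The term in \<open>u\<close> is there because \<open>r\<close> alone does
  not determine \<open>u\<close> and \<open>v\<close>.\<close>

definition energy :: "('a \<Rightarrow> 'a) \<Rightarrow> ('a \<Rightarrow> 'a) \<Rightarrow> 'a \<times> 'a \<times> 'a \<times> 'a \<Rightarrow> real" where
  "energy S Q = (\<lambda>(u, v, w, \<theta>). \<beta> * inner (S (v + \<rho> *\<^sub>R u)) (v + \<rho> *\<^sub>R u)
     + inner (Q (w + \<alpha> *\<^sub>R v)) (w + \<alpha> *\<^sub>R v) + inner (Q \<theta>) \<theta> + inner (S u) u)"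

text \<open>In the variables \<open>r = v + \<rho> u\<close> and \<open>q = w + \<alpha> v\<close> the unbounded coupling terms cancel
  and only terms in \<open>r\<close> and \<open>u\<close> are left to be absorbed.\<close>

lemma energy_rate_le:
  fixes u v w \<theta> f g :: 'a
  assumes S: "linear S" and sym: "\<And>x y. inner (S x) y = inner x (S y)"
    and S0: "\<And>x. 0 \<le> inner (S x) x" and Q0: "\<And>x. 0 \<le> inner (Q x) x"
  shows "\<beta> * (2 * inner (S (w + \<rho> *\<^sub>R v)) (v + \<rho> *\<^sub>R u))
      + 2 * inner (S (\<eta> *\<^sub>R \<theta> - \<beta> *\<^sub>R v - \<gamma> *\<^sub>R u) + f) (w + \<alpha> *\<^sub>R v)
      + 2 * inner (g - S (\<kappa> *\<^sub>R \<theta> + \<eta> *\<^sub>R (w + \<alpha> *\<^sub>R v))) \<theta> + 2 * inner (S v) u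
    \<le> \<omega> * energy S Q (u, v, w, \<theta>) + (2 * inner f (w + \<alpha> *\<^sub>R v) + 2 * inner g \<theta>)"
proof -
  interpret S: linear S by fact
  define r where "r = v + \<rho> *\<^sub>R u"
  define q where "q = w + \<alpha> *\<^sub>R v"
  have v: "v = r - \<rho> *\<^sub>R u" by (simp add: r_def)
  have w: "w + \<rho> *\<^sub>R v = q + \<delta> *\<^sub>R v" by (simp add: q_def \<delta>_def algebra_simps)
  have br: "\<eta> *\<^sub>R \<theta> - \<beta> *\<^sub>R v - \<gamma> *\<^sub>R u = \<eta> *\<^sub>R \<theta> - \<beta> *\<^sub>R r"
    by (simp add: r_def scaleR_add_right \<beta>\<rho>)
  have c: "inner (S x) y = inner (S y) x" for x y using trans[OF sym inner_commute] .
  have young: "2 * inner (S r) u \<le> inner (S r) r + inner (S u) u"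
  proof -
    have "0 \<le> inner (S (r - u)) (r - u)" by (rule S0)
    also have "\<dots> = inner (S r) r - inner (S r) u - inner (S u) r + inner (S u) u"
      by (simp add: S.diff inner_diff_left inner_diff_right)
    finally show ?thesis using c[of r u] by linarith
  qed
  have young': "- (2 * inner (S r) u) \<le> inner (S r) r + inner (S u) u"
  proof -
    have "0 \<le> inner (S (r + u)) (r + u)" by (rule S0)
    also have "\<dots> = inner (S r) r + inner (S r) u + inner (S u) r + inner (S u) u"
      by (simp add: S.add inner_add_left inner_add_right)
    finally show ?thesis using c[of r u] by linarith
  qed
  have "\<beta> * (2 * inner (S (q + \<delta> *\<^sub>R v)) r) + 2 * inner (S (\<eta> *\<^sub>R \<theta> - \<beta> *\<^sub>R r) + f) q
      + 2 * inner (g - S (\<kappa> *\<^sub>R \<theta> + \<eta> *\<^sub>R q)) \<theta> + 2 * inner (S v) u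
    = 2 * \<beta> * \<delta> * inner (S r) r + \<beta> * \<delta> * \<rho> * (- (2 * inner (S r) u)) - 2 * \<kappa> * inner (S \<theta>) \<theta>
      + 2 * inner (S r) u - 2 * \<rho> * inner (S u) u + 2 * inner f q + 2 * inner g \<theta>"
    unfolding v
    by (simp add: S.add S.diff S.scale inner_add_left inner_diff_left c[of q r] c[of u r] c[of q \<theta>] algebra_simps)
  \<comment> \<open>The dissipation \<open>- 2 * \<kappa> * inner (S \<theta>) \<theta>\<close> and
    the term \<open>- 2 * \<rho> * inner (S u) u\<close> have a favourable sign and are dropped; the
    mixed products of \<open>r\<close> and \<open>u\<close> are split by \<open>young\<close> and
    \<open>young'\<close>.\<close>
  also have "\<dots> \<le> 2 * \<beta> * \<delta> * inner (S r) r + \<beta> * \<delta> * \<rho> * (inner (S r) r + inner (S u) u)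
      + (inner (S r) r + inner (S u) u) + 2 * inner f q + 2 * inner g \<theta>"
  proof -
    have "\<beta> * \<delta> * \<rho> * (- (2 * inner (S r) u)) \<le> \<beta> * \<delta> * \<rho> * (inner (S r) r + inner (S u) u)"
      using young' \<beta>_pos \<delta>_nonneg \<rho>_pos by (intro mult_left_mono) auto
    moreover have "0 \<le> 2 * \<kappa> * inner (S \<theta>) \<theta>" "0 \<le> 2 * \<rho> * inner (S u) u"
      using \<kappa>_pos \<rho>_pos S0 by auto
    ultimately show ?thesis using young by linarith
  qed
  also have "\<dots> \<le> \<omega> * (\<beta> * inner (S r) r + inner (Q q) q + inner (Q \<theta>) \<theta> + inner (S u) u)
      + (2 * inner f q + 2 * inner g \<theta>)"
  proof -
    have "(2 * \<beta> * \<delta> + \<beta> * \<delta> * \<rho> + 1) * inner (S r) r \<le> \<omega> * \<beta> * inner (S r) r"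
      using S0[of r] \<beta>_pos \<delta>_nonneg \<rho>_pos
      by (intro mult_right_mono) (auto simp: \<omega>_def algebra_simps)
    moreover have "(\<beta> * \<delta> * \<rho> + 1) * inner (S u) u \<le> \<omega> * inner (S u) u"
      using S0[of u] \<beta>_pos \<delta>_nonneg \<rho>_pos by (intro mult_right_mono) (auto simp: \<omega>_def)
    moreover have "0 \<le> \<omega> * (inner (Q q) q + inner (Q \<theta>) \<theta>)" using Q0 \<omega>_nonneg by simp
    ultimately show ?thesis by (simp add: algebra_simps)
  qed
  finally show ?thesis unfolding w br energy_def by (simp add: r_def q_def)
qed

text \<open>Weighting \<open>q\<close> and \<theta> by \<open>S\<close> after \<open>B\<close> makes
  the energy differentiable: the derivative of \<open>S (B q)\<close> is \<open>S\<close> applied to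
  that of \<open>B q\<close>, which the equation supplies. The forcing \<open>f\<close>,
  \<open>g\<close> leaves room for comparing two approximations.\<close>

lemma energy_growth:
  assumes S: "bounded_linear S" and symS: "\<And>x y. inner (S x) y = inner x (S y)"
    and S0: "\<And>x. 0 \<le> inner (S x) x"
    and B: "bounded_linear B" and symB: "\<And>x y. inner (B x) y = inner x (B y)"
    and comm: "\<And>x. S (B x) = B (S x)" and Q0: "\<And>x. 0 \<le> inner (S (B x)) x"
    and cont: "continuous_on {0..\<tau>} U"
    and der: "\<And>t. t \<in> {0..\<tau>} \<Longrightarrow>
      ((\<lambda>t. evol_lhs B (U t)) has_vector_derivative evol_rhs B (U t) + (0, 0, f t, g t)) (at t within {0..\<tau>})"
    and K: "K \<ge> 0" "\<And>t u v w \<theta>. t \<in> {0..\<tau>} \<Longrightarrow> U t = (u, v, w, \<theta>) \<Longrightarrow>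
      2 * inner (S (f t)) (w + \<alpha> *\<^sub>R v) + 2 * inner (S (g t)) \<theta> \<le> K"
    and t: "t \<in> {0..\<tau>}"
  shows "energy S (\<lambda>x. S (B x)) (U t) \<le> exp (\<omega> * t) * (energy S (\<lambda>x. S (B x)) (U 0) + K * t)"
proof -
  interpret S: bounded_linear S by fact
  interpret B: bounded_linear B by fact
  let ?Q = "\<lambda>x. S (B x)" and ?I = "{0..\<tau>}"
  define u v w \<theta> where defs: "u t = fst (U t)" "v t = fst (snd (U t))" "w t = fst (snd (snd (U t)))"
    "\<theta> t = snd (snd (snd (U t)))" for t
  have U: "U t = (u t, v t, w t, \<theta> t)" for t by (simp add: defs)
  have ct: "continuous (at t within ?I) u" "continuous (at t within ?I) v"
    "continuous (at t within ?I) w" "continuous (at t within ?I) \<theta>" if "t \<in> ?I" for t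
    using cont that unfolding defs continuous_on_eq_continuous_within
    by (auto intro!: continuous_intros)
  have d: "(u has_vector_derivative v t) (at t within ?I)"
    "(v has_vector_derivative w t) (at t within ?I)"
    "((\<lambda>t. B (w t)) has_vector_derivative
      \<eta> *\<^sub>R \<theta> t - \<beta> *\<^sub>R v t - \<gamma> *\<^sub>R u t - \<alpha> *\<^sub>R B (w t) + f t) (at t within ?I)"
    "((\<lambda>t. B (\<theta> t)) has_vector_derivative
      - (\<kappa> *\<^sub>R \<theta> t + \<eta> *\<^sub>R (w t + \<alpha> *\<^sub>R v t)) + g t) (at t within ?I)" if "t \<in> ?I" for t
  proof -
    note d0 = der[OF that, unfolded U evol_lhs_def evol_rhs_def, simplified]
    note d1 = bounded_linear.has_vector_derivative[OF bounded_linear_fst d0]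
    note d2 = bounded_linear.has_vector_derivative[OF bounded_linear_snd d0, simplified]
    note d3 = bounded_linear.has_vector_derivative[OF bounded_linear_snd d2, simplified]
    show "(u has_vector_derivative v t) (at t within ?I)" using d1 by simp
    show "(v has_vector_derivative w t) (at t within ?I)"
      using bounded_linear.has_vector_derivative[OF bounded_linear_fst d2] by simp
    show "((\<lambda>t. B (w t)) has_vector_derivative
      \<eta> *\<^sub>R \<theta> t - \<beta> *\<^sub>R v t - \<gamma> *\<^sub>R u t - \<alpha> *\<^sub>R B (w t) + f t) (at t within ?I)"
      using bounded_linear.has_vector_derivative[OF bounded_linear_fst d3] by simp
    show "((\<lambda>t. B (\<theta> t)) has_vector_derivative
      - (\<kappa> *\<^sub>R \<theta> t + \<eta> *\<^sub>R (w t + \<alpha> *\<^sub>R v t)) + g t) (at t within ?I)"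
      using bounded_linear.has_vector_derivative[OF bounded_linear_snd d3] by simp
  qed
  have symQ: "inner (?Q x) y = inner x (?Q y)" for x y by (simp add: symS symB comm)
  define E where "E t = energy S ?Q (U t)" for t
  define E' where "E' t = \<beta> * (2 * inner (S (w t + \<rho> *\<^sub>R v t)) (v t + \<rho> *\<^sub>R u t))
      + 2 * inner (S (\<eta> *\<^sub>R \<theta> t - \<beta> *\<^sub>R v t - \<gamma> *\<^sub>R u t) + S (f t)) (w t + \<alpha> *\<^sub>R v t)
      + 2 * inner (S (g t) - S (\<kappa> *\<^sub>R \<theta> t + \<eta> *\<^sub>R (w t + \<alpha> *\<^sub>R v t))) (\<theta> t) + 2 * inner (S (v t)) (u t)" for t
  have "E t \<le> exp (\<omega> * t) * (E 0 + K * t)"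
  proof (rule gronwall_real_derivative[OF _ _ \<omega>_nonneg K(1) t, of E E'])
    fix t assume t: "t \<in> ?I"
    note d = d[OF t] and ct = ct[OF t]
    have 1: "((\<lambda>t. S (v t + \<rho> *\<^sub>R u t)) has_vector_derivative S (w t + \<rho> *\<^sub>R v t)) (at t within ?I)"
      by (intro S.has_vector_derivative derivative_eq_intros d) (auto intro!: derivative_eq_intros d)
    \<comment> \<open>The summand \<open>\<alpha> *\<^sub>R B (v t)\<close> contributes
      \<open>\<alpha> *\<^sub>R B (w t)\<close>, which cancels the damping.\<close>
    have "((\<lambda>t. B (w t) + \<alpha> *\<^sub>R B (v t)) has_vector_derivative
        (\<eta> *\<^sub>R \<theta> t - \<beta> *\<^sub>R v t - \<gamma> *\<^sub>R u t - \<alpha> *\<^sub>R B (w t) + f t) + \<alpha> *\<^sub>R B (w t)) (at t within ?I)"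
      by (intro has_vector_derivative_add d
          bounded_linear.has_vector_derivative[OF bounded_linear_scaleR_right] B.has_vector_derivative)
    then have "((\<lambda>t. B (w t + \<alpha> *\<^sub>R v t)) has_vector_derivative
        (\<eta> *\<^sub>R \<theta> t - \<beta> *\<^sub>R v t - \<gamma> *\<^sub>R u t) + f t) (at t within ?I)"
      by (simp add: B.add B.scaleR)
    from S.has_vector_derivative[OF this]
    have 2: "((\<lambda>t. ?Q (w t + \<alpha> *\<^sub>R v t)) has_vector_derivative
        S (\<eta> *\<^sub>R \<theta> t - \<beta> *\<^sub>R v t - \<gamma> *\<^sub>R u t) + S (f t)) (at t within ?I)"
      by (simp add: S.add)
    have 3: "((\<lambda>t. ?Q (\<theta> t)) has_vector_derivative
        S (g t) - S (\<kappa> *\<^sub>R \<theta> t + \<eta> *\<^sub>R (w t + \<alpha> *\<^sub>R v t))) (at t within ?I)"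
      using S.has_vector_derivative[OF d(4)] by (simp add: S.add S.diff S.neg algebra_simps)
    have 4: "((\<lambda>t. S (u t)) has_vector_derivative S (v t)) (at t within ?I)"
      by (rule S.has_vector_derivative[OF d(1)])
    show "(E has_real_derivative E' t) (at t within ?I)"
      unfolding E_def E'_def U energy_def prod.case
      by (intro DERIV_add DERIV_cmult has_vector_derivative_inner_selfadjoint[OF symS 1]
          has_vector_derivative_inner_selfadjoint[OF symQ 2] has_vector_derivative_inner_selfadjoint[OF symQ 3]
          has_vector_derivative_inner_selfadjoint[OF symS 4] continuous_intros ct)
    show "E' t \<le> \<omega> * E t + K"
      using energy_rate_le[OF S.linear_axioms symS S0 Q0, of "w t" "v t" "u t" "\<theta> t" "S (f t)" "S (g t)"]
        K(2)[OF t U] unfolding E_def E'_def U by linarith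
  qed
  then show ?thesis by (simp add: E_def)
qed

section \<open>Bounded operators on quadruples and solutions of the evolution equation\<close>

definition map4 :: "('a \<Rightarrow> 'a) \<Rightarrow> 'a \<times> 'a \<times> 'a \<times> 'a \<Rightarrow> 'a \<times> 'a \<times> 'a \<times> 'a" where
  "map4 F = (\<lambda>(u, v, w, \<theta>). (F u, F v, F w, F \<theta>))"

text \<open>Here and in \<open>\<theta>src\<close> the argument of \<open>A\<close> in the equation
  for \<open>w\<close>, respectively \<theta>, is isolated (up to sign in the second), so that an
  approximation of \<open>A\<close> can be inserted.\<close>

definition wsrc :: "'a \<times> 'a \<times> 'a \<times> 'a \<Rightarrow> 'a" where
  "wsrc = (\<lambda>(u, v, w, \<theta>). \<eta> *\<^sub>R \<theta> - \<beta> *\<^sub>R v - \<gamma> *\<^sub>R u)"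

definition \<theta>src :: "'a \<times> 'a \<times> 'a \<times> 'a \<Rightarrow> 'a" where
  "\<theta>src = (\<lambda>(u, v, w, \<theta>). \<kappa> *\<^sub>R \<theta> + \<eta> *\<^sub>R (w + \<alpha> *\<^sub>R v))"

lemma bounded_linear_components:
  "bounded_linear (\<lambda>U::'a \<times> 'a \<times> 'a \<times> 'a. fst U)" "bounded_linear (\<lambda>U::'a \<times> 'a \<times> 'a \<times> 'a. fst (snd U))"
  "bounded_linear (\<lambda>U::'a \<times> 'a \<times> 'a \<times> 'a. fst (snd (snd U)))" "bounded_linear (\<lambda>U::'a \<times> 'a \<times> 'a \<times> 'a. snd (snd (snd U)))"
  by (intro bounded_linear_fst bounded_linear_fst_comp bounded_linear_snd_comp bounded_linear_ident)+

lemmas blin4 = bounded_linear_components bounded_linear_Pair bounded_linear_add bounded_linear_sub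
  bounded_linear_minus bounded_linear_const_scaleR

lemma bounded_linear_map4:
  assumes "bounded_linear F"
  shows "bounded_linear (map4 F)"
  unfolding map4_def case_prod_unfold by (intro blin4 bounded_linear_compose[OF assms])

lemma bounded_linear_wsrc: "bounded_linear wsrc"
  unfolding wsrc_def case_prod_unfold by (intro blin4)

lemma bounded_linear_\<theta>src: "bounded_linear \<theta>src"
  unfolding \<theta>src_def case_prod_unfold by (intro blin4)

lemma bounded_linear_evol_lhs:
  assumes "bounded_linear B"
  shows "bounded_linear (evol_lhs B)"
  unfolding evol_lhs_def case_prod_unfold by (intro blin4 bounded_linear_compose[OF assms])

lemma bounded_linear_evol_rhs:
  assumes "bounded_linear B"
  shows "bounded_linear (evol_rhs B)"
  unfolding evol_rhs_def case_prod_unfold by (intro blin4 bounded_linear_compose[OF assms])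

lemma bounded_linear_shift: "bounded_linear (\<lambda>x. R x + e *\<^sub>R x)"
  by (intro bounded_linear_add blin bounded_linear_scaleR_right)

text \<open>Differentiability is imposed on \<open>evol_lhs B U\<close> and not on \<open>U\<close>,
  since for \<open>B = R\<close> the last two components need only be continuous. Derivatives within
  \<open>{0..\<tau>}\<close> are one-sided at the endpoints.\<close>

definition solves :: "('a \<Rightarrow> 'a) \<Rightarrow> (real \<Rightarrow> 'a \<times> 'a \<times> 'a \<times> 'a) \<Rightarrow> bool" where
  "solves B U \<longleftrightarrow> continuous_on {0..} U \<and> (\<forall>\<tau>. \<forall>t\<in>{0..\<tau>}.
     ((\<lambda>t. evol_lhs B (U t)) has_vector_derivative evol_rhs B (U t)) (at t within {0..\<tau>}))"

lemma solvesI: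
  assumes "continuous_on {0..} U"
    and "\<And>\<tau> t. t \<in> {0..\<tau>} \<Longrightarrow>
      ((\<lambda>t. evol_lhs B (U t)) has_vector_derivative evol_rhs B (U t)) (at t within {0..\<tau>})"
  shows "solves B U"
  using assms unfolding solves_def by blast

lemma solves_continuous: "solves B U \<Longrightarrow> continuous_on {0..} U"
  unfolding solves_def by (rule conjunct1)

lemma solves_derivative: "solves B U \<Longrightarrow> t \<in> {0..\<tau>} \<Longrightarrow>
    ((\<lambda>t. evol_lhs B (U t)) has_vector_derivative evol_rhs B (U t)) (at t within {0..\<tau>})"
  unfolding solves_def by blast

lemma solves_continuous_on: "solves B U \<Longrightarrow> continuous_on {0..\<tau>} U"
  by (rule continuous_on_subset[OF solves_continuous]) auto

text \<open>A bounded operator commuting with \<open>B\<close> acts componentwise on solutions. With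
  \<open>F = R\<close> this is the device for gaining regularity.\<close>

lemma solves_map4:
  assumes F: "bounded_linear F" "\<And>x. F (B x) = B (F x)" and U: "solves B U"
  shows "solves B (\<lambda>t. map4 F (U t))"
proof -
  interpret F: bounded_linear F by fact
  interpret F4: bounded_linear "map4 F" by (rule bounded_linear_map4[OF F(1)])
  have 1: "evol_lhs B (map4 F x) = map4 F (evol_lhs B x)" for x
    by (simp add: evol_lhs_def map4_def case_prod_unfold F)
  have 2: "evol_rhs B (map4 F x) = map4 F (evol_rhs B x)" for x
    by (simp add: evol_rhs_def map4_def case_prod_unfold F F.add F.diff F.scaleR F.neg)
  show ?thesis
  proof (rule solvesI)
    show "continuous_on {0..} (\<lambda>t. map4 F (U t))"
      by (rule F4.continuous_on[OF solves_continuous[OF U]])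
    show "((\<lambda>t. evol_lhs B (map4 F (U t))) has_vector_derivative evol_rhs B (map4 F (U t))) (at t within {0..\<tau>})"
      if "t \<in> {0..\<tau>}" for t \<tau>
      unfolding 1 2 by (rule F4.has_vector_derivative[OF solves_derivative[OF U that]])
  qed
qed

lemma solves_diff:
  assumes B: "bounded_linear B" and U: "solves B U" "solves B V"
  shows "solves B (\<lambda>t. U t - V t)"
proof -
  interpret l: bounded_linear "evol_lhs B" by (rule bounded_linear_evol_lhs[OF B])
  interpret r: bounded_linear "evol_rhs B" by (rule bounded_linear_evol_rhs[OF B])
  show ?thesis
  proof (rule solvesI)
    show "continuous_on {0..} (\<lambda>t. U t - V t)"
      by (rule continuous_on_diff[OF U[THEN solves_continuous]])
    show "((\<lambda>t. evol_lhs B (U t - V t)) has_vector_derivative evol_rhs B (U t - V t)) (at t within {0..\<tau>})"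
      if "t \<in> {0..\<tau>}" for t \<tau>
      unfolding l.diff r.diff
      by (rule has_vector_derivative_diff[OF U[THEN solves_derivative, OF that]])
  qed
qed

text \<open>The equation is autonomous; together with uniqueness this gives the semigroup
  law.\<close>

lemma solves_shift:
  assumes U: "solves B U" and s: "s \<ge> 0"
  shows "solves B (\<lambda>t. U (t + s))"
proof (rule solvesI)
  have "continuous_on ((\<lambda>t. t + s) ` {0..}) U"
    by (rule continuous_on_subset[OF solves_continuous[OF U]]) (use s in auto)
  then show "continuous_on {0..} (\<lambda>t. U (t + s))"
    by (rule continuous_on_compose2) (intro continuous_on_add continuous_on_id continuous_on_const order_refl)+
  fix \<tau> t :: real assume t: "t \<in> {0..\<tau>}"
  have "((\<lambda>t. evol_lhs B (U t)) has_vector_derivative evol_rhs B (U (t + s))) (at (t + s) within {0..\<tau> + s})"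
    by (rule solves_derivative[OF U]) (use t s in auto)
  then have "((\<lambda>t. evol_lhs B (U t)) has_vector_derivative evol_rhs B (U (t + s))) (at (t + s) within (\<lambda>t. t + s) ` {0..\<tau>})"
    by (rule has_vector_derivative_within_subset) (use s in auto)
  moreover have "((\<lambda>t. t + s) has_vector_derivative 1) (at t within {0..\<tau>})"
    by (auto intro!: derivative_eq_intros)
  ultimately have "((\<lambda>t. evol_lhs B (U t)) \<circ> (\<lambda>t. t + s) has_vector_derivative 1 *\<^sub>R evol_rhs B (U (t + s))) (at t within {0..\<tau>})"
    by (intro vector_diff_chain_within)
  then show "((\<lambda>t. evol_lhs B (U (t + s))) has_vector_derivative evol_rhs B (U (t + s))) (at t within {0..\<tau>})"
    by (simp add: o_def)
qed

section \<open>Coercivity of the lower energy and uniqueness\<close>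

lemma energy_shift_nonneg:
  assumes "e \<ge> 0"
  shows "0 \<le> energy (\<lambda>x. x) (\<lambda>x. R x + e *\<^sub>R x) U"
proof -
  have "0 \<le> inner (R x + e *\<^sub>R x) x" for x
    using assms R_nonneg[of x] by (simp add: inner_add_left)
  then show ?thesis using \<beta>_pos unfolding energy_def case_prod_unfold
    by (intro add_nonneg_nonneg mult_nonneg_nonneg) auto
qed

text \<open>The terms in \<open>r\<close> and \<open>u\<close> control norms directly, those in
  \<open>q\<close> and \<theta> control \<open>R q\<close> and \<open>R \<theta>\<close> through
  \<open>coercive\<close>. The shift only adds nonnegative amounts, so the constants are free of
  \<open>e\<close>.\<close>

lemma energy_shift_bounds:
  fixes u v w \<theta> :: 'a
  assumes "e \<ge> 0"
  defines "s \<equiv> sqrt (energy (\<lambda>x. x) (\<lambda>x. R x + e *\<^sub>R x) (u, v, w, \<theta>))"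
  shows "norm u \<le> s" "norm (v + \<rho> *\<^sub>R u) \<le> s / sqrt \<beta>" "norm (R (w + \<alpha> *\<^sub>R v)) \<le> sqrt k * s"
    "norm (R \<theta>) \<le> sqrt k * s"
proof -
  let ?E = "energy (\<lambda>x. x) (\<lambda>x. R x + e *\<^sub>R x) (u, v, w, \<theta>)"
  let ?r = "v + \<rho> *\<^sub>R u" and ?q = "w + \<alpha> *\<^sub>R v"
  have E: "?E = \<beta> * (norm ?r)\<^sup>2 + (inner (R ?q) ?q + e * (norm ?q)\<^sup>2) + (inner (R \<theta>) \<theta> + e * (norm \<theta>)\<^sup>2) + (norm u)\<^sup>2"
    unfolding energy_def prod.case inner_add_left[of "R _"] power2_norm_eq_inner by simp
  have nn: "0 \<le> \<beta> * (norm ?r)\<^sup>2" "0 \<le> inner (R ?q) ?q" "0 \<le> e * (norm ?q)\<^sup>2" "0 \<le> inner (R \<theta>) \<theta>"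
    "0 \<le> e * (norm \<theta>)\<^sup>2" using assms \<beta>_pos R_nonneg by auto
  have "(norm u)\<^sup>2 \<le> ?E" using E nn by linarith
  then show "norm u \<le> s" unfolding s_def by (rule real_le_rsqrt)
  have "\<beta> * (norm ?r)\<^sup>2 \<le> ?E" using E nn zero_le_power2[of "norm u"] by linarith
  then have "(norm ?r)\<^sup>2 \<le> ?E / \<beta>" using \<beta>_pos by (simp add: field_simps)
  then show "norm ?r \<le> s / sqrt \<beta>" unfolding s_def real_sqrt_divide[symmetric] by (rule real_le_rsqrt)
  have R: "norm (R x) \<le> sqrt k * s" if "inner (R x) x \<le> ?E" for x
  proof -
    have "(norm (R x))\<^sup>2 \<le> k * ?E"
      using coercive[of x] mult_left_mono[OF that less_imp_le[OF k_pos]] by linarith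
    then show ?thesis unfolding s_def real_sqrt_mult[symmetric] by (rule real_le_rsqrt)
  qed
  show "norm (R ?q) \<le> sqrt k * s" by (rule R) (use E nn zero_le_power2[of "norm u"] in linarith)
  show "norm (R \<theta>) \<le> sqrt k * s" by (rule R) (use E nn zero_le_power2[of "norm u"] in linarith)
qed

lemma norm_map4_R_le_energy:
  "\<exists>C\<ge>0. \<forall>e\<ge>0. \<forall>U. norm (map4 R U) \<le> C * sqrt (energy (\<lambda>x. x) (\<lambda>x. R x + e *\<^sub>R x) U)"
proof (intro exI conjI allI impI)
  \<comment> \<open>\<open>?cv\<close> is the constant for \<open>R v\<close>, from
    \<open>v = r - \<rho> *\<^sub>R u\<close>; the summands of \<open>?C\<close> belong to the four
    components in order.\<close>
  let ?cv = "k * (1 / sqrt \<beta> + \<rho>)"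
  let ?C = "k + ?cv + (sqrt k + \<alpha> * ?cv) + sqrt k"
  show "?C \<ge> 0" using k_pos \<alpha>_pos \<beta>_pos \<rho>_pos by simp
  fix e :: real and U :: "'a \<times> 'a \<times> 'a \<times> 'a" assume e: "e \<ge> 0"
  obtain u v w \<theta> where U: "U = (u, v, w, \<theta>)" by (cases U) auto
  define s where "s = sqrt (energy (\<lambda>x. x) (\<lambda>x. R x + e *\<^sub>R x) U)"
  note b = energy_shift_bounds[OF e, where u = u and v = v and w = w and \<theta> = \<theta>, folded U, folded s_def]
  have Ru: "norm (R u) \<le> k * s" using bound[of u] mult_left_mono[OF b(1) less_imp_le[OF k_pos]] by linarith
  have "norm v = norm ((v + \<rho> *\<^sub>R u) - \<rho> *\<^sub>R u)" by simp
  also have "\<dots> \<le> norm (v + \<rho> *\<^sub>R u) + norm (\<rho> *\<^sub>R u)" by (rule norm_triangle_ineq4)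
  also have "\<dots> \<le> s / sqrt \<beta> + \<rho> * s" using b(1,2) \<rho>_pos by (intro add_mono) auto
  finally have "k * norm v \<le> k * (s / sqrt \<beta> + \<rho> * s)" using k_pos by simp
  then have Rv: "norm (R v) \<le> ?cv * s" using bound[of v] by (simp add: algebra_simps)
  have "R w = R (w + \<alpha> *\<^sub>R v) - \<alpha> *\<^sub>R R v" by (simp add: R.add R.scaleR)
  also have "norm \<dots> \<le> norm (R (w + \<alpha> *\<^sub>R v)) + norm (\<alpha> *\<^sub>R R v)" by (rule norm_triangle_ineq4)
  also have "\<dots> \<le> sqrt k * s + \<alpha> * (?cv * s)"
    using b(3) Rv \<alpha>_pos by (intro add_mono) (auto intro: mult_left_mono)
  finally have Rw: "norm (R w) \<le> (sqrt k + \<alpha> * ?cv) * s" by (simp add: algebra_simps)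
  have "norm (map4 R U) \<le> norm (R u) + (norm (R v) + (norm (R w) + norm (R \<theta>)))"
    unfolding U map4_def prod.case
    by (intro order_trans[OF norm_Pair_le] add_left_mono order_refl)
  also have "\<dots> \<le> ?C * s" using Ru Rv Rw b(4) by (simp add: algebra_simps)
  finally show "norm (map4 R U) \<le> ?C * sqrt (energy (\<lambda>x. x) (\<lambda>x. R x + e *\<^sub>R x) U)"
    by (simp add: s_def)
qed

text \<open>The difference has zero initial energy and no forcing, so its lower energy stays zero;
  injectivity of \<open>R\<close> removes the components that the energy sees only through
  \<open>R\<close>.\<close>

lemma solves_unique:
  assumes "solves R U" "solves R V" "U 0 = V 0" "t \<ge> 0"
  shows "U t = V t"
proof -
  let ?W = "\<lambda>t. U t - V t"
  have W: "solves R ?W" by (rule solves_diff[OF blin assms(1,2)])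
  have "energy (\<lambda>x. x) (\<lambda>x. R x) (?W t) \<le> exp (\<omega> * t) * (energy (\<lambda>x. x) (\<lambda>x. R x) (?W 0) + 0 * t)"
    by (rule energy_growth[where f = "\<lambda>_. 0" and g = "\<lambda>_. 0" and \<tau> = t])
      (use W assms(4) sym blin R_nonneg in \<open>auto simp: zero_prod_def[symmetric] intro: solves_continuous_on solves_derivative\<close>)
  moreover have "energy (\<lambda>x. x) (\<lambda>x. R x) (?W 0) = 0" using assms(3) by (simp add: energy_def zero_prod_def)
  ultimately have le: "energy (\<lambda>x. x) (\<lambda>x. R x + 0 *\<^sub>R x) (?W t) \<le> 0" by simp
  obtain u v w \<theta> where eq: "?W t = (u, v, w, \<theta>)" by (cases "?W t") auto
  have E0: "energy (\<lambda>x. x) (\<lambda>x. R x + 0 *\<^sub>R x) (u, v, w, \<theta>) = 0"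
    using le energy_shift_nonneg[of 0 "?W t"] unfolding eq by simp
  note b = energy_shift_bounds[where e = 0 and u = u and v = v and w = w and \<theta> = \<theta>, unfolded E0]
  have "u = 0" "v + \<rho> *\<^sub>R u = 0" "R (w + \<alpha> *\<^sub>R v) = 0" "R \<theta> = 0" using b by simp_all
  then have "(u, v, w, \<theta>) = 0" by (auto simp: R_eq_0_iff zero_prod_def)
  then show ?thesis using eq by simp
qed

text \<open>The shift enters both sides as \<open>e n\<close> times the bounded maps
  \<open>M1\<close> and \<open>M2\<close>, hence disappears in the limit. With \<open>e\<close>
  constantly zero this says that solutions for \<open>R\<close> are closed under locally uniform
  limits.\<close>

lemma solves_uniform_limit:
  assumes U: "\<And>n. solves (\<lambda>x. R x + e n *\<^sub>R x) (U n)" and e: "e \<longlonglongrightarrow> 0"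
    and unif: "\<And>\<tau>. uniform_limit {0..\<tau>} U V sequentially"
  shows "solves R V"
proof -
  interpret l: bounded_linear "evol_lhs R" by (rule bounded_linear_evol_lhs[OF blin])
  interpret r: bounded_linear "evol_rhs R" by (rule bounded_linear_evol_rhs[OF blin])
  define M1 :: "'a \<times> 'a \<times> 'a \<times> 'a \<Rightarrow> 'a \<times> 'a \<times> 'a \<times> 'a" where "M1 U = (0, 0, fst (snd (snd U)), snd (snd (snd U)))" for U
  define M2 :: "'a \<times> 'a \<times> 'a \<times> 'a \<Rightarrow> 'a \<times> 'a \<times> 'a \<times> 'a" where "M2 U = (0, 0, - (\<alpha> *\<^sub>R fst (snd (snd U))), 0)" for U
  have bM: "bounded_linear M1" "bounded_linear M2"
    unfolding M1_def M2_def by (intro blin4 bounded_linear_zero)+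
  have lhs: "evol_lhs (\<lambda>x. R x + c *\<^sub>R x) W = evol_lhs R W + c *\<^sub>R M1 W" for c W
    by (cases W) (simp add: evol_lhs_def M1_def)
  have rhs: "evol_rhs (\<lambda>x. R x + c *\<^sub>R x) W = evol_rhs R W + c *\<^sub>R M2 W" for c W
    by (cases W) (simp add: evol_rhs_def M2_def scaleR_add_right)
  have contV: "continuous_on {0..\<tau>} V" for \<tau>
    by (rule uniform_limit_theorem[OF _ unif]) (simp_all add: solves_continuous_on[OF U])
  have "continuous_on {0..} V"
    unfolding continuous_on_eq_continuous_within
  proof
    fix t :: real assume "t \<in> {0..}"
    then have t: "continuous (at t within {0..t + 1}) V"
      using contV[of "t + 1"] by (auto simp: continuous_on_eq_continuous_within)
    have "at t within {0..t + 1} = at t within {0..}"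
      by (rule at_within_nhd[of _ "{..<t + 1}"]) auto
    with t show "continuous (at t within {0..}) V" by simp
  qed
  moreover have "((\<lambda>t. evol_lhs R (V t)) has_vector_derivative evol_rhs R (V t)) (at t within {0..\<tau>})"
    if t: "t \<in> {0..\<tau>}" for t \<tau>
  proof (rule has_vector_derivative_uniform_limit[where
        F = "\<lambda>n t. evol_lhs (\<lambda>x. R x + e n *\<^sub>R x) (U n t)" and f = "\<lambda>n t. evol_rhs (\<lambda>x. R x + e n *\<^sub>R x) (U n t)"])
    show "((\<lambda>t. evol_lhs (\<lambda>x. R x + e n *\<^sub>R x) (U n t)) has_vector_derivative
        evol_rhs (\<lambda>x. R x + e n *\<^sub>R x) (U n t)) (at t within {0..\<tau>})" if "t \<in> {0..\<tau>}" for n t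
      by (rule solves_derivative[OF U that])
    show "(\<lambda>n. evol_lhs (\<lambda>x. R x + e n *\<^sub>R x) (U n t)) \<longlonglongrightarrow> evol_lhs R (V t)" if "t \<in> {0..\<tau>}" for t
    proof -
      have "(\<lambda>n. U n t) \<longlonglongrightarrow> V t" by (rule tendsto_uniform_limitI[OF unif that])
      then have "(\<lambda>n. evol_lhs R (U n t) + e n *\<^sub>R M1 (U n t)) \<longlonglongrightarrow> evol_lhs R (V t) + 0 *\<^sub>R M1 (V t)"
        by (intro tendsto_add tendsto_scaleR e l.tendsto bounded_linear.tendsto[OF bM(1)])
      then show ?thesis by (simp add: lhs)
    qed
    have bdd: "bounded ((\<lambda>t. M2 (V t)) ` {0..\<tau>})"
      by (intro compact_imp_bounded compact_continuous_image bounded_linear.continuous_on[OF bM(2)] contV) simp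
    have "uniform_limit {0..\<tau>} (\<lambda>n t. evol_rhs R (U n t) + e n *\<^sub>R M2 (U n t))
        (\<lambda>t. evol_rhs R (V t) + 0 *\<^sub>R M2 (V t)) sequentially"
    proof (intro uniform_limit_add)
      show "uniform_limit {0..\<tau>} (\<lambda>n t. evol_rhs R (U n t)) (\<lambda>t. evol_rhs R (V t)) sequentially"
        by (rule r.uniform_limit[OF unif])
      show "uniform_limit {0..\<tau>} (\<lambda>n t. e n *\<^sub>R M2 (U n t)) (\<lambda>t. 0 *\<^sub>R M2 (V t)) sequentially"
        by (rule bounded_bilinear.bounded_uniform_limit[OF bounded_bilinear_scaleR _ bounded_linear.uniform_limit[OF bM(2) unif] bdd])
          (use e in \<open>auto simp: uniform_limit_iff tendsto_iff image_constant_conv\<close>)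
    qed
    then show "uniform_limit {0..\<tau>} (\<lambda>n t. evol_rhs (\<lambda>x. R x + e n *\<^sub>R x) (U n t)) (\<lambda>t. evol_rhs R (V t)) sequentially"
      by (simp add: rhs)
    show "continuous_on {0..\<tau>} (\<lambda>t. evol_rhs R (V t))" by (rule r.continuous_on[OF contV])
  qed fact
  ultimately show ?thesis by (rule solvesI)
qed

section \<open>Approximate solutions\<close>

lemma wsrc_map4:
  assumes "bounded_linear F"
  shows "wsrc (map4 F U) = F (wsrc U)"
proof -
  interpret F: bounded_linear F by fact
  show ?thesis by (cases U) (simp add: wsrc_def map4_def F.diff F.scaleR)
qed

lemma \<theta>src_map4:
  assumes "bounded_linear F"
  shows "\<theta>src (map4 F U) = F (\<theta>src U)"
proof -
  interpret F: bounded_linear F by fact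
  show ?thesis by (cases U) (simp add: \<theta>src_def map4_def F.add F.scaleR)
qed

text \<open>The generator of the system with \<open>T\<close>, the inverse of the shifted
  \<open>R\<close>, in place of \<open>A\<close>. It is bounded and can be exponentiated.\<close>

definition approx_gen :: "('a \<Rightarrow> 'a) \<Rightarrow> 'a \<times> 'a \<times> 'a \<times> 'a \<Rightarrow> 'a \<times> 'a \<times> 'a \<times> 'a" where
  "approx_gen T U = (fst (snd U), fst (snd (snd U)), T (wsrc U) - \<alpha> *\<^sub>R fst (snd (snd U)), - T (\<theta>src U))"

lemma bounded_linear_approx_gen:
  assumes "bounded_linear T"
  shows "bounded_linear (approx_gen T)"
  unfolding approx_gen_def
  by (intro blin4 bounded_linear_compose[OF assms] bounded_linear_wsrc bounded_linear_\<theta>src)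

lemma approx_gen_map4:
  assumes F: "bounded_linear F" and comm: "\<And>x. T (F x) = F (T x)"
  shows "approx_gen T (map4 F U) = map4 F (approx_gen T U)"
proof -
  interpret F: bounded_linear F by fact
  show ?thesis unfolding approx_gen_def wsrc_map4[OF F] \<theta>src_map4[OF F] comm
    by (cases U) (simp add: map4_def F.diff F.scaleR F.neg)
qed

text \<open>The shift \<open>d\<close> may differ from the shift \<open>e\<close> inverted by
  \<open>T\<close>. Equal shifts turn the approximate equation into the form required by
  \<open>solves\<close>; for different shifts the mismatch is the forcing that appears when two
  approximations are compared.\<close>

lemma evol_lhs_approx_gen:
  assumes T: "\<And>x. R (T x) + e *\<^sub>R T x = x"
  shows "evol_lhs (\<lambda>x. R x + d *\<^sub>R x) (approx_gen T U)
    = evol_rhs (\<lambda>x. R x + d *\<^sub>R x) U + (0, 0, (d - e) *\<^sub>R T (wsrc U), - (d - e) *\<^sub>R T (\<theta>src U))"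
proof -
  obtain u v w \<theta> where U: "U = (u, v, w, \<theta>)" by (cases U) auto
  have T': "R (T x) = x - e *\<^sub>R T x" for x using T[of x] by (simp add: algebra_simps)
  show ?thesis
    unfolding U evol_lhs_def evol_rhs_def approx_gen_def
    by (simp add: R.diff R.scaleR R.neg T' algebra_simps) (simp add: wsrc_def \<theta>src_def algebra_simps)
qed

lemma approx_solution:
  assumes T: "bounded_linear T" "\<And>x. R (T x) + e *\<^sub>R T x = x" "\<And>x. T (R x) = R (T x)"
  obtains Z where "Z 0 = Z0"
    "\<And>\<tau> t. t \<in> {0..\<tau>} \<Longrightarrow> (Z has_vector_derivative approx_gen T (Z t)) (at t within {0..\<tau>})"
    "solves (\<lambda>x. R x + e *\<^sub>R x) Z"
proof -
  obtain Z where Z0: "Z 0 = Z0"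
    and Z: "\<And>\<tau> t. t \<in> {0..\<tau>} \<Longrightarrow> (Z has_vector_derivative approx_gen T (Z t)) (at t within {0..\<tau>})"
    using bounded_linear_ode_solution[OF bounded_linear_approx_gen[OF T(1)], of Z0] by blast
  have "solves (\<lambda>x. R x + e *\<^sub>R x) Z"
  proof (rule solvesI)
    show "continuous_on {0..} Z"
      unfolding continuous_on_eq_continuous_within
    proof
      fix t :: real assume "t \<in> {0..}"
      then have "(Z has_vector_derivative approx_gen T (Z t)) (at t within {0..t + 1})"
        by (intro Z) auto
      then have t: "continuous (at t within {0..t + 1}) Z" by (rule has_vector_derivative_continuous)
      have "at t within {0..t + 1} = at t within {0..}"
        by (rule at_within_nhd[of _ "{..<t + 1}"]) auto
      with t show "continuous (at t within {0..}) Z" by simp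
    qed
    fix \<tau> t :: real assume t: "t \<in> {0..\<tau>}"
    show "((\<lambda>t. evol_lhs (\<lambda>x. R x + e *\<^sub>R x) (Z t)) has_vector_derivative
        evol_rhs (\<lambda>x. R x + e *\<^sub>R x) (Z t)) (at t within {0..\<tau>})"
      using bounded_linear.has_vector_derivative[OF bounded_linear_evol_lhs[OF bounded_linear_shift[of e]] Z[OF t]]
      unfolding evol_lhs_approx_gen[OF T(2)] by (simp add: zero_prod_def[symmetric])
  qed
  then show ?thesis using that Z0 Z by blast
qed

text \<open>Each application of \<open>R\<close> gains regularity uniformly in the approximation parameter:
  \<open>Z\<close> has bounded energy, \<open>R Z\<close> is bounded, \<open>R\<^sup>2 Z\<close> has bounded derivative and is Cauchy in the
  energy, and \<open>R\<^sup>3 Z\<close> is uniformly Cauchy.\<close>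

lemma approx_uniformly_Cauchy:
  fixes e :: "nat \<Rightarrow> real"
  assumes e: "\<And>n. e n = 1 / real (Suc n)"
    and T: "\<And>n. bounded_linear (T n)" "\<And>n x. R (T n x) + e n *\<^sub>R T n x = x" "\<And>n x. T n (R x) = R (T n x)"
      "\<And>n x. norm (R (T n x)) \<le> norm x"
    and Z: "\<And>n. Z n 0 = Z0"
      "\<And>n \<tau> t. t \<in> {0..\<tau>} \<Longrightarrow> (Z n has_vector_derivative approx_gen (T n) (Z n t)) (at t within {0..\<tau>})"
      "\<And>n. solves (\<lambda>x. R x + e n *\<^sub>R x) (Z n)"
  shows "uniformly_Cauchy_on {0..\<tau>} (\<lambda>n t. map4 R (map4 R (map4 R (Z n t))))"
proof -
  let ?B = "\<lambda>n x. R x + e n *\<^sub>R x" and ?I = "\<lambda>x::'a. x"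
  interpret R4: bounded_linear "map4 R" by (rule bounded_linear_map4[OF blin])
  have e01: "0 < e n" "e n \<le> 1" for n by (auto simp: e)
  have symB: "inner (?B n x) y = inner x (?B n y)" for n x y
    by (simp add: inner_add_left inner_add_right sym)
  have posB: "0 \<le> inner (?B n x) x" for n x
    using R_nonneg[of x] e01[of n] by (simp add: inner_add_left)
  note growth = energy_growth[of ?I, OF bounded_linear_ident refl inner_ge_zero bounded_linear_shift symB refl posB]
  obtain C where C: "C \<ge> 0" "\<And>n U. norm (map4 R U) \<le> C * sqrt (energy ?I (?B n) U)"
    using norm_map4_R_le_energy e01 by (metis less_imp_le)
  obtain C4 where C4: "C4 \<ge> 0" "\<And>U. norm (map4 R U) \<le> norm U * C4" using R4.nonneg_bounded by blast
  obtain Cw where Cw: "Cw \<ge> 0" "\<And>U. norm (wsrc U) \<le> norm U * Cw"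
    using bounded_linear.nonneg_bounded[OF bounded_linear_wsrc] by blast
  obtain C\<theta> where C\<theta>: "C\<theta> \<ge> 0" "\<And>U. norm (\<theta>src U) \<le> norm U * C\<theta>"
    using bounded_linear.nonneg_bounded[OF bounded_linear_\<theta>src] by blast
  show ?thesis
  proof (cases "\<tau> \<ge> 0")
    case False
    then show ?thesis by (auto simp: uniformly_Cauchy_on_def)
  next
    case \<tau>: True
    \<comment> \<open>As \<open>e n \<le> 1\<close>, all initial energies are dominated by the one
      with shift \<open>1\<close>, which makes \<open>M\<close> independent of
      \<open>n\<close>.\<close>
    define M where "M = exp (\<omega> * \<tau>) * energy ?I (\<lambda>x. R x + 1 *\<^sub>R x) Z0"
    have EZ: "energy ?I (?B n) (Z n t) \<le> M" if t: "t \<in> {0..\<tau>}" for n t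
    proof -
      have "energy ?I (?B n) (Z n t) \<le> exp (\<omega> * t) * (energy ?I (?B n) (Z n 0) + 0 * t)"
        by (rule growth[where f = "\<lambda>_. 0" and g = "\<lambda>_. 0" and \<tau> = \<tau>])
          (use t Z(3) in \<open>auto simp: zero_prod_def[symmetric] intro: solves_continuous_on solves_derivative\<close>)
      also have "\<dots> = exp (\<omega> * t) * energy ?I (?B n) Z0" by (simp add: Z)
      also have "\<dots> \<le> exp (\<omega> * \<tau>) * energy ?I (\<lambda>x. R x + 1 *\<^sub>R x) Z0"
      proof (intro mult_mono)
        show "exp (\<omega> * t) \<le> exp (\<omega> * \<tau>)" using t \<omega>_nonneg by (simp add: mult_left_mono)
        have le: "inner (?B n x) x \<le> inner (R x + 1 *\<^sub>R x) x" for x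
          using mult_right_mono[OF e01(2) inner_ge_zero[of x], of n] by (simp add: inner_add_left)
        show "energy ?I (?B n) Z0 \<le> energy ?I (\<lambda>x. R x + 1 *\<^sub>R x) Z0"
          unfolding energy_def case_prod_unfold by (intro add_mono order_refl le)
        show "0 \<le> energy ?I (?B n) Z0" by (rule energy_shift_nonneg) (use e01[of n] in simp)
      qed simp
      finally show ?thesis by (simp add: M_def)
    qed
    have M0: "M \<ge> 0" unfolding M_def by (intro mult_nonneg_nonneg energy_shift_nonneg) auto
    define b where "b = C * sqrt M"
    have b0: "b \<ge> 0" using C(1) M0 by (simp add: b_def)
    define X where "X n t = map4 R (map4 R (Z n t))" for n t
    have Yb: "norm (map4 R (Z n t)) \<le> b" if "t \<in> {0..\<tau>}" for n t
      using C(2)[of "Z n t" n] EZ[OF that, of n] C(1) unfolding b_def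
      by (meson mult_left_mono order_trans real_sqrt_le_mono)
    have Xb: "norm (X n t) \<le> b * C4" if "t \<in> {0..\<tau>}" for n t
      using C4(2)[of "map4 R (Z n t)"] mult_right_mono[OF Yb[OF that, of n] C4(1)] unfolding X_def by linarith
    have derX: "(X n has_vector_derivative approx_gen (T n) (X n t)) (at t within {0..\<tau>})"
      if "t \<in> {0..\<tau>}" for n t
      unfolding X_def approx_gen_map4[where T = "T n" and F = R, OF blin T(3)]
      by (intro R4.has_vector_derivative Z(2) that)
    \<comment> \<open>One factor \<open>R\<close> is taken out of \<open>X\<close> and placed next
      to \<open>T n\<close>, where \<open>R (T n x)\<close> is bounded by \<open>x\<close>; this
      compensates the possibly large norm of \<open>T n\<close>.\<close>
    have Twb: "norm (T n (wsrc (X n t))) \<le> b * Cw" if "t \<in> {0..\<tau>}" for n t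
    proof -
      have "norm (T n (wsrc (X n t))) \<le> norm (wsrc (map4 R (Z n t)))"
        unfolding X_def wsrc_map4[OF blin, of "map4 R _"] T(3) by (rule T(4))
      then show ?thesis
        using Cw(2)[of "map4 R (Z n t)"] mult_right_mono[OF Yb[OF that, of n] Cw(1)] by linarith
    qed
    have T\<theta>b: "norm (T n (\<theta>src (X n t))) \<le> b * C\<theta>" if "t \<in> {0..\<tau>}" for n t
    proof -
      have "norm (T n (\<theta>src (X n t))) \<le> norm (\<theta>src (map4 R (Z n t)))"
        unfolding X_def \<theta>src_map4[OF blin, of "map4 R _"] T(3) by (rule T(4))
      then show ?thesis
        using C\<theta>(2)[of "map4 R (Z n t)"] mult_right_mono[OF Yb[OF that, of n] C\<theta>(1)] by linarith
    qed
    define dX where "dX = 2 * (b * C4)"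
    have dX0: "dX \<ge> 0" using b0 C4(1) by (simp add: dX_def)
    define Kc where "Kc = 2 * (b * Cw * (dX + \<alpha> * dX)) + 2 * (b * C\<theta> * dX)"
    have Kc0: "Kc \<ge> 0" using b0 Cw(1) C\<theta>(1) dX0 \<alpha>_pos by (simp add: Kc_def)
    define M2 where "M2 = exp (\<omega> * \<tau>) * (Kc * \<tau>)"
    have M20: "M2 \<ge> 0" using Kc0 \<tau> by (simp add: M2_def)
    \<comment> \<open>\<open>X n - X m\<close> starts at zero and solves the \<open>n\<close>-th
      equation with a forcing proportional to \<open>e m - e n\<close>, so its energy is at most of
      that order.\<close>
    have EX: "energy ?I (?B n) (X n t - X m t) \<le> M2 * \<bar>e m - e n\<bar>" if t: "t \<in> {0..\<tau>}" for n m t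
    proof -
      let ?d = "\<bar>e m - e n\<bar>"
      let ?f = "\<lambda>t. (e m - e n) *\<^sub>R T m (wsrc (X m t))" and ?g = "\<lambda>t. - (e m - e n) *\<^sub>R T m (\<theta>src (X m t))"
      interpret l: bounded_linear "evol_lhs (?B n)" by (rule bounded_linear_evol_lhs[OF bounded_linear_shift])
      interpret r: bounded_linear "evol_rhs (?B n)" by (rule bounded_linear_evol_rhs[OF bounded_linear_shift])
      have "energy ?I (?B n) (X n t - X m t)
          \<le> exp (\<omega> * t) * (energy ?I (?B n) (X n 0 - X m 0) + (Kc * ?d) * t)"
      proof (rule growth[where f = ?f and g = ?g and \<tau> = \<tau> and U = "\<lambda>t. X n t - X m t"])
        show "continuous_on {0..\<tau>} (\<lambda>t. X n t - X m t)"
          unfolding X_def by (intro continuous_on_diff R4.continuous_on solves_continuous_on[OF Z(3)])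
        fix s assume s: "s \<in> {0..\<tau>}"
        have "((\<lambda>t. evol_lhs (?B n) (X n t - X m t)) has_vector_derivative
            evol_lhs (?B n) (approx_gen (T n) (X n s)) - evol_lhs (?B n) (approx_gen (T m) (X m s))) (at s within {0..\<tau>})"
          unfolding l.diff
          by (intro has_vector_derivative_diff l.has_vector_derivative derX s)
        also have "evol_lhs (?B n) (approx_gen (T n) (X n s)) - evol_lhs (?B n) (approx_gen (T m) (X m s))
            = evol_rhs (?B n) (X n s - X m s) + (0, 0, ?f s, ?g s)"
          unfolding evol_lhs_approx_gen[OF T(2)] r.diff
          by (simp add: algebra_simps zero_prod_def[symmetric])
        finally show "((\<lambda>t. evol_lhs (?B n) (X n t - X m t)) has_vector_derivative
            evol_rhs (?B n) (X n s - X m s) + (0, 0, ?f s, ?g s)) (at s within {0..\<tau>})" .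
        fix u v w \<theta> assume eq: "X n s - X m s = (u, v, w, \<theta>)"
        have "norm (X n s - X m s) \<le> dX"
          using norm_triangle_ineq4[of "X n s" "X m s"] Xb[OF s, of n] Xb[OF s, of m] by (simp add: dX_def)
        then have n: "norm (u, v, w, \<theta>) \<le> dX" by (simp add: eq)
        have nv: "norm v \<le> dX" "norm w \<le> dX" "norm \<theta> \<le> dX"
          using n norm_snd_le[of "(v, w, \<theta>)" u] norm_fst_le[of v "(w, \<theta>)"] norm_snd_le[of "(w, \<theta>)" v]
            norm_fst_le[of w \<theta>] norm_snd_le[of \<theta> w] by auto
        have "norm (w + \<alpha> *\<^sub>R v) \<le> dX + \<alpha> * dX"
          using nv \<alpha>_pos by (intro order_trans[OF norm_triangle_ineq] add_mono) auto
        then have 1: "inner (?f s) (w + \<alpha> *\<^sub>R v) \<le> (?d * (b * Cw)) * (dX + \<alpha> * dX)"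
          using Twb[OF s, of m] b0 Cw(1)
          by (intro order_trans[OF norm_cauchy_schwarz] mult_mono) (auto intro: mult_left_mono)
        have 2: "inner (?g s) \<theta> \<le> (?d * (b * C\<theta>)) * dX"
          using T\<theta>b[OF s, of m] nv(3) b0 C\<theta>(1)
          by (intro order_trans[OF norm_cauchy_schwarz] mult_mono) (auto simp: abs_minus_commute[of "e n"] intro: mult_left_mono)
        show "2 * inner (?f s) (w + \<alpha> *\<^sub>R v) + 2 * inner (?g s) \<theta> \<le> Kc * ?d"
          using 1 2 by (simp add: Kc_def algebra_simps)
      qed (use Kc0 t in auto)
      also have "energy ?I (?B n) (X n 0 - X m 0) = 0"
        by (simp add: X_def Z energy_def zero_prod_def)
      also have "exp (\<omega> * t) * (0 + Kc * ?d * t) \<le> exp (\<omega> * \<tau>) * (Kc * ?d * \<tau>)"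
        using t Kc0 \<omega>_nonneg by (intro mult_mono) (auto intro!: mult_left_mono)
      finally show ?thesis by (simp add: M2_def mult_ac)
    qed
    show ?thesis
    proof (rule uniformly_Cauchy_onI)
      fix \<epsilon> :: real assume \<epsilon>: "\<epsilon> > 0"
      define c where "c = C\<^sup>2 * M2 + 1"
      have c: "c > 0" using M20 by (simp add: c_def add_nonneg_pos)
      obtain N where N: "1 / real (Suc N) < \<epsilon>\<^sup>2 / c"
        using nat_approx_posE[of "\<epsilon>\<^sup>2 / c"] \<epsilon> c by auto
      show "\<exists>N. \<forall>t\<in>{0..\<tau>}. \<forall>n\<ge>N. \<forall>m\<ge>N.
          dist (map4 R (map4 R (map4 R (Z n t)))) (map4 R (map4 R (map4 R (Z m t)))) < \<epsilon>"
      proof (intro exI ballI allI impI)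
        fix t n m assume t: "t \<in> {0..\<tau>}" and nm: "n \<ge> N" "m \<ge> N"
        have "e n \<le> 1 / real (Suc N)" "e m \<le> 1 / real (Suc N)"
          using nm by (auto simp: e intro!: divide_left_mono)
        then have d: "\<bar>e m - e n\<bar> \<le> 1 / real (Suc N)" using e01(1)[of n] e01(1)[of m] by linarith
        have E0: "0 \<le> energy ?I (?B n) (X n t - X m t)" by (rule energy_shift_nonneg) (use e01[of n] in simp)
        have "norm (map4 R (X n t - X m t)) \<le> C * sqrt (energy ?I (?B n) (X n t - X m t))" by (rule C(2))
        then have "(norm (map4 R (X n t - X m t)))\<^sup>2 \<le> (C * sqrt (energy ?I (?B n) (X n t - X m t)))\<^sup>2"
          by (intro power_mono) auto
        also have "\<dots> = C\<^sup>2 * energy ?I (?B n) (X n t - X m t)" using E0 by (simp add: power_mult_distrib)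
        also have "\<dots> \<le> C\<^sup>2 * (M2 * \<bar>e m - e n\<bar>)" by (intro mult_left_mono EX t) auto
        also have "\<dots> \<le> c * \<bar>e m - e n\<bar>" by (simp add: c_def algebra_simps)
        also have "\<dots> \<le> c * (1 / real (Suc N))" using c d by (intro mult_left_mono) auto
        also have "\<dots> < c * (\<epsilon>\<^sup>2 / c)" using c N by (intro mult_strict_left_mono)
        also have "\<dots> = \<epsilon>\<^sup>2" using c by simp
        finally have "norm (map4 R (X n t - X m t)) < \<epsilon>" using \<epsilon> by (simp add: power_less_imp_less_base)
        then show "dist (map4 R (map4 R (map4 R (Z n t)))) (map4 R (map4 R (map4 R (Z m t)))) < \<epsilon>"
          by (simp add: dist_norm X_def R4.diff)
      qed
    qed
  qed
qed

text \<open>Three factors \<open>R\<close> are the regularity at which the approximations are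
  uniformly Cauchy; the shifts tend to zero, so the limit solves the unshifted equation.\<close>

lemma regular_solution_exists:
  "\<exists>W. solves R W \<and> W 0 = map4 R (map4 R (map4 R Z0))"
proof -
  interpret R4: bounded_linear "map4 R" by (rule bounded_linear_map4[OF blin])
  define e where "e n = 1 / real (Suc n)" for n
  have "e n > 0" for n by (simp add: e_def)
  have "\<exists>T. bounded_linear T \<and> (\<forall>x. R (T x) + e n *\<^sub>R T x = x) \<and> (\<forall>x. T (R x) = R (T x))
      \<and> (\<forall>x. norm (R (T x)) \<le> norm x)" for n
    using R_shift_inverse[OF \<open>e n > 0\<close>] by metis
  then obtain T where T: "\<And>n. bounded_linear (T n)" "\<And>n x. R (T n x) + e n *\<^sub>R T n x = x"
    "\<And>n x. T n (R x) = R (T n x)" "\<And>n x. norm (R (T n x)) \<le> norm x" by metis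
  have "\<exists>Z. Z 0 = Z0 \<and>
      (\<forall>\<tau> t. t \<in> {0..\<tau>} \<longrightarrow> (Z has_vector_derivative approx_gen (T n) (Z t)) (at t within {0..\<tau>})) \<and>
      solves (\<lambda>x. R x + e n *\<^sub>R x) Z" for n
    by (rule approx_solution[OF T(1-3)[of n], of Z0]) blast
  then obtain Z where Z: "\<And>n. Z n 0 = Z0"
      "\<And>n \<tau> t. t \<in> {0..\<tau>} \<Longrightarrow> (Z n has_vector_derivative approx_gen (T n) (Z n t)) (at t within {0..\<tau>})"
      "\<And>n. solves (\<lambda>x. R x + e n *\<^sub>R x) (Z n)" by metis
  let ?W = "\<lambda>n t. map4 R (map4 R (map4 R (Z n t)))"
  define W where "W t = lim (\<lambda>n. ?W n t)" for t
  have unif: "uniform_limit {0..\<tau>} ?W W sequentially" for \<tau>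
    using Cauchy_uniformly_convergent[OF approx_uniformly_Cauchy[OF e_def T Z, of \<tau>]]
    unfolding uniformly_convergent_uniform_limit_iff W_def .
  have "R (R x + c *\<^sub>R x) = R (R x) + c *\<^sub>R R x" for c x by (simp add: R.add R.scaleR)
  then have "solves (\<lambda>x. R x + e n *\<^sub>R x) (?W n)" for n
    by (intro solves_map4 blin Z)
  moreover have "e \<longlonglongrightarrow> 0" unfolding e_def by (rule LIMSEQ_Suc[OF lim_1_over_n])
  ultimately have "solves R W" using unif by (rule solves_uniform_limit)
  moreover have "(\<lambda>n. ?W n 0) \<longlonglongrightarrow> W 0" by (rule tendsto_uniform_limitI[OF unif[of 0]]) simp
  then have "W 0 = map4 R (map4 R (map4 R Z0))" by (simp add: Z LIMSEQ_const_iff)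
  ultimately show ?thesis by blast
qed

end

section \<open>From weak identities to derivatives in norm\<close>

lemma norm_le_of_dense_tests:
  fixes z :: "'a::real_inner"
  assumes S: "closure S = UNIV" and M: "0 \<le> M" and le: "\<And>\<psi>. \<psi> \<in> S \<Longrightarrow> \<bar>inner z \<psi>\<bar> \<le> M * norm \<psi>"
  shows "norm z \<le> M"
proof -
  obtain x where x: "\<And>n. x n \<in> S" "x \<longlonglongrightarrow> z"
    using S closure_sequential[of z S] by auto
  have "\<bar>inner z z\<bar> \<le> M * norm z"
  proof (rule LIMSEQ_le)
    show "(\<lambda>n. \<bar>inner z (x n)\<bar>) \<longlonglongrightarrow> \<bar>inner z z\<bar>" by (intro tendsto_intros x)
    show "(\<lambda>n. M * norm (x n)) \<longlonglongrightarrow> M * norm z" by (intro tendsto_intros x)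
  qed (use le x in blast)
  then have m: "norm z * norm z \<le> M * norm z" by (simp add: dot_square_norm power2_eq_square)
  show ?thesis
  proof (cases "z = 0")
    case False
    then show ?thesis using mult_right_le_imp_le[OF m] by simp
  qed (use M in simp)
qed

text \<open>Each test \<psi> gives a scalar mean value estimate whose modulus \<open>d\<close> stems
  from the continuity of \<open>f\<close> and is the same for all \<psi>. Density of the tests then
  yields the estimate in norm.\<close>

lemma weak_has_vector_derivative:
  fixes F f :: "real \<Rightarrow> 'a::real_inner"
  assumes S: "closure S = UNIV" and cont: "continuous_on {0..\<tau>} f"
    and weak: "\<And>\<psi> t. \<psi> \<in> S \<Longrightarrow> t \<in> {0..\<tau>} \<Longrightarrow>
      inner (F t) \<psi> = c \<psi> + integral {0..t} (\<lambda>s. inner (f s) \<psi>)"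
    and s: "s \<in> {0..\<tau>}"
  shows "(F has_vector_derivative f s) (at s within {0..\<tau>})"
  unfolding has_vector_derivative_def has_derivative_within_alt
proof (intro conjI allI impI)
  show "bounded_linear (\<lambda>x. x *\<^sub>R f s)" by (rule bounded_linear_scaleR_left)
  fix e :: real assume e: "e > 0"
  obtain d where d: "d > 0" "\<And>t. t \<in> {0..\<tau>} \<Longrightarrow> dist t s < d \<Longrightarrow> dist (f t) (f s) < e"
    using cont s e unfolding continuous_on_iff by metis
  have der: "((\<lambda>t. inner (F t) \<psi>) has_vector_derivative inner (f t) \<psi>) (at t within {0..\<tau>})"
    if "\<psi> \<in> S" "t \<in> {0..\<tau>}" for \<psi> t
  proof -
    have "((\<lambda>t. c \<psi> + integral {0..t} (\<lambda>s. inner (f s) \<psi>)) has_vector_derivative 0 + inner (f t) \<psi>) (at t within {0..\<tau>})"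
      using that cont
      by (intro has_vector_derivative_add has_vector_derivative_const integral_has_vector_derivative continuous_intros)
    then show ?thesis
      unfolding add_0 by (rule has_vector_derivative_transform[rotated 2]) (use weak that in auto)
  qed
  have "norm (F t - F s - (t - s) *\<^sub>R f s) \<le> e * norm (t - s)"
    if t: "t \<in> {0..\<tau>}" "norm (t - s) < d" for t
  proof (rule norm_le_of_dense_tests[OF S])
    show "0 \<le> e * norm (t - s)" using e by simp
  next
    fix \<psi> assume \<psi>: "\<psi> \<in> S"
    let ?S = "{min s t..max s t}"
    have sub: "?S \<subseteq> {0..\<tau>}" using s t by auto
    let ?h = "\<lambda>x. inner (F x) \<psi> - x * inner (f s) \<psi>"
    have "norm (?h t - ?h s) \<le> (e * norm \<psi>) * norm (t - s)"
    proof (rule differentiable_bound[where S = ?S and f' = "\<lambda>x h. h *\<^sub>R (inner (f x) \<psi> - inner (f s) \<psi>)"])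
      fix x assume x: "x \<in> ?S"
      have "((\<lambda>t. inner (F t) \<psi>) has_vector_derivative inner (f x) \<psi>) (at x within ?S)"
        using der[OF \<psi>, of x] x sub has_vector_derivative_within_subset by blast
      then have "(?h has_vector_derivative inner (f x) \<psi> - inner (f s) \<psi>) (at x within ?S)"
        by (auto intro!: derivative_eq_intros simp: has_real_derivative_iff_has_vector_derivative[symmetric])
      then show "(?h has_derivative (\<lambda>h. h *\<^sub>R (inner (f x) \<psi> - inner (f s) \<psi>))) (at x within ?S)"
        by (simp add: has_vector_derivative_def)
      have "dist x s < d" using x t(2) by (auto simp: dist_real_def)
      then have "norm (f x - f s) \<le> e" using d(2)[of x] x sub by (force simp: dist_norm)
      then have "\<bar>inner (f x) \<psi> - inner (f s) \<psi>\<bar> \<le> e * norm \<psi>"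
        using Cauchy_Schwarz_ineq2[of "f x - f s" \<psi>] mult_right_mono[of "norm (f x - f s)" e "norm \<psi>"]
        by (simp add: inner_diff_left)
      then show "onorm (\<lambda>h. h *\<^sub>R (inner (f x) \<psi> - inner (f s) \<psi>)) \<le> e * norm \<psi>"
        by (intro onorm_le) (simp add: abs_mult mult.commute[of "e * norm \<psi>"] mult_left_mono)
    qed auto
    then show "\<bar>inner (F t - F s - (t - s) *\<^sub>R f s) \<psi>\<bar> \<le> e * norm (t - s) * norm \<psi>"
      by (simp add: inner_diff_left algebra_simps)
  qed
  then show "\<exists>d>0. \<forall>y\<in>{0..\<tau>}. norm (y - s) < d \<longrightarrow> norm (F y - F s - (y - s) *\<^sub>R f s) \<le> e * norm (y - s)"
    using d(1) by blast
qed

context mgt_system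
begin

section \<open>A sum norm on the phase space equivalent to \<open>phase_norm\<close>\<close>

abbreviation "Ph \<equiv> phase D A"

text \<open>This decouples the components that \<open>phase_norm\<close> mixes through
  \<open>v + \<alpha> *\<^sub>R u\<close> and \<open>w + \<alpha> *\<^sub>R v\<close>, so that
  limits and the triangle inequality can be treated componentwise.\<close>

definition pnorm :: "'a \<times> 'a \<times> 'a \<times> 'a \<Rightarrow> real" where
  "pnorm = (\<lambda>(u, v, w, \<theta>). nrm u + nrm v + norm w + norm \<theta>)"

lemma phase_iff: "(u, v, w, \<theta>) \<in> Ph \<longleftrightarrow> u \<in> H \<and> v \<in> H"
  by (simp add: phase_def)

lemma phase_diff: "U \<in> Ph \<Longrightarrow> V \<in> Ph \<Longrightarrow> U - V \<in> Ph"
  by (cases U; cases V) (simp add: phase_iff H1_diff)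

lemma map4_R_in_phase: "map4 R U \<in> Ph"
  by (cases U) (simp add: map4_def phase_iff R_in_H1)

lemma pnorm_triangle:
  assumes "U \<in> Ph" "V \<in> Ph"
  shows "pnorm (U + V) \<le> pnorm U + pnorm V"
proof -
  obtain u v w \<theta> u' v' w' \<theta>' where eq: "U = (u, v, w, \<theta>)" "V = (u', v', w', \<theta>')"
    by (cases U, cases V) auto
  show ?thesis
    using norm1_triangle[of u u'] norm1_triangle[of v v'] norm_triangle_ineq[of w w']
      norm_triangle_ineq[of \<theta> \<theta>'] assms
    by (simp add: eq phase_iff pnorm_def)
qed

lemma pnorm_minus_commute:
  assumes "U \<in> Ph" "V \<in> Ph"
  shows "pnorm (U - V) = pnorm (V - U)"
proof -
  obtain u v w \<theta> u' v' w' \<theta>' where eq: "U = (u, v, w, \<theta>)" "V = (u', v', w', \<theta>')"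
    by (cases U, cases V) auto
  show ?thesis
    using assms by (simp add: eq phase_iff pnorm_def norm1_minus_commute[of u u'] norm1_minus_commute[of v v'] norm_minus_commute)
qed

lemma pnorm_diff_triangle:
  assumes "U \<in> Ph" "V \<in> Ph" "W \<in> Ph"
  shows "pnorm (U - W) \<le> pnorm (U - V) + pnorm (V - W)"
  using pnorm_triangle[OF phase_diff[OF assms(1,2)] phase_diff[OF assms(2,3)]] by simp

lemma norm_le_pnorm:
  assumes "U \<in> Ph"
  shows "norm U \<le> (1 + sqrt k) * pnorm U"
proof -
  obtain u v w \<theta> where eq: "U = (u, v, w, \<theta>)" by (cases U) auto
  have H: "u \<in> H" "v \<in> H" using assms by (auto simp: eq phase_iff)
  have "norm U \<le> norm u + (norm v + (norm w + norm \<theta>))"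
    unfolding eq by (intro order_trans[OF norm_Pair_le] add_left_mono order_refl)
  also have "\<dots> \<le> sqrt k * nrm u + (sqrt k * nrm v + (norm w + norm \<theta>))"
    using norm_le_norm1[OF H(1)] norm_le_norm1[OF H(2)] by linarith
  also have "\<dots> \<le> (1 + sqrt k) * pnorm U"
    using norm1_nonneg[OF H(1)] norm1_nonneg[OF H(2)] k_pos by (simp add: eq pnorm_def algebra_simps)
  finally show ?thesis .
qed

text \<open>\<open>R\<close> maps the base space boundedly into \<open>H^1\<close>; continuity of
  \<open>W\<close> in the base norm thus becomes phase-space continuity of
  \<open>map4 R W\<close>.\<close>

lemma pnorm_map4_R_le: "pnorm (map4 R U) \<le> (2 * sqrt k + 2 * k) * norm U"
proof -
  obtain u v w \<theta> where eq: "U = (u, v, w, \<theta>)" by (cases U) auto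
  have n: "norm u \<le> norm U" "norm v \<le> norm U" "norm w \<le> norm U" "norm \<theta> \<le> norm U"
    using norm_fst_le[of u "(v, w, \<theta>)"] norm_snd_le[of "(v, w, \<theta>)" u] norm_fst_le[of v "(w, \<theta>)"]
      norm_snd_le[of "(w, \<theta>)" v] norm_fst_le[of w \<theta>] norm_snd_le[of \<theta> w] by (auto simp: eq)
  have "pnorm (map4 R U) \<le> sqrt k * norm u + sqrt k * norm v + k * norm w + k * norm \<theta>"
    using norm1_R_le[of u] norm1_R_le[of v] bound[of w] bound[of \<theta>] by (simp add: eq map4_def pnorm_def)
  also have "\<dots> \<le> sqrt k * norm U + sqrt k * norm U + k * norm U + k * norm U"
    using n k_pos by (intro add_mono mult_left_mono) auto
  finally show ?thesis by (simp add: algebra_simps)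
qed

text \<open>Lower semicontinuity is applied to the four components separately, each bounded by
  \<open>M\<close>; hence the factor \<open>4\<close>.\<close>

lemma pnorm_lsc:
  assumes lim: "U \<longlonglongrightarrow> L" and M: "0 \<le> M" and ev: "\<forall>\<^sub>F n in sequentially. U n \<in> Ph \<and> pnorm (U n) \<le> M"
  shows "L \<in> Ph" "pnorm L \<le> 4 * M"
proof -
  obtain u v w \<theta> where L: "L = (u, v, w, \<theta>)" by (cases L) auto
  have c: "nrm (fst x) \<le> M" "nrm (fst (snd x)) \<le> M" "norm (fst (snd (snd x))) \<le> M"
    "norm (snd (snd (snd x))) \<le> M" "fst x \<in> H" "fst (snd x) \<in> H" if "x \<in> Ph \<and> pnorm x \<le> M" for x
  proof -
    obtain a b c d where x: "x = (a, b, c, d)" by (cases x) auto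
    have ab: "a \<in> H" "b \<in> H" using that by (auto simp: x phase_iff)
    show "nrm (fst x) \<le> M" "nrm (fst (snd x)) \<le> M" "norm (fst (snd (snd x))) \<le> M"
      "norm (snd (snd (snd x))) \<le> M" "fst x \<in> H" "fst (snd x) \<in> H"
      using that norm1_nonneg[OF ab(1)] norm1_nonneg[OF ab(2)] norm_ge_zero[of c] norm_ge_zero[of d] ab
      by (auto simp: x pnorm_def simp del: norm_ge_zero)
  qed
  have l1: "(\<lambda>n. fst (U n)) \<longlonglongrightarrow> u" and l2: "(\<lambda>n. fst (snd (U n))) \<longlonglongrightarrow> v"
    and l3: "(\<lambda>n. fst (snd (snd (U n)))) \<longlonglongrightarrow> w" and l4: "(\<lambda>n. snd (snd (snd (U n)))) \<longlonglongrightarrow> \<theta>"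
    using tendsto_fst[OF lim] tendsto_fst[OF tendsto_snd[OF lim]] tendsto_fst[OF tendsto_snd[OF tendsto_snd[OF lim]]]
      tendsto_snd[OF tendsto_snd[OF tendsto_snd[OF lim]]] by (simp_all add: L)
  have u: "u \<in> H" "nrm u \<le> M"
    using norm1_lsc[OF l1 M eventually_mono[OF ev]] c(1,5) by blast+
  have v: "v \<in> H" "nrm v \<le> M"
    using norm1_lsc[OF l2 M eventually_mono[OF ev]] c(2,6) by blast+
  have w: "norm w \<le> M"
    by (rule tendsto_upperbound[OF tendsto_norm[OF l3] eventually_mono[OF ev c(3)] trivial_limit_sequentially])
  have \<theta>: "norm \<theta> \<le> M"
    by (rule tendsto_upperbound[OF tendsto_norm[OF l4] eventually_mono[OF ev c(4)] trivial_limit_sequentially])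
  show "L \<in> Ph" "pnorm L \<le> 4 * M" using u v w \<theta> by (auto simp: L phase_iff pnorm_def)
qed

lemma phase_norm_le_pnorm:
  assumes "U \<in> Ph"
  shows "phase_norm D A \<alpha> U \<le> (3 + \<alpha> + \<alpha> * sqrt k) * pnorm U"
proof -
  obtain u v w \<theta> where eq: "U = (u, v, w, \<theta>)" by (cases U) auto
  have H: "u \<in> H" "v \<in> H" using assms by (auto simp: eq phase_iff)
  have nn: "0 \<le> nrm u" "0 \<le> nrm v" "0 \<le> nrm (v + \<alpha> *\<^sub>R u)"
    using H by (auto intro!: norm1_nonneg H1_add H1_scale)
  let ?a = "nrm (v + \<alpha> *\<^sub>R u)" and ?b = "norm (w + \<alpha> *\<^sub>R v)" and ?c = "nrm v" and ?d = "norm \<theta>"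
  have "?a\<^sup>2 + ?b\<^sup>2 + ?c\<^sup>2 + ?d\<^sup>2 \<le> (?a + ?b + ?c + ?d)\<^sup>2"
    using nn by (simp add: power2_eq_square algebra_simps)
  then have "phase_norm D A \<alpha> U \<le> ?a + ?b + ?c + ?d"
    using nn unfolding eq phase_norm_def prod.case by (intro real_le_lsqrt) auto
  moreover have "?a \<le> nrm v + \<alpha> * nrm u"
    using norm1_triangle[OF H(2) H1_scale[OF H(1)], of \<alpha>] norm1_scale_le[OF H(1), of \<alpha>] \<alpha>_pos by simp
  moreover have "?b \<le> norm w + \<alpha> * (sqrt k * nrm v)"
    using norm_le_norm1[OF H(2)] \<alpha>_pos by (intro order_trans[OF norm_triangle_ineq] add_mono) auto
  moreover have "nrm v + \<alpha> * nrm u + (norm w + \<alpha> * (sqrt k * nrm v)) + nrm v + norm \<theta>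
      \<le> (3 + \<alpha> + \<alpha> * sqrt k) * pnorm U"
  proof -
    have "0 \<le> \<alpha> * norm w" "0 \<le> \<alpha> * norm \<theta>" "0 \<le> \<alpha> * nrm v" "0 \<le> \<alpha> * (sqrt k * nrm u)"
      "0 \<le> \<alpha> * (sqrt k * norm w)" "0 \<le> \<alpha> * (sqrt k * norm \<theta>)" "0 \<le> norm w" "0 \<le> norm \<theta>"
      using nn \<alpha>_pos k_pos by auto
    moreover have "(3 + \<alpha> + \<alpha> * sqrt k) * pnorm U = 3 * nrm u + 3 * nrm v + 3 * norm w + 3 * norm \<theta>
       + \<alpha> * nrm u + \<alpha> * nrm v + \<alpha> * norm w + \<alpha> * norm \<theta>
       + \<alpha> * (sqrt k * nrm u) + \<alpha> * (sqrt k * nrm v) + \<alpha> * (sqrt k * norm w) + \<alpha> * (sqrt k * norm \<theta>)"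
      by (simp add: eq pnorm_def algebra_simps)
    ultimately show ?thesis using nn by linarith
  qed
  ultimately show ?thesis by linarith
qed

text \<open>\<open>u\<close> is recovered from \<open>v + \<alpha> *\<^sub>R u\<close> and
  \<open>v\<close> through division by \<alpha>, which gives \<open>2 / \<alpha>\<close>;
  \<open>w\<close> is recovered from \<open>w + \<alpha> *\<^sub>R v\<close> and the embedding of
  \<open>H^1\<close>.\<close>

lemma pnorm_le_phase_norm:
  assumes "U \<in> Ph"
  shows "pnorm U \<le> (2 / \<alpha> + 3 + \<alpha> * sqrt k) * phase_norm D A \<alpha> U"
proof -
  obtain u v w \<theta> where eq: "U = (u, v, w, \<theta>)" by (cases U) auto
  have H: "u \<in> H" "v \<in> H" using assms by (auto simp: eq phase_iff)
  define p where "p = phase_norm D A \<alpha> U"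
  have "nrm (v + \<alpha> *\<^sub>R u) \<le> p" "norm (w + \<alpha> *\<^sub>R v) \<le> p" "nrm v \<le> p" "norm \<theta> \<le> p"
    unfolding p_def eq phase_norm_def prod.case by (rule real_le_rsqrt; simp)+
  note p = this
  have "\<alpha> *\<^sub>R u = (v + \<alpha> *\<^sub>R u) + (-1) *\<^sub>R v" by simp
  then have "u = (1 / \<alpha>) *\<^sub>R ((v + \<alpha> *\<^sub>R u) + (-1) *\<^sub>R v)" using \<alpha>_pos by simp
  then have "nrm u = nrm ((1 / \<alpha>) *\<^sub>R ((v + \<alpha> *\<^sub>R u) + (-1) *\<^sub>R v))" by simp
  also have "\<dots> \<le> 1 / \<alpha> * nrm ((v + \<alpha> *\<^sub>R u) + (-1) *\<^sub>R v)"
    using norm1_scale_le[of "(v + \<alpha> *\<^sub>R u) + (-1) *\<^sub>R v" "1 / \<alpha>"] H \<alpha>_pos by (auto intro!: H1_add H1_scale)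
  also have "\<dots> \<le> 1 / \<alpha> * (p + p)"
  proof (intro mult_left_mono)
    have "nrm ((v + \<alpha> *\<^sub>R u) + (-1) *\<^sub>R v) \<le> nrm (v + \<alpha> *\<^sub>R u) + nrm ((-1) *\<^sub>R v)"
      using H by (intro norm1_triangle H1_add H1_scale)
    also have "\<dots> \<le> p + p" using p norm1_scale_le[OF H(2), of "-1"] by simp
    finally show "nrm ((v + \<alpha> *\<^sub>R u) + (-1) *\<^sub>R v) \<le> p + p" .
  qed (use \<alpha>_pos in simp)
  finally have u: "nrm u \<le> 2 / \<alpha> * p" by simp
  have "norm w = norm ((w + \<alpha> *\<^sub>R v) - \<alpha> *\<^sub>R v)" by simp
  also have "\<dots> \<le> norm (w + \<alpha> *\<^sub>R v) + norm (\<alpha> *\<^sub>R v)" by (rule norm_triangle_ineq4)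
  also have "norm (\<alpha> *\<^sub>R v) = \<alpha> * norm v" using \<alpha>_pos by simp
  also have "\<alpha> * norm v \<le> \<alpha> * (sqrt k * p)"
    using order_trans[OF norm_le_norm1[OF H(2)] mult_left_mono[OF p(3)]] k_pos \<alpha>_pos
    by (intro mult_left_mono) auto
  finally have "norm w \<le> p + \<alpha> * (sqrt k * p)" using p(2) by linarith
  then show ?thesis using u p(3,4) by (simp add: eq pnorm_def p_def[unfolded eq, symmetric] algebra_simps)
qed

lemma cont_phase_iff:
  "cont_phase D A \<alpha> U \<longleftrightarrow> (\<forall>t\<ge>0. U t \<in> Ph) \<and>
     (\<forall>t\<ge>0. \<forall>e>0. \<exists>d>0. \<forall>s\<ge>0. \<bar>s - t\<bar> < d \<longrightarrow> pnorm (U s - U t) < e)"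
proof -
  let ?c = "3 + \<alpha> + \<alpha> * sqrt k" and ?c' = "2 / \<alpha> + 3 + \<alpha> * sqrt k"
  have c: "?c > 0" "?c' > 0" using \<alpha>_pos k_pos by (auto intro!: add_pos_nonneg)
  have to_phase: "(\<exists>d>0. \<forall>s\<ge>0. \<bar>s - t\<bar> < d \<longrightarrow> phase_norm D A \<alpha> (U s - U t) < e)"
    if U: "\<forall>t\<ge>0. U t \<in> Ph" and C: "\<forall>t\<ge>0. \<forall>e>0. \<exists>d>0. \<forall>s\<ge>0. \<bar>s - t\<bar> < d \<longrightarrow> pnorm (U s - U t) < e"
      and t: "t \<ge> 0" and e: "e > 0" for t e
  proof -
    obtain d where d: "d > 0" "\<And>s. s \<ge> 0 \<Longrightarrow> \<bar>s - t\<bar> < d \<Longrightarrow> pnorm (U s - U t) < e / ?c"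
      using C[rule_format, OF t divide_pos_pos[OF e c(1)]] by blast
    have "phase_norm D A \<alpha> (U s - U t) < e" if s: "s \<ge> 0" "\<bar>s - t\<bar> < d" for s
    proof -
      have "phase_norm D A \<alpha> (U s - U t) \<le> ?c * pnorm (U s - U t)"
        using U t s by (intro phase_norm_le_pnorm phase_diff) auto
      also have "\<dots> < ?c * (e / ?c)" by (intro mult_strict_left_mono d s c)
      also have "\<dots> = e" using c by simp
      finally show ?thesis .
    qed
    then show ?thesis using d(1) by blast
  qed
  have to_p: "(\<exists>d>0. \<forall>s\<ge>0. \<bar>s - t\<bar> < d \<longrightarrow> pnorm (U s - U t) < e)"
    if U: "\<forall>t\<ge>0. U t \<in> Ph"
      and C: "\<forall>t\<ge>0. \<forall>e>0. \<exists>d>0. \<forall>s\<ge>0. \<bar>s - t\<bar> < d \<longrightarrow> phase_norm D A \<alpha> (U s - U t) < e"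
      and t: "t \<ge> 0" and e: "e > 0" for t e
  proof -
    obtain d where d: "d > 0" "\<And>s. s \<ge> 0 \<Longrightarrow> \<bar>s - t\<bar> < d \<Longrightarrow> phase_norm D A \<alpha> (U s - U t) < e / ?c'"
      using C[rule_format, OF t divide_pos_pos[OF e c(2)]] by blast
    have "pnorm (U s - U t) < e" if s: "s \<ge> 0" "\<bar>s - t\<bar> < d" for s
    proof -
      have "pnorm (U s - U t) \<le> ?c' * phase_norm D A \<alpha> (U s - U t)"
        using U t s by (intro pnorm_le_phase_norm phase_diff) auto
      also have "\<dots> < ?c' * (e / ?c')" by (intro mult_strict_left_mono d s c)
      also have "\<dots> = e" using c by simp
      finally show ?thesis .
    qed
    then show ?thesis using d(1) by blast
  qed
  show ?thesis unfolding cont_phase_def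
    by (intro iffI conjI allI impI; elim conjE; (rule to_phase to_p)?; simp)
qed

section \<open>Existence in the phase space\<close>

lemma energy_le_pnorm:
  "\<exists>C\<ge>0. \<forall>U. sqrt (energy R (\<lambda>x. R (R x)) U) \<le> C * pnorm (map4 R U)"
proof (intro exI conjI allI)
  let ?C = "sqrt \<beta> * (1 + \<rho>) + (1 + \<alpha> * sqrt k) + 1 + 1"
  show "?C \<ge> 0" using \<beta>_pos \<rho>_pos \<alpha>_pos k_pos by simp
  fix U :: "'a \<times> 'a \<times> 'a \<times> 'a"
  obtain u v w \<theta> where U: "U = (u, v, w, \<theta>)" by (cases U) auto
  define p where "p = pnorm (map4 R U)"
  have p: "p = nrm (R u) + nrm (R v) + norm (R w) + norm (R \<theta>)" by (simp add: p_def U map4_def pnorm_def)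
  have nn: "0 \<le> nrm (R u)" "0 \<le> nrm (R v)" using norm1_nonneg[OF R_in_H1] by auto
  let ?r = "nrm (R (v + \<rho> *\<^sub>R u))" and ?q = "norm (R (w + \<alpha> *\<^sub>R v))"
  have r0: "0 \<le> ?r" by (rule norm1_nonneg[OF R_in_H1])
  have E: "energy R (\<lambda>x. R (R x)) U = (sqrt \<beta> * ?r)\<^sup>2 + ?q\<^sup>2 + (norm (R \<theta>))\<^sup>2 + (nrm (R u))\<^sup>2"
    using \<beta>_pos R_nonneg by (simp add: U energy_def norm1_R power_mult_distrib sym[of "R _"] dot_square_norm)
  have "\<dots> \<le> (sqrt \<beta> * ?r + ?q + norm (R \<theta>) + nrm (R u))\<^sup>2"
  proof -
    have "a\<^sup>2 + b\<^sup>2 + c\<^sup>2 + d\<^sup>2 \<le> (a + b + c + d)\<^sup>2" if "0 \<le> a" "0 \<le> b" "0 \<le> c" "0 \<le> d" for a b c d :: real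
      using that by (simp add: power2_eq_square algebra_simps)
    then show ?thesis using r0 \<beta>_pos nn by simp
  qed
  then have "sqrt (energy R (\<lambda>x. R (R x)) U) \<le> sqrt \<beta> * ?r + ?q + norm (R \<theta>) + nrm (R u)"
    unfolding E using r0 \<beta>_pos nn by (intro real_le_lsqrt) auto
  also have "\<dots> \<le> sqrt \<beta> * ((1 + \<rho>) * p) + (1 + \<alpha> * sqrt k) * p + p + p"
  proof (intro add_mono mult_left_mono)
    have "?r \<le> nrm (R v) + \<rho> * nrm (R u)"
      unfolding R.add R.scaleR using norm1_triangle[OF R_in_H1 H1_scale[OF R_in_H1]]
        norm1_scale_le[OF R_in_H1, of \<rho>] \<rho>_pos by (smt (verit))
    also have "\<dots> \<le> p + \<rho> * p" using \<rho>_pos nn p by (intro add_mono mult_left_mono) auto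
    finally show "?r \<le> (1 + \<rho>) * p" by (simp add: algebra_simps)
    have "?q \<le> norm (R w) + \<alpha> * norm (R v)"
      unfolding R.add R.scaleR using norm_triangle_ineq[of "R w" "\<alpha> *\<^sub>R R v"] \<alpha>_pos by simp
    also have "\<dots> \<le> p + \<alpha> * (sqrt k * p)"
    proof (intro add_mono mult_left_mono)
      have "norm (R v) \<le> sqrt k * nrm (R v)" by (rule norm_le_norm1[OF R_in_H1])
      also have "\<dots> \<le> sqrt k * p" using p nn k_pos by (intro mult_left_mono) auto
      finally show "norm (R v) \<le> sqrt k * p" .
    qed (use p nn \<alpha>_pos in auto)
    finally show "?q \<le> (1 + \<alpha> * sqrt k) * p" by (simp add: algebra_simps)
  qed (use p nn \<beta>_pos in auto)
  also have "\<dots> = ?C * p" by (simp add: algebra_simps)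
  finally show "sqrt (energy R (\<lambda>x. R (R x)) U) \<le> ?C * pnorm (map4 R U)" by (simp add: p_def)
qed

lemma pnorm_le_energy:
  "\<exists>C\<ge>0. \<forall>U. pnorm (map4 R U) \<le> C * sqrt (energy R (\<lambda>x. R (R x)) U)"
proof (intro exI conjI allI)
  let ?cv = "1 / sqrt \<beta> + \<rho>"
  let ?C = "1 + ?cv + (1 + \<alpha> * (sqrt k * ?cv)) + 1"
  show "?C \<ge> 0" using \<beta>_pos \<rho>_pos \<alpha>_pos k_pos by simp
  fix U :: "'a \<times> 'a \<times> 'a \<times> 'a"
  obtain u v w \<theta> where U: "U = (u, v, w, \<theta>)" by (cases U) auto
  let ?r = "v + \<rho> *\<^sub>R u" and ?q = "w + \<alpha> *\<^sub>R v"
  define s where "s = sqrt (energy R (\<lambda>x. R (R x)) U)"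
  have E: "energy R (\<lambda>x. R (R x)) U = \<beta> * (nrm (R ?r))\<^sup>2 + (norm (R ?q))\<^sup>2 + (norm (R \<theta>))\<^sup>2 + (nrm (R u))\<^sup>2"
    using R_nonneg by (simp add: U energy_def norm1_R sym[of "R _"] dot_square_norm)
  have nn: "0 \<le> \<beta> * (nrm (R ?r))\<^sup>2" using \<beta>_pos by simp
  have u: "nrm (R u) \<le> s" and q: "norm (R ?q) \<le> s" and \<theta>: "norm (R \<theta>) \<le> s"
    unfolding s_def E using nn by (auto intro!: real_le_rsqrt)
  have "(nrm (R ?r))\<^sup>2 \<le> energy R (\<lambda>x. R (R x)) U / \<beta>"
    using \<beta>_pos unfolding E by (simp add: field_simps)
  then have r: "nrm (R ?r) \<le> s / sqrt \<beta>"
    unfolding s_def real_sqrt_divide[symmetric] by (rule real_le_rsqrt)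
  have "R v = R ?r + (- \<rho>) *\<^sub>R R u" by (simp add: R.add R.scaleR)
  then have "nrm (R v) \<le> nrm (R ?r) + nrm ((- \<rho>) *\<^sub>R R u)"
    using norm1_triangle[OF R_in_H1 H1_scale[OF R_in_H1]] by metis
  also have "\<dots> \<le> s / sqrt \<beta> + \<rho> * s"
    using r order_trans[OF norm1_scale_le[OF R_in_H1] mult_left_mono[OF u abs_ge_zero], of "- \<rho>"] \<rho>_pos
    by (intro add_mono) auto
  finally have v: "nrm (R v) \<le> ?cv * s" by (simp add: algebra_simps)
  have "norm (R v) \<le> sqrt k * (?cv * s)"
    using order_trans[OF norm_le_norm1[OF R_in_H1] mult_left_mono[OF v]] k_pos by simp
  then have "norm (\<alpha> *\<^sub>R R v) \<le> \<alpha> * (sqrt k * (?cv * s))" using \<alpha>_pos by simp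
  moreover have "R w = R ?q - \<alpha> *\<^sub>R R v" by (simp add: R.add R.scaleR)
  then have "norm (R w) \<le> norm (R ?q) + norm (\<alpha> *\<^sub>R R v)" by (metis norm_triangle_ineq4)
  ultimately have "norm (R w) \<le> (1 + \<alpha> * (sqrt k * ?cv)) * s" using q by (simp add: algebra_simps)
  then have "pnorm (map4 R U) \<le> s + ?cv * s + (1 + \<alpha> * (sqrt k * ?cv)) * s + s"
    using u v \<theta> unfolding U map4_def pnorm_def prod.case by linarith
  also have "\<dots> = ?C * s" by (simp add: algebra_simps)
  finally show "pnorm (map4 R U) \<le> ?C * sqrt (energy R (\<lambda>x. R (R x)) U)" by (simp add: s_def)
qed

text \<open>The energy estimate is run for \<open>W\<close> with the bounded weights
  \<open>R\<close> and \<open>R\<close> squared and read as a phase-space estimate for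
  \<open>map4 R W\<close>. \<open>C\<close> is independent of the solution, which allows the passage
  to general data.\<close>

lemma regular_solution_bound:
  "\<exists>C\<ge>0. \<forall>W t. solves R W \<longrightarrow> t \<ge> 0 \<longrightarrow> pnorm (map4 R (W t)) \<le> C * exp (\<omega> * t) * pnorm (map4 R (W 0))"
proof -
  let ?E = "energy R (\<lambda>x. R (R x))"
  obtain C1 where C1: "C1 \<ge> 0" "\<And>U. sqrt (?E U) \<le> C1 * pnorm (map4 R U)"
    using energy_le_pnorm by blast
  obtain C2 where C2: "C2 \<ge> 0" "\<And>U. pnorm (map4 R U) \<le> C2 * sqrt (?E U)"
    using pnorm_le_energy by blast
  have RR: "0 \<le> inner (R (R x)) x" for x by (simp add: sym[of "R _"])
  have "pnorm (map4 R (W t)) \<le> (C2 * C1) * exp (\<omega> * t) * pnorm (map4 R (W 0))"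
    if W: "solves R W" and t: "t \<ge> 0" for W t
  proof -
    have "?E (W t) \<le> exp (\<omega> * t) * (?E (W 0) + 0 * t)"
      by (rule energy_growth[where f = "\<lambda>_. 0" and g = "\<lambda>_. 0" and \<tau> = t, OF blin sym R_nonneg blin sym refl RR
            solves_continuous_on[OF W]])
        (use W t in \<open>auto simp: zero_prod_def[symmetric] R.zero intro: solves_derivative\<close>)
    then have "sqrt (?E (W t)) \<le> sqrt (exp (\<omega> * t) * ?E (W 0))" by (simp add: real_sqrt_le_mono)
    also have "\<dots> = sqrt (exp (\<omega> * t)) * sqrt (?E (W 0))" by (rule real_sqrt_mult)
    also have "\<dots> \<le> exp (\<omega> * t) * (C1 * pnorm (map4 R (W 0)))"
    proof (rule mult_mono[OF _ C1(2)])
      \<comment> \<open>The square root would give the rate \<open>\<omega> / 2\<close>; it is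
        replaced by the cruder rate \<omega>.\<close>
      have "1 \<le> exp (\<omega> * t)" using \<omega>_nonneg t by simp
      then show "sqrt (exp (\<omega> * t)) \<le> exp (\<omega> * t)"
        by (intro real_le_lsqrt) (auto simp: power2_eq_square)
      have "0 \<le> ?E (W 0)" using R_nonneg RR \<beta>_pos unfolding energy_def case_prod_unfold
        by (intro add_nonneg_nonneg mult_nonneg_nonneg) auto
      then show "0 \<le> sqrt (?E (W 0))" by simp
    qed simp
    finally show ?thesis
      using C2(2)[of "W t"] mult_left_mono[OF _ C2(1)] by (smt (verit) mult.assoc mult.commute)
  qed
  then show ?thesis using C1(1) C2(1) by (intro exI[of _ "C2 * C1"]) auto
qed

text \<open>The three inner factors of \<open>R\<close> make a regular solution \<open>W\<close>
  available, and the outermost one forms \<open>map4 R W\<close>, the object that the phase-space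
  bound controls.\<close>

lemma regular_data_dense:
  assumes U: "U \<in> Ph" and e: "e > 0"
  shows "\<exists>Z. pnorm (map4 R (map4 R (map4 R (map4 R Z))) - U) < e"
proof -
  obtain u v w \<theta> where eq: "U = (u, v, w, \<theta>)" by (cases U) auto
  have H: "u \<in> H" "v \<in> H" using U by (auto simp: eq phase_iff)
  have R4: "(R ^^ Suc 3) x = R (R (R (R x)))" for x by (simp add: numeral_3_eq_3)
  have e4: "e / 4 > 0" using e by simp
  obtain a where a: "nrm (u - R (R (R (R a)))) < e / 4" using R_pow_dense_in_H1[OF H(1) e4, of 3] unfolding R4 by blast
  obtain b where b: "nrm (v - R (R (R (R b)))) < e / 4" using R_pow_dense_in_H1[OF H(2) e4, of 3] unfolding R4 by blast
  obtain c where c: "norm (w - R (R (R (R c)))) < e / 4" using R_pow_dense[OF e4, of w "Suc 3"] unfolding R4 by blast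
  obtain d where d: "norm (\<theta> - R (R (R (R d)))) < e / 4" using R_pow_dense[OF e4, of \<theta> "Suc 3"] unfolding R4 by blast
  have "map4 R (map4 R (map4 R (map4 R (a, b, c, d)))) \<in> Ph" by (rule map4_R_in_phase)
  then have "pnorm (map4 R (map4 R (map4 R (map4 R (a, b, c, d)))) - U)
      = pnorm (U - map4 R (map4 R (map4 R (map4 R (a, b, c, d)))))"
    by (rule pnorm_minus_commute[OF _ U])
  also have "\<dots> < e" using a b c d by (simp add: eq map4_def pnorm_def)
  finally show ?thesis by blast
qed

lemma phase_solution_exists:
  "\<exists>C\<ge>0. \<forall>U0\<in>Ph. \<exists>V. solves R V \<and> V 0 = U0 \<and> cont_phase D A \<alpha> V \<and>
     (\<forall>t\<ge>0. pnorm (V t) \<le> C * exp (\<omega> * t) * pnorm U0)"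
proof -
  interpret R4: bounded_linear "map4 R" by (rule bounded_linear_map4[OF blin])
  obtain C where C: "C \<ge> 0"
    and bnd: "\<And>W t. solves R W \<Longrightarrow> t \<ge> 0 \<Longrightarrow> pnorm (map4 R (W t)) \<le> C * exp (\<omega> * t) * pnorm (map4 R (W 0))"
    using regular_solution_bound by blast
  have "\<exists>V. solves R V \<and> V 0 = U0 \<and> cont_phase D A \<alpha> V \<and> (\<forall>t\<ge>0. pnorm (V t) \<le> C * exp (\<omega> * t) * pnorm U0)"
    if U0: "U0 \<in> Ph" for U0
  proof -
    define \<epsilon> where "\<epsilon> n = 1 / real (Suc n)" for n
    have \<epsilon>: "\<epsilon> n > 0" for n by (simp add: \<epsilon>_def)
    have \<epsilon>_mono: "\<epsilon> m \<le> \<epsilon> n" if "n \<le> m" for n m using that by (simp add: \<epsilon>_def frac_le)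
    have \<epsilon>_lim: "\<epsilon> \<longlonglongrightarrow> 0" unfolding \<epsilon>_def by (rule LIMSEQ_Suc[OF lim_1_over_n])
    have "\<exists>W. solves R W \<and> pnorm (map4 R (W 0) - U0) < \<epsilon> n" for n
      using regular_data_dense[OF U0 \<epsilon>[of n]] regular_solution_exists by metis
    then obtain W where W: "\<And>n. solves R (W n)" and W0: "\<And>n. pnorm (map4 R (W n 0) - U0) < \<epsilon> n" by metis
    define V where "V n t = map4 R (W n t)" for n t
    have VP: "V n t \<in> Ph" for n t unfolding V_def by (rule map4_R_in_phase)
    have Vs: "solves R (V n)" for n unfolding V_def by (intro solves_map4 blin W refl)
    \<comment> \<open>By linearity the bound applies to the difference of two regular solutions, so
      the \<open>V n\<close> are Cauchy in \<open>pnorm\<close>, uniformly on bounded time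
      intervals.\<close>
    have diff: "pnorm (V n t - V m t) \<le> C * exp (\<omega> * t) * (\<epsilon> n + \<epsilon> m)" if "t \<ge> 0" for n m t
    proof -
      have "pnorm (V n t - V m t) \<le> C * exp (\<omega> * t) * pnorm (V n 0 - V m 0)"
        using bnd[OF solves_diff[OF blin W W] that] by (simp add: V_def R4.diff)
      also have "pnorm (V n 0 - V m 0) \<le> pnorm (V n 0 - U0) + pnorm (U0 - V m 0)"
        by (rule pnorm_diff_triangle[OF VP U0 VP])
      also have "\<dots> \<le> \<epsilon> n + \<epsilon> m"
        using W0[of n] W0[of m] pnorm_minus_commute[OF U0 VP, of m 0] by (simp add: V_def)
      finally show ?thesis using C by (simp add: mult_left_mono)
    qed
    have diffT: "pnorm (V n t - V m t) \<le> C * exp (\<omega> * \<tau>) * (2 * \<epsilon> N)"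
      if "t \<in> {0..\<tau>}" "n \<ge> N" "m \<ge> N" for n m t N \<tau>
    proof -
      have "pnorm (V n t - V m t) \<le> C * exp (\<omega> * t) * (\<epsilon> n + \<epsilon> m)" using diff that by simp
      also have "\<dots> \<le> C * exp (\<omega> * \<tau>) * (2 * \<epsilon> N)"
        using that C \<omega>_nonneg \<epsilon>_mono[OF that(2)] \<epsilon>_mono[OF that(3)] \<epsilon>[of n] \<epsilon>[of m]
        by (intro mult_mono) (auto simp: mult_left_mono)
      finally show ?thesis .
    qed
    have small: "\<exists>N. K * \<epsilon> N < e" if "e > 0" "K \<ge> 0" for K e
    proof -
      have "(\<lambda>n. K * \<epsilon> n) \<longlonglongrightarrow> K * 0" by (intro tendsto_intros \<epsilon>_lim)
      then have "\<forall>\<^sub>F n in sequentially. K * \<epsilon> n < e" using that by (intro order_tendstoD) auto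
      then show ?thesis by (auto simp: eventually_sequentially)
    qed
    have "uniformly_Cauchy_on {0..\<tau>} V" for \<tau>
    proof (rule uniformly_Cauchy_onI)
      fix e :: real assume e: "e > 0"
      let ?K = "(1 + sqrt k) * (C * exp (\<omega> * \<tau>) * 2)"
      have "?K \<ge> 0" using C k_pos by simp
      then obtain N where N: "?K * \<epsilon> N < e" using small[OF e] by blast
      have "dist (V n t) (V m t) < e" if "t \<in> {0..\<tau>}" "n \<ge> N" "m \<ge> N" for t n m
      proof -
        have "norm (V n t - V m t) \<le> (1 + sqrt k) * pnorm (V n t - V m t)"
          by (intro norm_le_pnorm phase_diff VP)
        also have "\<dots> \<le> (1 + sqrt k) * (C * exp (\<omega> * \<tau>) * (2 * \<epsilon> N))"
          using k_pos by (intro mult_left_mono diffT that) auto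
        also have "\<dots> < e" using N by (simp add: mult_ac)
        finally show ?thesis by (simp add: dist_norm)
      qed
      then show "\<exists>N. \<forall>t\<in>{0..\<tau>}. \<forall>n\<ge>N. \<forall>m\<ge>N. dist (V n t) (V m t) < e" by blast
    qed
    then have unif: "uniform_limit {0..\<tau>} V (\<lambda>t. lim (\<lambda>n. V n t)) sequentially" for \<tau>
      using Cauchy_uniformly_convergent uniformly_convergent_uniform_limit_iff by blast
    define L where "L t = lim (\<lambda>n. V n t)" for t
    have unif: "uniform_limit {0..\<tau>} V L sequentially" for \<tau> using unif by (simp add: L_def[abs_def])
    have L: "solves R L"
      by (rule solves_uniform_limit[where e = "\<lambda>_. 0" and U = V]) (use Vs unif in auto)
    have lim: "(\<lambda>n. V n t) \<longlonglongrightarrow> L t" if "t \<ge> 0" for t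
      by (rule tendsto_uniform_limitI[OF unif[of t]]) (use that in simp)
    \<comment> \<open>The limit was taken in the base norm; lower semicontinuity gives it the Cauchy
      bound in \<open>pnorm\<close>, and \<open>L t\<close> lies in the phase space because
      \<open>V N t\<close> and \<open>V N t - L t\<close> do.\<close>
    have near: "L t \<in> Ph \<and> pnorm (V N t - L t) \<le> 4 * (C * exp (\<omega> * \<tau>) * (2 * \<epsilon> N))" if t: "t \<in> {0..\<tau>}" for t N \<tau>
    proof -
      have l: "(\<lambda>m. V N t - V m t) \<longlonglongrightarrow> V N t - L t" using t by (intro tendsto_intros lim) auto
      have M: "0 \<le> C * exp (\<omega> * \<tau>) * (2 * \<epsilon> N)" using C \<epsilon>[of N] by simp
      have ev: "\<forall>\<^sub>F m in sequentially. V N t - V m t \<in> Ph \<and> pnorm (V N t - V m t) \<le> C * exp (\<omega> * \<tau>) * (2 * \<epsilon> N)"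
        using eventually_ge_at_top[of N]
        by (rule eventually_mono) (intro conjI phase_diff VP diffT[OF t], auto)
      from pnorm_lsc[OF l M ev] have "V N t - L t \<in> Ph" "pnorm (V N t - L t) \<le> 4 * (C * exp (\<omega> * \<tau>) * (2 * \<epsilon> N))" .
      then show ?thesis using phase_diff[OF VP[of N t], of "V N t - L t"] by simp
    qed
    have LP: "L t \<in> Ph" if "t \<ge> 0" for t using near[of t t 0] that by simp
    have "L 0 = U0"
    proof -
      have "norm (V n 0 - U0) \<le> (1 + sqrt k) * \<epsilon> n" for n
      proof -
        have "norm (V n 0 - U0) \<le> (1 + sqrt k) * pnorm (V n 0 - U0)" by (intro norm_le_pnorm phase_diff VP U0)
        also have "\<dots> \<le> (1 + sqrt k) * \<epsilon> n" using W0[of n] k_pos by (intro mult_left_mono) (auto simp: V_def)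
        finally show ?thesis .
      qed
      moreover have "(\<lambda>n. (1 + sqrt k) * \<epsilon> n) \<longlonglongrightarrow> (1 + sqrt k) * 0" by (intro tendsto_intros \<epsilon>_lim)
      ultimately have "(\<lambda>n. V n 0 - U0) \<longlonglongrightarrow> 0"
        by (intro Lim_null_comparison[of "\<lambda>n. V n 0 - U0" "\<lambda>n. (1 + sqrt k) * \<epsilon> n"]) auto
      then have "(\<lambda>n. V n 0) \<longlonglongrightarrow> U0" by (rule LIM_zero_cancel)
      then show ?thesis using lim[of 0] LIMSEQ_unique by blast
    qed
    moreover have "cont_phase D A \<alpha> L"
      unfolding cont_phase_iff
    proof (intro conjI allI impI)
      show "L t \<in> Ph" if "t \<ge> 0" for t using LP that .
      fix t e :: real assume t: "t \<ge> 0" and e: "e > 0"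
      \<comment> \<open>A three-term argument: \<open>L\<close> is uniformly close to
        \<open>V N\<close> on \<open>{0..t + 1}\<close>, and \<open>V N\<close> is continuous in
        \<open>pnorm\<close> because \<open>W N\<close> is continuous in the base norm.\<close>
      let ?K = "4 * (C * exp (\<omega> * (t + 1)) * 2)"
      have "?K \<ge> 0" using C by simp
      then obtain N where N: "?K * \<epsilon> N < e / 3" using small[of "e / 3" ?K] e by auto
      have n: "pnorm (V N s - L s) < e / 3" if "s \<in> {0..t + 1}" for s
      proof -
        have "pnorm (V N s - L s) \<le> 4 * (C * exp (\<omega> * (t + 1)) * (2 * \<epsilon> N))" using near[OF that] by blast
        also have "\<dots> < e / 3" using N by (simp add: mult_ac)
        finally show ?thesis .
      qed
      define k' where "k' = 2 * sqrt k + 2 * k"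
      have k: "k' > 0" using k_pos by (simp add: k'_def add_pos_pos)
      have "e / 3 / k' > 0" using e k by simp
      then obtain d where d: "d > 0" "\<And>s. s \<in> {0..} \<Longrightarrow> dist s t < d \<Longrightarrow> dist (W N s) (W N t) < e / 3 / k'"
        using solves_continuous[OF W[of N]] t unfolding continuous_on_iff by (metis atLeast_iff)
      have "pnorm (L s - L t) < e" if s: "s \<ge> 0" "\<bar>s - t\<bar> < min d 1" for s
      proof -
        have "V N s - V N t = map4 R (W N s - W N t)" by (simp add: V_def R4.diff)
        then have "pnorm (V N s - V N t) \<le> k' * norm (W N s - W N t)" by (simp only: pnorm_map4_R_le k'_def)
        also have "\<dots> < k' * (e / 3 / k')"
          using d(2)[of s] s k by (intro mult_strict_left_mono) (auto simp: dist_norm)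
        also have "\<dots> = e / 3" using k by simp
        finally have 2: "pnorm (V N s - V N t) < e / 3" .
        have 1: "pnorm (L s - V N s) < e / 3"
          using n[of s] s pnorm_minus_commute[OF LP[OF s(1)] VP, of N s] by auto
        have 3: "pnorm (V N t - L t) < e / 3" using n[of t] t by simp
        show ?thesis
          using 1 2 3 pnorm_diff_triangle[OF LP[OF s(1)] VP LP[OF t], of N s]
            pnorm_diff_triangle[OF VP VP LP[OF t], of N s N t] by linarith
      qed
      then show "\<exists>d>0. \<forall>s\<ge>0. \<bar>s - t\<bar> < d \<longrightarrow> pnorm (L s - L t) < e"
        using d(1) by (intro exI[of _ "min d 1"]) auto
    qed
    moreover have "pnorm (L t) \<le> C * exp (\<omega> * t) * pnorm U0" if t: "t \<ge> 0" for t
    proof -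
      let ?c = "C * exp (\<omega> * t)"
      have c: "?c \<ge> 0" using C by simp
      \<comment> \<open>The \<open>9\<close> is \<open>4 * 2\<close> from the distance of
        \<open>L t\<close> to \<open>V n t\<close>, plus \<open>1\<close> from the approximation of
        the initial datum.\<close>
      have le: "pnorm (L t) \<le> ?c * pnorm U0 + 9 * ?c * \<epsilon> n" for n
      proof -
        have "pnorm (V n 0) \<le> \<epsilon> n + pnorm U0"
          using pnorm_triangle[OF phase_diff[OF VP U0] U0, of n 0] W0[of n] by (simp add: V_def)
        then have "?c * pnorm (V n 0) \<le> ?c * (\<epsilon> n + pnorm U0)" using c by (rule mult_left_mono)
        moreover have "pnorm (V n t) \<le> ?c * pnorm (V n 0)" using bnd[OF W t] by (simp add: V_def)
        moreover have "pnorm (L t - V n t) \<le> 4 * (?c * (2 * \<epsilon> n))"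
          using near[of t t n] t pnorm_minus_commute[OF LP[OF t] VP, of n t] by simp
        moreover have "pnorm (L t) \<le> pnorm (L t - V n t) + pnorm (V n t)"
          using pnorm_triangle[OF phase_diff[OF LP[OF t] VP] VP, of n t n t] by simp
        ultimately have "pnorm (L t) \<le> 4 * (?c * (2 * \<epsilon> n)) + ?c * (\<epsilon> n + pnorm U0)" by linarith
        then show ?thesis by (simp add: algebra_simps)
      qed
      have "(\<lambda>n. ?c * pnorm U0 + 9 * ?c * \<epsilon> n) \<longlonglongrightarrow> ?c * pnorm U0 + 9 * ?c * 0"
        by (intro tendsto_intros \<epsilon>_lim)
      then show ?thesis using le by (intro LIMSEQ_le_const) auto
    qed
    ultimately show ?thesis using L by blast
  qed
  then show ?thesis using C by blast
qed

section \<open>Weak solutions\<close>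

lemma cont_phase_imp_continuous_on:
  assumes "cont_phase D A \<alpha> U"
  shows "continuous_on {0..} U"
  unfolding continuous_on_iff
proof (intro ballI allI impI)
  fix t e :: real assume t: "t \<in> {0..}" and e: "e > 0"
  have P: "\<And>t. t \<ge> 0 \<Longrightarrow> U t \<in> Ph"
    and c: "\<And>t e. t \<ge> 0 \<Longrightarrow> e > 0 \<Longrightarrow> \<exists>d>0. \<forall>s\<ge>0. \<bar>s - t\<bar> < d \<longrightarrow> pnorm (U s - U t) < e"
    using assms unfolding cont_phase_iff by blast+
  define k' where "k' = 1 + sqrt k"
  have k': "k' > 0" using k_pos by (simp add: k'_def add_pos_nonneg)
  obtain d where d: "d > 0" "\<And>s. s \<ge> 0 \<Longrightarrow> \<bar>s - t\<bar> < d \<Longrightarrow> pnorm (U s - U t) < e / k'"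
    using c[of t "e / k'"] t e k' by auto
  have "dist (U s) (U t) < e" if s: "s \<in> {0..}" "dist s t < d" for s
  proof -
    have "norm (U s - U t) \<le> k' * pnorm (U s - U t)"
      unfolding k'_def using s t by (intro norm_le_pnorm phase_diff P) auto
    also have "\<dots> < k' * (e / k')" using d(2)[of s] s k' by (intro mult_strict_left_mono) (auto simp: dist_real_def)
    also have "\<dots> = e" using k' by simp
    finally show ?thesis by (simp add: dist_norm)
  qed
  then show "\<exists>d>0. \<forall>s\<in>{0..}. dist s t < d \<longrightarrow> dist (U s) (U t) < e" using d(1) by blast
qed

lemma eq_of_dense_tests:
  assumes "\<And>\<psi>. \<psi> \<in> D \<Longrightarrow> inner x \<psi> = inner y \<psi>"
  shows "x = y"
proof -
  have "norm (x - y) \<le> 0"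
    by (rule norm_le_of_dense_tests[OF dense]) (simp_all add: inner_diff_left assms)
  then show ?thesis by simp
qed

lemma weak_solution_cont_phase:
  "weak_solution D A \<alpha> \<beta> \<gamma> \<kappa> \<eta> U0 U \<Longrightarrow> cont_phase D A \<alpha> U"
  unfolding weak_solution_def by (rule conjunct1)

text \<open>Testing the last two equations with \<open>\<psi> = R \<phi>\<close> replaces
  \<open>A \<psi>\<close> by an arbitrary \<phi>, so they become identities for \<open>R w\<close>
  and \<open>R \<theta>\<close> tested against the whole space.\<close>

lemma weak_solution_imp_solves:
  assumes "weak_solution D A \<alpha> \<beta> \<gamma> \<kappa> \<eta> U0 U"
  shows "solves R U" "U 0 = U0"
proof -
  define u v w \<theta> where defs: "u t = fst (U t)" "v t = fst (snd (U t))" "w t = fst (snd (snd (U t)))"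
    "\<theta> t = snd (snd (snd (U t)))" for t
  obtain u0 v0 w0 \<theta>0 where U0: "U0 = (u0, v0, w0, \<theta>0)" by (cases U0) auto
  have cont: "continuous_on {0..} U"
    by (rule cont_phase_imp_continuous_on[OF weak_solution_cont_phase[OF assms]])
  have eqs: "inner (u t) \<psi> = inner u0 \<psi> + integral {0..t} (\<lambda>s. inner (v s) \<psi>)"
    "inner (v t) \<psi> = inner v0 \<psi> + integral {0..t} (\<lambda>s. inner (w s) \<psi>)"
    "inner (w t) \<psi> = inner w0 \<psi> - integral {0..t} (\<lambda>s. \<alpha> * inner (w s) \<psi> + \<beta> * inner (v s) (A \<psi>)
        + \<gamma> * inner (u s) (A \<psi>) - \<eta> * inner (\<theta> s) (A \<psi>))"
    "inner (\<theta> t) \<psi> = inner \<theta>0 \<psi> - integral {0..t} (\<lambda>s. \<kappa> * inner (\<theta> s) (A \<psi>) + \<eta> * inner (w s) (A \<psi>)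
        + \<alpha> * \<eta> * inner (v s) (A \<psi>))"
    if "t \<ge> 0" "\<psi> \<in> D" for t \<psi>
    using assms that unfolding weak_solution_def defs U0 fst_conv snd_conv by blast+
  have U: "U t = (u t, v t, w t, \<theta> t)" for t by (simp add: defs)
  \<comment> \<open>At time zero the integrals vanish, and density of \<open>D\<close> identifies
    the values.\<close>
  have "u 0 = u0" "v 0 = v0" "w 0 = w0" "\<theta> 0 = \<theta>0"
    by (rule eq_of_dense_tests; simp add: eqs)+
  then show "U 0 = U0" by (simp add: U U0)
  show "solves R U"
  proof (rule solvesI[OF cont])
    fix \<tau> t :: real assume t: "t \<in> {0..\<tau>}"
    have "continuous_on {0..\<tau>} U" by (rule continuous_on_subset[OF cont]) auto
    then have c: "continuous_on {0..\<tau>} u" "continuous_on {0..\<tau>} v" "continuous_on {0..\<tau>} w" "continuous_on {0..\<tau>} \<theta>"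
      unfolding defs[abs_def] by (intro continuous_intros; assumption)+
    have "(u has_vector_derivative v t) (at t within {0..\<tau>})"
      by (rule weak_has_vector_derivative[OF dense c(2) _ t, where c = "inner u0"]) (use eqs(1) in auto)
    moreover have "(v has_vector_derivative w t) (at t within {0..\<tau>})"
      by (rule weak_has_vector_derivative[OF dense c(3) _ t, where c = "inner v0"]) (use eqs(2) in auto)
    moreover have "((\<lambda>t. R (w t)) has_vector_derivative
        \<eta> *\<^sub>R \<theta> t - \<beta> *\<^sub>R v t - \<gamma> *\<^sub>R u t - \<alpha> *\<^sub>R R (w t)) (at t within {0..\<tau>})"
    proof (rule weak_has_vector_derivative[OF closure_UNIV _ _ t, where c = "\<lambda>\<phi>. inner w0 (R \<phi>)"])
      show "continuous_on {0..\<tau>} (\<lambda>t. \<eta> *\<^sub>R \<theta> t - \<beta> *\<^sub>R v t - \<gamma> *\<^sub>R u t - \<alpha> *\<^sub>R R (w t))"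
        by (intro continuous_on_diff continuous_on_scaleR continuous_on_const R.continuous_on c)
      fix \<phi> s assume "s \<in> {0..\<tau>}"
      then have "inner (w s) (R \<phi>) = inner w0 (R \<phi>) + integral {0..s} (\<lambda>s. - (\<alpha> * inner (w s) (R \<phi>)
          + \<beta> * inner (v s) \<phi> + \<gamma> * inner (u s) \<phi> - \<eta> * inner (\<theta> s) \<phi>))"
        using eqs(3)[OF _ RD[of \<phi>], of s] by (simp add: AR integral_neg del: minus_diff_eq minus_add_distrib)
      also have "(\<lambda>s. - (\<alpha> * inner (w s) (R \<phi>) + \<beta> * inner (v s) \<phi> + \<gamma> * inner (u s) \<phi> - \<eta> * inner (\<theta> s) \<phi>))
          = (\<lambda>s. inner (\<eta> *\<^sub>R \<theta> s - \<beta> *\<^sub>R v s - \<gamma> *\<^sub>R u s - \<alpha> *\<^sub>R R (w s)) \<phi>)"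
        by (auto simp: inner_diff_left sym)
      finally show "inner (R (w s)) \<phi> = inner w0 (R \<phi>)
          + integral {0..s} (\<lambda>s. inner (\<eta> *\<^sub>R \<theta> s - \<beta> *\<^sub>R v s - \<gamma> *\<^sub>R u s - \<alpha> *\<^sub>R R (w s)) \<phi>)"
        by (simp only: sym)
    qed
    moreover have "((\<lambda>t. R (\<theta> t)) has_vector_derivative
        - (\<kappa> *\<^sub>R \<theta> t + \<eta> *\<^sub>R (w t + \<alpha> *\<^sub>R v t))) (at t within {0..\<tau>})"
    proof (rule weak_has_vector_derivative[OF closure_UNIV _ _ t, where c = "\<lambda>\<phi>. inner \<theta>0 (R \<phi>)"])
      show "continuous_on {0..\<tau>} (\<lambda>t. - (\<kappa> *\<^sub>R \<theta> t + \<eta> *\<^sub>R (w t + \<alpha> *\<^sub>R v t)))"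
        by (intro continuous_on_minus continuous_on_add continuous_on_scaleR continuous_on_const c)
      fix \<phi> s assume "s \<in> {0..\<tau>}"
      then have "inner (\<theta> s) (R \<phi>) = inner \<theta>0 (R \<phi>) + integral {0..s} (\<lambda>s. - (\<kappa> * inner (\<theta> s) \<phi>
          + \<eta> * inner (w s) \<phi> + \<alpha> * \<eta> * inner (v s) \<phi>))"
        using eqs(4)[OF _ RD[of \<phi>], of s] by (simp add: AR integral_neg del: minus_diff_eq minus_add_distrib)
      also have "(\<lambda>s. - (\<kappa> * inner (\<theta> s) \<phi> + \<eta> * inner (w s) \<phi> + \<alpha> * \<eta> * inner (v s) \<phi>))
          = (\<lambda>s. inner (- (\<kappa> *\<^sub>R \<theta> s + \<eta> *\<^sub>R (w s + \<alpha> *\<^sub>R v s))) \<phi>)"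
        by (auto simp: inner_add_left inner_diff_left algebra_simps)
      finally show "inner (R (\<theta> s)) \<phi> = inner \<theta>0 (R \<phi>)
          + integral {0..s} (\<lambda>s. inner (- (\<kappa> *\<^sub>R \<theta> s + \<eta> *\<^sub>R (w s + \<alpha> *\<^sub>R v s))) \<phi>)"
        by (simp only: sym)
    qed
    ultimately show "((\<lambda>t. evol_lhs R (U t)) has_vector_derivative evol_rhs R (U t)) (at t within {0..\<tau>})"
      unfolding U evol_lhs_def evol_rhs_def prod.case by (intro has_vector_derivative_Pair)
  qed
qed

text \<open>Pairing the last two components with \<open>A \<psi>\<close> undoes \<open>R\<close>,
  since \<open>inner (R x) (A \<psi>) = inner x \<psi>\<close>; the scalar fundamental theorem of
  calculus then gives the weak form.\<close>

lemma solves_imp_weak_solution: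
  assumes U: "solves R U" and c: "cont_phase D A \<alpha> U"
  shows "weak_solution D A \<alpha> \<beta> \<gamma> \<kappa> \<eta> (U 0) U"
  unfolding weak_solution_def
proof (rule conjI[OF c], intro allI ballI impI)
  fix t :: real and \<psi> assume t: "t \<ge> 0" and \<psi>: "\<psi> \<in> D"
  define u v w \<theta> where defs: "u t = fst (U t)" "v t = fst (snd (U t))" "w t = fst (snd (snd (U t)))"
    "\<theta> t = snd (snd (snd (U t)))" for t
  have Ueq: "U t = (u t, v t, w t, \<theta> t)" for t by (simp add: defs)
  have RA': "inner (R x) (A \<psi>) = inner x \<psi>" for x by (simp add: sym RA[OF \<psi>])
  have I: "(f has_integral F t - F 0) {0..t}"
    if "\<And>s. s \<in> {0..t} \<Longrightarrow> (F has_vector_derivative f s) (at s within {0..t})" for F f :: "real \<Rightarrow> real"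
    using fundamental_theorem_of_calculus[of 0 t F f] that t by blast
  have der: "((\<lambda>s. inner (evol_lhs R (U s)) \<phi>) has_vector_derivative inner (evol_rhs R (U s)) \<phi>) (at s within {0..t})"
    if "s \<in> {0..t}" for s \<phi>
    by (rule bounded_linear.has_vector_derivative[OF bounded_linear_inner_left solves_derivative[OF U that]])
  have J: "integral {0..t} (\<lambda>s. inner (evol_rhs R (U s)) \<phi>) = inner (evol_lhs R (U t)) \<phi> - inner (evol_lhs R (U 0)) \<phi>" for \<phi>
    by (rule integral_unique[OF I[OF der]])
  note J' = J[unfolded Ueq evol_lhs_def evol_rhs_def prod.case]
  have 1: "inner (u t) \<psi> = inner (u 0) \<psi> + integral {0..t} (\<lambda>s. inner (v s) \<psi>)"
    using J'[of "(\<psi>, 0, 0, 0)"] by simp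
  have 2: "inner (v t) \<psi> = inner (v 0) \<psi> + integral {0..t} (\<lambda>s. inner (w s) \<psi>)"
    using J'[of "(0, \<psi>, 0, 0)"] by simp
  have "integral {0..t} (\<lambda>s. - inner (\<eta> *\<^sub>R \<theta> s - \<beta> *\<^sub>R v s - \<gamma> *\<^sub>R u s - \<alpha> *\<^sub>R R (w s)) (A \<psi>))
      = - (inner (w t) \<psi> - inner (w 0) \<psi>)"
    using J'[of "(0, 0, A \<psi>, 0)"] by (simp add: RA' integral_neg)
  then have 3: "inner (w t) \<psi> = inner (w 0) \<psi> - integral {0..t} (\<lambda>s. \<alpha> * inner (w s) \<psi> + \<beta> * inner (v s) (A \<psi>)
        + \<gamma> * inner (u s) (A \<psi>) - \<eta> * inner (\<theta> s) (A \<psi>))"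
    by (simp add: inner_diff_left RA' algebra_simps)
  have "integral {0..t} (\<lambda>s. - inner (- (\<kappa> *\<^sub>R \<theta> s + \<eta> *\<^sub>R (w s + \<alpha> *\<^sub>R v s))) (A \<psi>))
      = - (inner (\<theta> t) \<psi> - inner (\<theta> 0) \<psi>)"
    using J'[of "(0, 0, 0, A \<psi>)"] by (simp only: integral_neg) (simp add: RA')
  then have 4: "inner (\<theta> t) \<psi> = inner (\<theta> 0) \<psi> - integral {0..t} (\<lambda>s. \<kappa> * inner (\<theta> s) (A \<psi>) + \<eta> * inner (w s) (A \<psi>)
        + \<alpha> * \<eta> * inner (v s) (A \<psi>))"
    by (simp add: inner_add_left inner_diff_left algebra_simps)
  show "inner (fst (U t)) \<psi> = inner (fst (U 0)) \<psi> + integral {0..t} (\<lambda>s. inner (fst (snd (U s))) \<psi>) \<and>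
    inner (fst (snd (U t))) \<psi> = inner (fst (snd (U 0))) \<psi> + integral {0..t} (\<lambda>s. inner (fst (snd (snd (U s)))) \<psi>) \<and>
    inner (fst (snd (snd (U t)))) \<psi> = inner (fst (snd (snd (U 0)))) \<psi>
      - integral {0..t} (\<lambda>s. \<alpha> * inner (fst (snd (snd (U s)))) \<psi> + \<beta> * inner (fst (snd (U s))) (A \<psi>)
        + \<gamma> * inner (fst (U s)) (A \<psi>) - \<eta> * inner (snd (snd (snd (U s)))) (A \<psi>)) \<and>
    inner (snd (snd (snd (U t)))) \<psi> = inner (snd (snd (snd (U 0)))) \<psi>
      - integral {0..t} (\<lambda>s. \<kappa> * inner (snd (snd (snd (U s)))) (A \<psi>) + \<eta> * inner (fst (snd (snd (U s)))) (A \<psi>)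
        + \<alpha> * \<eta> * inner (fst (snd (U s))) (A \<psi>))"
    unfolding defs[symmetric] by (intro conjI 1 2 3 4)
qed

lemma weak_solution_iff:
  "weak_solution D A \<alpha> \<beta> \<gamma> \<kappa> \<eta> U0 U \<longleftrightarrow> solves R U \<and> U 0 = U0 \<and> cont_phase D A \<alpha> U"
  using weak_solution_imp_solves[of U0 U] solves_imp_weak_solution[of U] weak_solution_cont_phase[of U0 U]
  by blast

end

section \<open>The solution semigroup\<close>

theorem theorem4p2:
  fixes D :: "'a::{real_inner,complete_space} set" and A :: "'a \<Rightarrow> 'a"
    and \<alpha> \<beta> \<gamma> \<kappa> \<eta> :: real
  assumes "strictly_pos_selfadjoint D A"
    and "\<alpha> > 0" "\<beta> > 0" "\<gamma> > 0" "\<kappa> > 0"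
    and "\<gamma> - \<alpha> * \<beta> \<ge> 0"
  defines "S \<equiv> sol_op D A \<alpha> \<beta> \<gamma> \<kappa> \<eta>"
  shows "(\<forall>U0\<in>phase D A. (\<exists>U. weak_solution D A \<alpha> \<beta> \<gamma> \<kappa> \<eta> U0 U) \<and>
            (\<forall>U U'. weak_solution D A \<alpha> \<beta> \<gamma> \<kappa> \<eta> U0 U \<longrightarrow> weak_solution D A \<alpha> \<beta> \<gamma> \<kappa> \<eta> U0 U'
                \<longrightarrow> (\<forall>t\<ge>0. U t = U' t))) \<and>
    (\<forall>t\<ge>0. \<forall>U0\<in>phase D A. \<forall>e>0. \<exists>d>0. \<forall>V0\<in>phase D A.
            phase_norm D A \<alpha> (V0 - U0) < d \<longrightarrow> phase_norm D A \<alpha> (S t V0 - S t U0) < e) \<and>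
    (\<forall>t\<ge>0. \<forall>U0\<in>phase D A. S t U0 \<in> phase D A) \<and>
    (\<forall>U0\<in>phase D A. S 0 U0 = U0) \<and>
    (\<forall>t\<ge>0. \<forall>s\<ge>0. \<forall>U0\<in>phase D A. S (t + s) U0 = S t (S s U0)) \<and>
    (\<forall>U0\<in>phase D A. cont_phase D A \<alpha> (\<lambda>t. S t U0))"
proof -
  obtain R k where "spsa_inverse D A R k"
    using strictly_pos_selfadjoint_imp_spsa_inverse[OF assms(1)] by blast
  then interpret mgt_system D A R k \<alpha> \<beta> \<gamma> \<kappa> \<eta>
    by (intro mgt_system.intro mgt_system_axioms.intro assms(2-6))
  let ?ws = "weak_solution D A \<alpha> \<beta> \<gamma> \<kappa> \<eta>"
  obtain C where C: "C \<ge> 0" and ex: "\<And>U0. U0 \<in> Ph \<Longrightarrow> \<exists>V. solves R V \<and> V 0 = U0 \<and> cont_phase D A \<alpha> V \<and>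
      (\<forall>t\<ge>0. pnorm (V t) \<le> C * exp (\<omega> * t) * pnorm U0)"
    using phase_solution_exists by blast
  have uniq: "U t = U' t" if "?ws U0 U" "?ws U0 U'" "t \<ge> 0" for U0 U U' t
    using that solves_unique[of U U' t] unfolding weak_solution_iff by auto
  \<comment> \<open>By uniqueness all weak solutions from \<open>U0\<close> share their value at
    \<open>t\<close>, so the definite description in \<open>sol_op\<close> denotes it.\<close>
  have S_eq: "S t U0 = U t" if U: "?ws U0 U" and t: "t \<ge> 0" for U0 U t
    unfolding S_def sol_op_def using U uniq[OF _ U t] by (intro the_equality) blast+
  have exw: "\<exists>U. ?ws U0 U \<and> (\<forall>t\<ge>0. pnorm (U t) \<le> C * exp (\<omega> * t) * pnorm U0)" if "U0 \<in> Ph" for U0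
    using ex[OF that] unfolding weak_solution_iff by blast
  \<comment> \<open>By linearity the difference of two solutions is the solution with data
    \<open>V0 - U0\<close>, whose growth bound gives Lipschitz dependence for each fixed
    \<open>t\<close>.\<close>
  have S_bound: "S t U0 \<in> Ph \<and> S t V0 \<in> Ph \<and> pnorm (S t V0 - S t U0) \<le> C * exp (\<omega> * t) * pnorm (V0 - U0)"
    if P: "U0 \<in> Ph" "V0 \<in> Ph" and t: "t \<ge> 0" for U0 V0 t
  proof -
    obtain U V W where U: "?ws U0 U" and V: "?ws V0 V" and W: "?ws (V0 - U0) W"
      and W_le: "pnorm (W t) \<le> C * exp (\<omega> * t) * pnorm (V0 - U0)"
      using exw[OF P(1)] exw[OF P(2)] exw[OF phase_diff[OF P(2,1)]] t by blast
    have "solves R (\<lambda>t. V t - U t)" using U V unfolding weak_solution_iff by (intro solves_diff[OF blin]) auto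
    then have "V t - U t = W t"
      using U V W t solves_unique[of "\<lambda>t. V t - U t" W t] unfolding weak_solution_iff by auto
    moreover have "U t \<in> Ph" "V t \<in> Ph" using U V t unfolding weak_solution_iff cont_phase_iff by auto
    ultimately show ?thesis using W_le by (simp add: S_eq[OF U t] S_eq[OF V t])
  qed
  have S_continuous: "\<exists>d>0. \<forall>V0\<in>Ph. phase_norm D A \<alpha> (V0 - U0) < d \<longrightarrow> phase_norm D A \<alpha> (S t V0 - S t U0) < e"
    if t: "t \<ge> 0" and U0: "U0 \<in> Ph" and e: "e > 0" for t U0 e
  proof -
    define c1 where "c1 = 3 + \<alpha> + \<alpha> * sqrt k"
    define c2 where "c2 = 2 / \<alpha> + 3 + \<alpha> * sqrt k"
    \<comment> \<open>The growth bound framed by the two constants of the norm equivalence; the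
      added \<open>1\<close> makes \<open>K\<close> positive.\<close>
    define K where "K = c1 * (C * exp (\<omega> * t) * c2) + 1"
    have c: "c1 \<ge> 0" "c2 \<ge> 0" using \<alpha>_pos k_pos by (simp_all add: c1_def c2_def)
    have K: "K > 0" using c C by (simp add: K_def add_nonneg_pos)
    have "phase_norm D A \<alpha> (S t V0 - S t U0) < e"
      if V0: "V0 \<in> Ph" and d: "phase_norm D A \<alpha> (V0 - U0) < e / K" for V0
    proof -
      note b = S_bound[OF U0 V0 t]
      have "phase_norm D A \<alpha> (S t V0 - S t U0) \<le> c1 * pnorm (S t V0 - S t U0)"
        unfolding c1_def using b by (intro phase_norm_le_pnorm phase_diff) auto
      also have "\<dots> \<le> c1 * (C * exp (\<omega> * t) * pnorm (V0 - U0))" using b c by (intro mult_left_mono) auto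
      also have "\<dots> \<le> c1 * (C * exp (\<omega> * t) * (c2 * phase_norm D A \<alpha> (V0 - U0)))"
        unfolding c2_def using c C U0 V0 by (intro mult_left_mono pnorm_le_phase_norm phase_diff) auto
      also have "\<dots> \<le> K * phase_norm D A \<alpha> (V0 - U0)"
        by (cases "V0 - U0") (simp add: K_def phase_norm_def algebra_simps)
      also have "\<dots> < K * (e / K)" using d K by (intro mult_strict_left_mono)
      also have "\<dots> = e" using K by simp
      finally show ?thesis .
    qed
    then show ?thesis using e K by (intro exI[of _ "e / K"]) auto
  qed
  have S_add: "S (t + s) U0 = S t (S s U0)" if ts: "t \<ge> 0" "s \<ge> 0" and U0: "U0 \<in> Ph" for t s U0
  proof -
    obtain U where U: "?ws U0 U" using exw[OF U0] by blast
    have P: "U s \<in> Ph" using U ts(2) unfolding weak_solution_iff cont_phase_iff by blast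
    obtain V where V: "?ws (U s) V" using exw[OF P] by blast
    \<comment> \<open>The shifted solution and the one restarted from \<open>U s\<close> have the
      same initial value.\<close>
    have "U (t + s) = V t"
      using U V ts solves_shift[of R U s] solves_unique[of "\<lambda>t. U (t + s)" V t]
      unfolding weak_solution_iff by auto
    then show ?thesis
      using ts by (simp add: S_eq[OF U] S_eq[OF V])
  qed
  have S_0: "S 0 U0 = U0" if U0: "U0 \<in> Ph" for U0
    using exw[OF U0] S_eq[of U0 _ 0] unfolding weak_solution_iff by fastforce
  have S_cont_phase: "cont_phase D A \<alpha> (\<lambda>t. S t U0)" if U0: "U0 \<in> Ph" for U0
  proof -
    obtain U where U: "?ws U0 U" using exw[OF U0] by blast
    then have "cont_phase D A \<alpha> U" by (rule weak_solution_cont_phase)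
    then show ?thesis unfolding cont_phase_def by (simp add: S_eq[OF U])
  qed
  have S_phase: "S t U0 \<in> Ph" if "t \<ge> 0" "U0 \<in> Ph" for t U0 using S_bound[OF that(2,2,1)] by blast
  have ex_ws: "\<exists>U. ?ws U0 U" if "U0 \<in> Ph" for U0 using exw[OF that] by blast
  show ?thesis
    by (intro conjI ballI allI impI)
      ((rule ex_ws, assumption | rule S_0, assumption | rule S_add, assumption+ | rule uniq, assumption+
        | rule S_continuous, assumption+ | rule S_phase, assumption+ | rule S_cont_phase, assumption)+)
qed

end
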